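(* Let $K$ be an algebraically closed field, $n\geqslant 3$, and let $\varphi:K[C_n]\to M_j(K)$ be an irreducible representation of $K[C_n]$. If $\varphi(K[I_{n-3}])\neq 0$ set $i=n-2$; otherwise let $i$ be the minimal element of $\{-1,0,\ldots,n-3\}$ such that $\varphi(K[I_i])=0$. 1) If $i\geqslant 0$ then a) either $\varphi(K[M_i])\neq 0$ and the representation $\varphi$ is induced by a representation of $K_0[M_i]$; b) or $\varphi(K[M_i])=0$, and the representation $\varphi$ is one-dimensional and induced by an idempotent $e\in I_{i-1}\setminus I_i$; in particular $\varphi(e)=1$. 2) If $i=-1$ then the representation $\varphi$ is one-dimensional and induced by an idempotent $e\in C_n\setminus I_{-1}$; in particular $\varphi(e)=1$.
   Context: For $n\geqslant 3$, $C_n$ is the Hecke--Kiselman monoid of the oriented cycle $1\to 2\to\cdots\to n\to 1$: the monoid generated by $x_1,\ldots,x_n$ with relations $x_i^2=x_i$; $x_ix_j=x_jx_i$ if $i,j$ are not connected by an arrow; and $x_ix_jx_i=x_jx_ix_j=x_ix_j$ if there is an arrow $i\to j$. $K[C_n]$ is its monoid algebra; for a subset $X\subseteq C_n$, $K[X]$ is the linear span of $X$ in $K[C_n]$. An irreducible representation $K[C_n]\to M_j(K)$ ($j\geqslant 1$) is an algebra homomorphism making $K^j$ a simple module (as $K$ is algebraically closed, this means it is surjective). For $i=0,\ldots,n-2$ put $s_i=x_n(x_1x_2\cdots x_i)(x_{n-1}x_{n-2}\cdots x_{i+1})\in C_n$ (for $i=0$ the first bracket is empty), and let $\langle s_i\rangle$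 be the cyclic submonoid generated by $s_i$. Define the ideals $I_i=\{x\in C_n: C_nxC_n\cap\langle s_i\rangle=\emptyset\}$ for $i=0,\ldots,n-2$ and $I_{-1}=I_0\cup C_ns_0C_n$. It is known that $\emptyset=I_{n-2}\subseteq I_{n-3}\subseteq\cdots\subseteq I_0\subseteq I_{-1}\subseteq C_n$. For $i=0,\ldots,n-2$, $M_i$ is the ideal of the Rees quotient $C_n/I_i$ generated by (the image of) $s_i$, with zero element $\theta$ included (if $I_i=\emptyset$, then $C_n/I_i$ means $C_n$ with a zero $\theta$ adjoined). Thus $M_i\setminus\{\theta\}=C_ns_iC_n\setminus I_i$; it is known that this is contained in $I_{i-1}\setminus I_i$ and that $M_i$ is a semigroup of matrix type over the infinite cyclic semigroup generated by $s_i$. $K[M_i]\subseteq K[C_n]$ is the linear span of $M_i\setminus\{\theta\}$, and $K_0[M_i]$ is the contracted semigroup algebra of $M_i$ (semigroup algebra modulo $K\theta$). If $\varphi$ vanishes on $K[I_i]$, it factors through $K[C_n]/K[I_i]$, which contains $K_0[M_i]$ as an ideal; $\varphi$ is said to be induced by a representation $\psi:K_0[M_i]\to M_j(K)$ if $\psi$ is irreducible (surjective) and is the restriction to $K_0[M_i]$ of the map so obtained from $\varphi$ (then $\varphi(x)=\psi(xf)$ for all $x$, where $f\in K_0[M_i]$ is any element with $\psi(f)=1$). A one-dimensional representation is induced by an idempotent $e=e^2\in C_n$ if it is the map $\varphi_e:K[C_n]\to K$ given on $m\in C_n$ by $\varphi_e(m)=1$ if $e\in C_nmC_n$ and $\varphi_e(m)=0$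 otherwise. *)

theory Defs
  imports
    "HOL-Analysis.Cartesian_Space"
    "HOL-Computational_Algebra.Polynomial"
    "HOL-Algebra.Module"
begin

section \<open>Monoids given by generators and relations\<close>

inductive pres_cong :: "'g set \<Rightarrow> ('g list \<times> 'g list) set \<Rightarrow> 'g list \<Rightarrow> 'g list \<Rightarrow> bool"
  for X :: "'g set" and R :: "('g list \<times> 'g list) set"
where
  refl: "u \<in> lists X \<Longrightarrow> pres_cong X R u u"
| sym: "pres_cong X R u v \<Longrightarrow> pres_cong X R v u"
| trans: "pres_cong X R u v \<Longrightarrow> pres_cong X R v w \<Longrightarrow> pres_cong X R u w"
| rel: "(u, v) \<in> R \<Longrightarrow> u \<in> lists X \<Longrightarrow> v \<in> lists X \<Longrightarrow> a \<in> lists X \<Longrightarrow> b \<in> lists X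
        \<Longrightarrow> pres_cong X R (a @ u @ b) (a @ v @ b)"

definition pres_class :: "'g set \<Rightarrow> ('g list \<times> 'g list) set \<Rightarrow> 'g list \<Rightarrow> 'g list set" where
  "pres_class X R w = {v. pres_cong X R w v}"

definition presented_monoid :: "'g set \<Rightarrow> ('g list \<times> 'g list) set \<Rightarrow> 'g list set monoid" where
  "presented_monoid X R =
     \<lparr> carrier = pres_class X R ` lists X,
       mult = (\<lambda>A B. \<Union>u\<in>A. \<Union>v\<in>B. pres_class X R (u @ v)),
       one = pres_class X R [] \<rparr>"


section \<open>The Hecke--Kiselman monoid of the oriented cycle\<close>

definition cycle_arrow :: "nat \<Rightarrow> nat \<Rightarrow> nat \<Rightarrow> bool" where
  "cycle_arrow n i j \<longleftrightarrow> i \<in> {1..n} \<and> j = (if i = n then 1 else i + 1)"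

definition hk_relations :: "nat \<Rightarrow> (nat list \<times> nat list) set" where
  "hk_relations n =
     {([i, i], [i]) | i. i \<in> {1..n}}
   \<union> {([i, j], [j, i]) | i j. i \<in> {1..n} \<and> j \<in> {1..n}
        \<and> \<not> cycle_arrow n i j \<and> \<not> cycle_arrow n j i}
   \<union> {([i, j, i], [i, j]) | i j. cycle_arrow n i j}
   \<union> {([j, i, j], [i, j]) | i j. cycle_arrow n i j}"

definition hk :: "nat \<Rightarrow> nat list set monoid" where
  "hk n = presented_monoid {1..n} (hk_relations n)"

definition hk_gen :: "nat \<Rightarrow> nat \<Rightarrow> nat list set" where
  "hk_gen n i = pres_class {1..n} (hk_relations n) [i]"

definition mon_prod :: "('m, 'b) monoid_scheme \<Rightarrow> 'm list \<Rightarrow> 'm" where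
  "mon_prod G xs = foldr (mult G) xs (one G)"

definition hk_s :: "nat \<Rightarrow> nat \<Rightarrow> nat list set" where
  "hk_s n i = hk_gen n n
     \<otimes>\<^bsub>hk n\<^esub> mon_prod (hk n) (map (hk_gen n) [1..<i+1])
     \<otimes>\<^bsub>hk n\<^esub> mon_prod (hk n) (map (hk_gen n) (rev [i+1..<n]))"


section \<open>Ideals and Rees quotients\<close>

definition two_sided :: "('m, 'b) monoid_scheme \<Rightarrow> 'm \<Rightarrow> 'm set" where
  "two_sided G x = {a \<otimes>\<^bsub>G\<^esub> x \<otimes>\<^bsub>G\<^esub> b | a b. a \<in> carrier G \<and> b \<in> carrier G}"

definition cyclic_submonoid :: "('m, 'b) monoid_scheme \<Rightarrow> 'm \<Rightarrow> 'm set" where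
  "cyclic_submonoid G s = {s [^]\<^bsub>G\<^esub> k | k::nat. True}"

text \<open>The ideals \<open>I\<^sub>k\<close>, to be used for \<open>-1 \<le> k \<le> n - 2\<close>.\<close>

definition hk_ideal_nat :: "nat \<Rightarrow> nat \<Rightarrow> nat list set set" where
  "hk_ideal_nat n i =
     {x \<in> carrier (hk n). two_sided (hk n) x \<inter> cyclic_submonoid (hk n) (hk_s n i) = {}}"

definition hk_ideal :: "nat \<Rightarrow> int \<Rightarrow> nat list set set" where
  "hk_ideal n k = (if k = -1 then hk_ideal_nat n 0 \<union> two_sided (hk n) (hk_s n 0)
                   else hk_ideal_nat n (nat k))"

text \<open>The Rees quotient by an ideal \<open>I\<close>; \<open>None\<close> is the zero \<open>\<theta>\<close>.  For \<open>I = {}\<close> this is the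
  monoid with a new zero adjoined.\<close>

definition rees_proj :: "'m set \<Rightarrow> 'm \<Rightarrow> 'm option" where
  "rees_proj I x = (if x \<in> I then None else Some x)"

definition rees_quotient :: "('m, 'b) monoid_scheme \<Rightarrow> 'm set \<Rightarrow> 'm option monoid" where
  "rees_quotient G I =
     \<lparr> carrier = insert None (Some ` (carrier G - I)),
       mult = (\<lambda>a b. case (a, b) of
                  (Some x, Some y) \<Rightarrow> rees_proj I (x \<otimes>\<^bsub>G\<^esub> y)
                | _ \<Rightarrow> None),
       one = rees_proj I \<one>\<^bsub>G\<^esub> \<rparr>"

text \<open>\<open>M\<^sub>i\<close> as an ideal of the Rees quotient.  It is a semigroup with zero, without identity in
  general; the field \<^const>\<open>one\<close> inherited from the Rees quotient is not used.\<close>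

definition hk_M :: "nat \<Rightarrow> nat \<Rightarrow> nat list set option monoid" where
  "hk_M n i =
     (let Q = rees_quotient (hk n) (hk_ideal n (int i)) in
      Q\<lparr>carrier := insert None (two_sided Q (rees_proj (hk_ideal n (int i)) (hk_s n i)))\<rparr>)"

text \<open>\<open>M\<^sub>i - {\<theta>}\<close>, regarded as a subset of \<open>C\<^sub>n\<close>.\<close>

definition hk_M_nonzero :: "nat \<Rightarrow> nat \<Rightarrow> nat list set set" where
  "hk_M_nonzero n i = {x. Some x \<in> carrier (hk_M n i)}"


section \<open>Semigroup algebras\<close>

text \<open>The linear span of \<open>X\<close>: formal finite linear combinations of elements of \<open>X\<close>.\<close>

definition lin_span :: "'m set \<Rightarrow> ('m \<Rightarrow> 'k::field) set" where
  "lin_span X = {f. finite {x. f x \<noteq> 0} \<and> {x. f x \<noteq> 0} \<subseteq> X}"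

definition basis_elem :: "'m \<Rightarrow> 'm \<Rightarrow> 'k::field" where
  "basis_elem x = (\<lambda>y. if y = x then 1 else 0)"

definition semigroup_algebra :: "('m, 'b) monoid_scheme \<Rightarrow> ('k::field, 'm \<Rightarrow> 'k) Module.module" where
  "semigroup_algebra S =
     \<lparr> carrier = lin_span (carrier S),
       mult = (\<lambda>f g z. \<Sum>(x, y) \<in> {(x, y). f x \<noteq> 0 \<and> g y \<noteq> 0 \<and> x \<otimes>\<^bsub>S\<^esub> y = z}. f x * g y),
       one = basis_elem \<one>\<^bsub>S\<^esub>,
       zero = (\<lambda>_. 0),
       add = (\<lambda>f g x. f x + g x),
       smult = (\<lambda>c f x. c * f x) \<rparr>"

text \<open>The contracted algebra of a semigroup \<open>S\<close> with zero \<open>\<theta>\<close>, that is \<open>K[S]\<close> modulo \<open>K\<theta>\<close>: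
  every class has a unique representative with coefficient \<open>0\<close> at \<open>\<theta>\<close>.\<close>

definition contracted_algebra ::
    "('m, 'b) monoid_scheme \<Rightarrow> 'm \<Rightarrow> ('k::field, 'm \<Rightarrow> 'k) Module.module" where
  "contracted_algebra S \<theta> =
     (semigroup_algebra S)
       \<lparr> carrier := lin_span (carrier S - {\<theta>}),
         mult := (\<lambda>f g. (f \<otimes>\<^bsub>semigroup_algebra S\<^esub> g)(\<theta> := 0)) \<rparr>"

text \<open>The projection of \<open>K[G]\<close> onto \<open>K[G]/K[I]\<close>, the latter identified with the contracted
  algebra of the Rees quotient of \<open>G\<close> by \<open>I\<close>.\<close>

definition alg_proj :: "'m set \<Rightarrow> ('m \<Rightarrow> 'k::field) \<Rightarrow> 'm option \<Rightarrow> 'k" where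
  "alg_proj I f = (\<lambda>u. case u of None \<Rightarrow> 0 | Some x \<Rightarrow> (if x \<in> I then 0 else f x))"


section \<open>Representations\<close>

definition representation ::
    "('k::field, 'a) Module.module \<Rightarrow> ('a \<Rightarrow> 'k^'j^'j) \<Rightarrow> bool" where
  "representation A \<phi> \<longleftrightarrow>
     (\<forall>a\<in>carrier A. \<forall>b\<in>carrier A. \<phi> (a \<oplus>\<^bsub>A\<^esub> b) = \<phi> a + \<phi> b)
   \<and> (\<forall>c. \<forall>a\<in>carrier A. \<phi> (c \<odot>\<^bsub>A\<^esub> a) = (\<chi> p q. c * \<phi> a $ p $ q))
   \<and> (\<forall>a\<in>carrier A. \<forall>b\<in>carrier A. \<phi> (a \<otimes>\<^bsub>A\<^esub> b) = \<phi> a ** \<phi> b)"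

text \<open>\<open>K\<^sup>j\<close> is a simple module; \<open>A\<close> may lack an identity, so the action is required to be nonzero.
  Since index types are nonempty, \<open>j \<ge> 1\<close>.\<close>

definition irreducible_rep ::
    "('k::field, 'a) Module.module \<Rightarrow> ('a \<Rightarrow> 'k^'j^'j) \<Rightarrow> bool" where
  "irreducible_rep A \<phi> \<longleftrightarrow>
     representation A \<phi>
   \<and> (\<exists>a\<in>carrier A. \<phi> a \<noteq> 0)
   \<and> (\<forall>W. vec.subspace W \<and> (\<forall>a\<in>carrier A. \<forall>w\<in>W. \<phi> a *v w \<in> W) \<longrightarrow> W = {0} \<or> W = UNIV)"

definition unital_irreducible_rep ::
    "('k::field, 'a) Module.module \<Rightarrow> ('a \<Rightarrow> 'k^'j^'j) \<Rightarrow> bool" where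
  "unital_irreducible_rep A \<phi> \<longleftrightarrow> irreducible_rep A \<phi> \<and> \<phi> \<one>\<^bsub>A\<^esub> = mat 1"

definition vanishes_on :: "(('m \<Rightarrow> 'k::field) \<Rightarrow> 'k^'j^'j) \<Rightarrow> 'm set \<Rightarrow> bool" where
  "vanishes_on \<phi> X \<longleftrightarrow> (\<forall>f\<in>lin_span X. \<phi> f = 0)"

text \<open>\<open>\<phi>\<close> is induced by the representation \<open>\<psi>\<close> of \<open>K\<^sub>0[M\<^sub>i]\<close>: the map that \<open>\<phi>\<close> induces on
  \<open>K[C\<^sub>n]/K[I\<^sub>i]\<close> restricts to \<open>\<psi>\<close>.\<close>

definition induced_by_rep ::
    "nat \<Rightarrow> nat \<Rightarrow> ((nat list set \<Rightarrow> 'k::field) \<Rightarrow> 'k^'j^'j)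
       \<Rightarrow> ((nat list set option \<Rightarrow> 'k) \<Rightarrow> 'k^'j^'j) \<Rightarrow> bool" where
  "induced_by_rep n i \<phi> \<psi> \<longleftrightarrow>
     vanishes_on \<phi> (hk_ideal n (int i))
   \<and> irreducible_rep (contracted_algebra (hk_M n i) None) \<psi>
   \<and> \<psi> ` carrier (contracted_algebra (hk_M n i) None) = UNIV
   \<and> (\<forall>f\<in>carrier (semigroup_algebra (hk n)).
        alg_proj (hk_ideal n (int i)) f \<in> carrier (contracted_algebra (hk_M n i) None)
        \<longrightarrow> \<psi> (alg_proj (hk_ideal n (int i)) f) = \<phi> f)"

definition idempotent_rep :: "nat \<Rightarrow> nat list set \<Rightarrow> (nat list set \<Rightarrow> 'k::field) \<Rightarrow> 'k" where
  "idempotent_rep n e f =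
     (\<Sum>m | f m \<noteq> 0. f m * (if e \<in> two_sided (hk n) m then 1 else 0))"

text \<open>\<open>\<phi>\<close> is one-dimensional and equals \<open>\<phi>\<^sub>e\<close>, where \<open>M\<^sub>1(K)\<close> is identified with \<open>K\<close> via scalar
  matrices.\<close>

definition one_dim_induced_by ::
    "nat \<Rightarrow> nat list set \<Rightarrow> ((nat list set \<Rightarrow> 'k::field) \<Rightarrow> 'k^'j^'j) \<Rightarrow> bool" where
  "one_dim_induced_by n e \<phi> \<longleftrightarrow>
     CARD('j) = 1
   \<and> e \<in> carrier (hk n) \<and> e \<otimes>\<^bsub>hk n\<^esub> e = e
   \<and> (\<forall>f\<in>carrier (semigroup_algebra (hk n)). \<phi> f = mat (idempotent_rep n e f))"

end

theory Submission
  imports Defs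
begin

text \<open>
  The monoid \<open>C\<^sub>n\<close> acts on the integers: the generator \<open>x\<^sub>i\<close> moves every integer congruent to \<open>i + 1\<close>
  modulo \<open>n\<close> one step down and fixes all others, and in a word the rightmost letter acts first.
  The map of a word is monotone, commutes with the shift by \<open>n\<close> and never raises an integer. The
  action is faithful (\<open>cong_iff_word_act\<close>), and a map of this kind comes from a word as soon as it is
  the identity or takes some value at two consecutive integers (\<open>word_act_surj\<close>). So \<open>C\<^sub>n\<close> can be treated
  as a monoid of maps, ordered pointwise. Multiplying on either side can only lower a map; hence
  two elements that divide each other are equal, and proper multiples have strictly larger total
  displacement.

  The rank of a map is the number of its values modulo \<open>n\<close>, which equals the number of its ascents
  modulo \<open>n\<close>. The map of \<open>s\<^sub>i\<close> has rank \<open>r = n - 1 - i\<close>, and it permutes its image like a shift: the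
  image can be enumerated by the integers so that \<open>s\<^sub>i\<close> moves each of its members to the preceding
  one. Two divisibility statements follow. An element of rank at least \<open>r\<close> divides a power of \<open>s\<^sub>i\<close>
  (\<open>many_ascents_divides_power\<close>), so elements of \<open>I\<^sub>i\<close> have rank below \<open>r\<close>, and \<open>I\<^sub>n\<^sub>-\<^sub>2\<close> is empty. An
  element of rank at most \<open>r\<close> that moves every integer down by \<open>5 n\<close> or more is a multiple of \<open>s\<^sub>i\<close>
  (\<open>few_ascents_divisible\<close>). Consequently the elements of \<open>I\<^sub>i\<^sub>-\<^sub>1\<close> outside \<open>C\<^sub>n s\<^sub>i C\<^sub>n\<close> have bounded
  displacement.

  Now let \<open>\<phi>\<close> be irreducible with \<open>\<phi>(K[I\<^sub>i]) = 0\<close> and \<open>\<phi>(K[I\<^sub>i\<^sub>-\<^sub>1]) \<noteq> 0\<close>. If \<open>\<phi>\<close> does not vanish on \<open>K[M\<^sub>i]\<close>,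
  its restriction to this ideal modulo \<open>K[I\<^sub>i]\<close> is again irreducible, and surjective by Burnside's
  theorem (\<open>induced_on_principal_factor\<close>). If \<open>\<phi>\<close> vanishes on \<open>K[M\<^sub>i]\<close>, then among the elements of \<open>I\<^sub>i\<^sub>-\<^sub>1\<close>
  on which \<open>\<phi>\<close> does not vanish there is one, \<open>e\<close>, of largest displacement. For each \<open>a\<close> the product
  \<open>a e\<close> is \<open>e\<close> or is killed by \<open>\<phi>\<close> (\<open>ex_bottom_element\<close>). So every line \<open>K \<phi>(e) v\<close> is invariant, the
  representation has dimension one, \<open>\<phi>(e) = 1\<close>, and \<open>\<phi>(a) \<noteq> 0\<close> exactly when \<open>e\<close> is a multiple of \<open>a\<close>
  (\<open>one_dimensional\<close>). For \<open>i = -1\<close> the same argument is applied to the whole monoid and \<open>s\<^sub>0\<close>.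
\<close>

section \<open>Congruences on words\<close>

lemma cong_lists: "pres_cong X R u v \<Longrightarrow> u \<in> lists X \<and> v \<in> lists X"
  by (induction rule: pres_cong.induct) auto

lemma cong_context:
  assumes "pres_cong X R u v" "a \<in> lists X" "b \<in> lists X"
  shows "pres_cong X R (a @ u @ b) (a @ v @ b)"
  using assms
proof (induction rule: pres_cong.induct)
  case (refl u) thus ?case by (auto intro!: pres_cong.refl)
next
  case (sym u v) thus ?case by (blast intro: pres_cong.sym)
next
  case (trans u v w) thus ?case by (blast intro: pres_cong.trans)
next
  case (rel u v c d)
  have "pres_cong X R ((a @ c) @ u @ (d @ b)) ((a @ c) @ v @ (d @ b))"
    using rel by (intro pres_cong.rel) auto
  thus ?case by simp
qed

lemma cong_append:
  assumes "pres_cong X R u v" "pres_cong X R u' v'"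
  shows "pres_cong X R (u @ u') (v @ v')"
proof -
  have "pres_cong X R ([] @ u @ u') ([] @ v @ u')"
    using assms cong_lists[OF assms(2)] by (intro cong_context) auto
  moreover have "pres_cong X R (v @ u' @ []) (v @ v' @ [])"
    using assms cong_lists[OF assms(1)] by (intro cong_context) auto
  ultimately show ?thesis by (auto intro: pres_cong.trans)
qed

section \<open>The action of the cycle monoid on the integers\<close>

locale oriented_cycle =
  fixes n :: nat
  assumes n3: "n \<ge> 3"
begin

text \<open>
  Points, rather than indices, are the convenient names for letters: this is the one generator
  that moves the point \<open>z\<close>. With it the arrow from \<open>i\<close> to \<open>i + 1\<close>, including the arrow from \<open>n\<close> to \<open>1\<close>,
  becomes \<open>letter z\<close> to \<open>letter (z + 1)\<close> and no case distinction at \<open>n\<close> is left.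
\<close>

definition letter :: "int \<Rightarrow> nat" where
  "letter z = nat ((z - 2) mod int n) + 1"

definition letter_act :: "nat \<Rightarrow> int \<Rightarrow> int" where
  "letter_act i z = (if i = letter z then z - 1 else z)"

definition word_act :: "nat list \<Rightarrow> int \<Rightarrow> int" where
  "word_act w z = foldr letter_act w z"

abbreviation X where "X \<equiv> {1..n}"
abbreviation W where "W \<equiv> lists X"
abbreviation hkeq (infix \<open>\<approx>\<close> 50) where "u \<approx> v \<equiv> pres_cong X (hk_relations n) u v"

lemma word_act_simps [simp]: "word_act [] z = z" "word_act (i # w) z = letter_act i (word_act w z)"
  "word_act (u @ v) z = word_act u (word_act v z)"
  by (simp_all add: word_act_def)

lemma letter_range [simp]: "letter z \<in> X"
proof -
  have "(z - 2) mod int n < int n" "0 \<le> (z - 2) mod int n" using n3 by auto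
  thus ?thesis by (auto simp: letter_def)
qed

lemma letter_ge1 [simp]: "Suc 0 \<le> letter z" and letter_le [simp]: "letter z \<le> n"
  using letter_range[of z] by auto

lemma letter_eq_iff: "letter z = letter z' \<longleftrightarrow> z mod int n = z' mod int n"
proof -
  have "letter z = letter z' \<longleftrightarrow> (z - 2) mod int n = (z' - 2) mod int n"
    unfolding letter_def using n3 by (simp add: nat_eq_iff)
  also have "\<dots> \<longleftrightarrow> z mod int n = z' mod int n"
    by (metis diff_add_cancel mod_add_left_eq mod_diff_left_eq)
  finally show ?thesis .
qed

lemma letter_eq_iff_dvd: "letter z = letter z' \<longleftrightarrow> int n dvd z - z'"
  by (simp add: letter_eq_iff mod_eq_dvd_iff)

lemma letter_period [simp]: "letter (z + int n) = letter z"
  by (simp add: letter_eq_iff)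

lemma letter_shift: "letter y = letter z \<Longrightarrow> letter (y + k) = letter (z + k)"
  by (simp add: letter_eq_iff_dvd)

lemma letter_of_succ: "i \<in> X \<Longrightarrow> letter (int i + 1) = i"
  by (auto simp: letter_def nat_eq_iff)

text \<open>
  This is where \<open>n \<ge> 3\<close> enters: both neighbours of a vertex of the cycle are different vertices.
\<close>

lemma letter_neq [simp]: "letter (z - 1) \<noteq> letter z" "letter (z + 1) \<noteq> letter z" "letter (z + 1) \<noteq> letter (z - 1)"
  "letter z \<noteq> letter (z - 1)" "letter z \<noteq> letter (z + 1)" "letter (z - 1) \<noteq> letter (z + 1)"
  using n3 by (auto simp: letter_eq_iff_dvd dest!: zdvd_imp_le)

lemma cycle_arrow_letter: "cycle_arrow n (letter z) j \<longleftrightarrow> j = letter (z + 1)"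
proof -
  define y where "y = (z - 2) mod int n"
  have y: "0 \<le> y" "y < int n" using n3 by (auto simp: y_def)
  have e: "(z + 1 - 2) mod int n = (y + 1) mod int n"
    unfolding y_def by (metis add_diff_eq diff_add_eq mod_add_left_eq)
  have "letter z = nat y + 1" by (simp add: letter_def y_def)
  moreover have "letter (z + 1) = (if y + 1 = int n then 1 else nat y + 2)"
    unfolding letter_def e using y by (auto simp: nat_add_distrib)
  ultimately show ?thesis using y by (auto simp: cycle_arrow_def)
qed

lemma cycle_arrow_letter': "i \<in> X \<Longrightarrow> cycle_arrow n i (letter z) \<longleftrightarrow> i = letter (z - 1)"
proof -
  assume i: "i \<in> X"
  have "letter z = letter (int i + 1 + 1) \<longleftrightarrow> letter (int i + 1) = letter (z - 1)"
    unfolding letter_eq_iff_dvd by (subst dvd_minus_iff [symmetric]) (simp add: algebra_simps)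
  thus ?thesis using cycle_arrow_letter[of "int i + 1" "letter z"] letter_of_succ[OF i] by simp
qed

lemma letter_act_mono1: "letter_act i z \<le> letter_act i (z + 1)"
  by (auto simp: letter_act_def)

lemma letter_act_mono: "mono (letter_act i)"
proof (rule monoI)
  fix x y :: int assume "x \<le> y"
  thus "letter_act i x \<le> letter_act i y"
    by (induction y rule: int_ge_induct) (auto intro: order_trans letter_act_mono1)
qed

lemma letter_act_le: "letter_act i z \<le> z" by (simp add: letter_act_def)
lemma letter_act_period: "letter_act i (z + int n) = letter_act i z + int n" by (simp add: letter_act_def)

lemma word_act_mono: "x \<le> y \<Longrightarrow> word_act w x \<le> word_act w y"
  by (induction w) (auto intro: monoD[OF letter_act_mono])
lemma word_act_le: "word_act w z \<le> z"
  by (induction w) (auto intro: order_trans[OF letter_act_le])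
lemma word_act_period: "word_act w (z + int n) = word_act w z + int n"
  by (induction w) (auto simp: letter_act_period)

lemma word_act_unmoved: "letter z \<notin> set w \<Longrightarrow> word_act w z = z"
  by (induction w) (auto simp: letter_act_def)
lemma word_act_unmoved_iff: "word_act w z = z \<longleftrightarrow> letter z \<notin> set w"
proof
  show "word_act w z = z \<Longrightarrow> letter z \<notin> set w"
  proof (induction w)
    case (Cons k w)
    have "word_act w z = z" using Cons.prems word_act_le[of w z] letter_act_le[of k "word_act w z"] by simp
    thus ?case using Cons by (auto simp: letter_act_def split: if_splits)
  qed auto
qed (rule word_act_unmoved)

lemma letter_act_comm: "i \<in> X \<Longrightarrow> j \<in> X \<Longrightarrow> \<not> cycle_arrow n i j \<Longrightarrow> \<not> cycle_arrow n j i \<Longrightarrow>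
   letter_act i (letter_act j z) = letter_act j (letter_act i z)"
  by (auto simp: letter_act_def cycle_arrow_letter' cycle_arrow_letter)

lemma letter_act_arrow:
  assumes "cycle_arrow n i j"
  shows "letter_act i (letter_act j (letter_act i z)) = letter_act i (letter_act j z)"
    "letter_act j (letter_act i (letter_act j z)) = letter_act i (letter_act j z)"
proof -
  have i: "i \<in> X" using assms by (auto simp: cycle_arrow_def)
  then obtain y where y: "i = letter y" using letter_of_succ[of i] by metis
  have j: "j = letter (y + 1)" using assms y cycle_arrow_letter by blast
  consider "letter z = letter y" | "letter z = letter (y + 1)" | "letter z \<noteq> letter y" "letter z \<noteq> letter (y + 1)"
    by blast
  hence "letter_act i (letter_act j (letter_act i z)) = letter_act i (letter_act j z) \<and>
    letter_act j (letter_act i (letter_act j z)) = letter_act i (letter_act j z)"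
  proof cases
    case 1
    have "letter (z - 1) = letter (y - 1)" using letter_shift[OF 1, of "-1"] by simp
    thus ?thesis by (simp add: letter_act_def y j 1)
  next
    case 2
    have "letter (z - 1) = letter y" "letter (z - 1 - 1) = letter (y - 1)"
      using letter_shift[OF 2, of "-1"] letter_shift[OF 2, of "-2"] by simp_all
    thus ?thesis by (simp add: letter_act_def y j 2)
  next
    case 3
    thus ?thesis by (simp add: letter_act_def y j)
  qed
  thus "letter_act i (letter_act j (letter_act i z)) = letter_act i (letter_act j z)"
    "letter_act j (letter_act i (letter_act j z)) = letter_act i (letter_act j z)"
    by simp_all
qed

lemma word_act_cong: "u \<approx> v \<Longrightarrow> word_act u = word_act v"
proof (induction rule: pres_cong.induct)
  case (rel u v a b)
  have "word_act u z = word_act v z" for z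
    using rel(1) unfolding hk_relations_def
    by (auto simp: letter_act_comm letter_act_arrow) (auto simp: letter_act_def)
  thus ?case by (simp add: fun_eq_iff)
qed simp_all

section \<open>Consequences of the relations\<close>

lemma rel_idem: "[letter z, letter z] \<approx> [letter z]"
  using pres_cong.rel[of "[letter z, letter z]" "[letter z]" "hk_relations n" X "[]" "[]"]
  by (auto simp: hk_relations_def)

lemma rel_comm: "i \<in> X \<Longrightarrow> i \<noteq> letter (z - 1) \<Longrightarrow> i \<noteq> letter (z + 1) \<Longrightarrow> [letter z, i] \<approx> [i, letter z]"
  using pres_cong.rel[of "[letter z, i]" "[i, letter z]" "hk_relations n" X "[]" "[]"]
  by (auto simp: hk_relations_def cycle_arrow_letter cycle_arrow_letter')

lemma rel_left: "[letter z, letter (z + 1), letter z] \<approx> [letter z, letter (z + 1)]"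
  using pres_cong.rel[of "[letter z, letter (z+1), letter z]" "[letter z, letter (z+1)]" "hk_relations n" X "[]" "[]"]
  by (auto simp: hk_relations_def cycle_arrow_letter)

lemma rel_right: "[letter z, letter (z - 1), letter z] \<approx> [letter (z - 1), letter z]"
proof -
  have "([letter z, letter (z-1), letter z], [letter (z-1), letter z]) \<in> hk_relations n"
    using cycle_arrow_letter[of "z - 1" "letter z"] unfolding hk_relations_def by auto
  thus ?thesis
  using pres_cong.rel[of "[letter z, letter (z-1), letter z]" "[letter (z-1), letter z]" "hk_relations n" X "[]" "[]"]
  by auto
qed

text \<open>
  Go through \<open>u\<close> from its end. The letter on the right equals or commutes with the last letter of
  \<open>u\<close>, or that last letter is its successor \<open>x\<^sub>j\<close>. In the latter case the induction hypothesis
  supplies a further copy in front of \<open>x\<^sub>j\<close>, and the relation \<open>x\<^sub>i x\<^sub>j x\<^sub>i = x\<^sub>i x\<^sub>j\<close> applies.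
\<close>

lemma absorb_left:
  assumes "u \<in> W" "letter (z - 1) \<notin> set u"
  shows "[letter z] @ u @ [letter z] \<approx> [letter z] @ u"
  using assms
proof (induction u rule: rev_induct)
  case Nil thus ?case using rel_idem by simp
next
  case (snoc k u)
  have u: "u \<in> W" "k \<in> X" "k \<noteq> letter (z - 1)" and IH: "[letter z] @ u @ [letter z] \<approx> [letter z] @ u"
    using snoc by auto
  let ?i = "letter z"
  consider "k = ?i" | "k = letter (z + 1)" | "k \<noteq> ?i" "k \<noteq> letter (z + 1)" by blast
  thus ?case
  proof cases
    case 1 thus ?thesis using cong_context[OF rel_idem, of "[?i] @ u" "[]" z] u by simp
  next
    case 2
    have "[] @ ([?i] @ u) @ [k, ?i] \<approx> [] @ ([?i] @ u @ [?i]) @ [k, ?i]"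
      by (rule cong_context[OF pres_cong.sym[OF IH]]) (use u in auto)
    also have "\<dots> = ([?i] @ u) @ [?i, k, ?i] @ []" by simp
    finally have 1: "[?i] @ (u @ [k]) @ [?i] \<approx> ([?i] @ u) @ [?i, k, ?i] @ []" by simp
    have 2: "([?i] @ u) @ [?i, k, ?i] @ [] \<approx> ([?i] @ u) @ [?i, k] @ []"
      by (rule cong_context) (use u rel_left 2 in auto)
    have "[] @ ([?i] @ u @ [?i]) @ [k] \<approx> [] @ ([?i] @ u) @ [k]"
      by (rule cong_context[OF IH]) (use u in auto)
    hence 3: "([?i] @ u) @ [?i, k] @ [] \<approx> [?i] @ (u @ [k])" by simp
    show ?thesis using 1 2 3 by (blast intro: pres_cong.trans)
  next
    case 3
    have "([?i] @ u) @ [k, ?i] @ [] \<approx> ([?i] @ u) @ [?i, k] @ []"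
      by (rule cong_context) (use u 3 rel_comm in \<open>auto intro: pres_cong.sym\<close>)
    moreover have "[] @ ([?i] @ u @ [?i]) @ [k] \<approx> [] @ ([?i] @ u) @ [k]"
      by (rule cong_context[OF IH]) (use u in auto)
    ultimately show ?thesis by (auto intro: pres_cong.trans)
  qed
qed

text \<open>
  The mirror image of \<open>absorb_left\<close>, with the relation \<open>x\<^sub>j x\<^sub>i x\<^sub>j = x\<^sub>i x\<^sub>j\<close>.
\<close>

lemma absorb_right:
  assumes "u \<in> W" "letter (z + 1) \<notin> set u"
  shows "[letter z] @ u @ [letter z] \<approx> u @ [letter z]"
  using assms
proof (induction u)
  case Nil thus ?case using rel_idem by simp
next
  case (Cons k u)
  have u: "u \<in> W" "k \<in> X" "k \<noteq> letter (z + 1)" and IH: "[letter z] @ u @ [letter z] \<approx> u @ [letter z]"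
    using Cons by auto
  let ?i = "letter z"
  consider "k = ?i" | "k = letter (z - 1)" | "k \<noteq> ?i" "k \<noteq> letter (z - 1)" by blast
  thus ?case
  proof cases
    case 1 thus ?thesis using cong_context[OF rel_idem, of "[]" "u @ [?i]" z] u by simp
  next
    case 2
    have 1: "[?i, k] @ (u @ [?i]) @ [] \<approx> [?i, k] @ ([?i] @ u @ [?i]) @ []"
      by (rule cong_context[OF pres_cong.sym[OF IH]]) (use u in auto)
    have 2: "[] @ [?i, k, ?i] @ (u @ [?i]) \<approx> [] @ [k, ?i] @ (u @ [?i])"
      by (rule cong_context) (use u rel_right 2 in auto)
    have 3: "[k] @ ([?i] @ u @ [?i]) @ [] \<approx> [k] @ (u @ [?i]) @ []"
      by (rule cong_context[OF IH]) (use u in auto)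
    show ?thesis using 1 2 3 by (auto intro: pres_cong.trans)
  next
    case 3
    have "[] @ [?i, k] @ (u @ [?i]) \<approx> [] @ [k, ?i] @ (u @ [?i])"
      by (rule cong_context) (use u 3 rel_comm in auto)
    moreover have "[k] @ ([?i] @ u @ [?i]) @ [] \<approx> [k] @ (u @ [?i]) @ []"
      by (rule cong_context[OF IH]) (use u in auto)
    ultimately show ?thesis by (auto intro: pres_cong.trans)
  qed
qed

lemma commute_past:
  assumes "u \<in> W" "letter z \<notin> set u" "letter (z - 1) \<notin> set u" "letter (z + 1) \<notin> set u"
  shows "[letter z] @ u \<approx> u @ [letter z]"
  using assms
proof (induction u)
  case Nil thus ?case by (auto intro: pres_cong.refl)
next
  case (Cons k u)
  have "[] @ [letter z, k] @ u \<approx> [] @ [k, letter z] @ u"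
    by (rule cong_context) (use Cons rel_comm in auto)
  moreover have "[k] @ ([letter z] @ u) @ [] \<approx> [k] @ (u @ [letter z]) @ []"
    by (rule cong_context) (use Cons in auto)
  ultimately show ?case by (auto intro: pres_cong.trans)
qed

section \<open>Faithfulness of the action\<close>

definition shortest :: "nat list \<Rightarrow> bool" where
  "shortest w \<longleftrightarrow> w \<in> W \<and> (\<forall>v. w \<approx> v \<longrightarrow> length w \<le> length v)"

lemma ex_shortest: "w \<in> W \<Longrightarrow> \<exists>v. w \<approx> v \<and> shortest v"
proof -
  assume "w \<in> W"
  hence "w \<approx> w" by (rule pres_cong.refl)
  hence "\<exists>v. w \<approx> v \<and> (\<forall>u. w \<approx> u \<longrightarrow> length v \<le> length u)"
    by (rule ex_has_least_nat)
  then obtain v where "w \<approx> v" "\<forall>u. w \<approx> u \<longrightarrow> length v \<le> length u" by blast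
  moreover have "v \<in> W" using cong_lists[OF \<open>w \<approx> v\<close>] by simp
  ultimately show ?thesis unfolding shortest_def
    using pres_cong.trans[of X "hk_relations n" w v] by blast
qed

lemma shortest_factor:
  assumes "shortest (a @ u @ b)" shows "shortest u"
proof -
  have W: "a \<in> W" "b \<in> W" "u \<in> W" using assms by (auto simp: shortest_def)
  have "length u \<le> length v" if "u \<approx> v" for v
  proof -
    have "length (a @ u @ b) \<le> length (a @ v @ b)"
      using assms cong_context[OF that W(1,2)] unfolding shortest_def by blast
    thus ?thesis by simp
  qed
  thus ?thesis using W by (simp add: shortest_def)
qed

text \<open>
  Otherwise one of the two occurrences could be absorbed by the other. This is the only property
  of shortest words that enters the study of their action.
\<close>

lemma shortest_between:
  assumes "shortest (a @ [letter z] @ u @ [letter z] @ b)"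
  shows "letter (z - 1) \<in> set u" "letter (z + 1) \<in> set u"
proof -
  have m: "shortest ([letter z] @ u @ [letter z])"
    using shortest_factor[of a "[letter z] @ u @ [letter z]" b] assms by simp
  hence u: "u \<in> W" by (auto simp: shortest_def)
  show "letter (z - 1) \<in> set u"
  proof (rule ccontr)
    assume "\<not> ?thesis"
    have "length ([letter z] @ u @ [letter z]) \<le> length ([letter z] @ u)"
      using absorb_left[OF u \<open>\<not> _\<close>] m unfolding shortest_def by blast
    thus False by simp
  qed
  show "letter (z + 1) \<in> set u"
  proof (rule ccontr)
    assume "\<not> ?thesis"
    have "length ([letter z] @ u @ [letter z]) \<le> length (u @ [letter z])"
      using absorb_right[OF u \<open>\<not> _\<close>] m unfolding shortest_def by blast
    thus False by simp
  qed
qed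

text \<open>
  The word \<open>c\<close> is what acts after the last move of the point. The lemma locates the letter by
  which a point arrives at its final position.
\<close>

lemma word_act_last_move:
  "word_act b x < x \<Longrightarrow> \<exists>c d. b = c @ [letter (word_act b x + 1)] @ d \<and> letter (word_act b x) \<notin> set c"
proof (induction b)
  case (Cons k b)
  show ?case
  proof (cases "k = letter (word_act b x)")
    case True
    hence e: "word_act (k # b) x = word_act b x - 1" by (simp add: letter_act_def)
    show ?thesis unfolding e using True by (intro exI[of _ "[]"] exI[of _ b]) auto
  next
    case False
    hence e: "word_act (k # b) x = word_act b x" by (simp add: letter_act_def)
    obtain c d where "b = c @ [letter (word_act b x + 1)] @ d" "letter (word_act b x) \<notin> set c"
      using Cons.IH Cons.prems unfolding e by blast
    thus ?thesis unfolding e using False by (intro exI[of _ "k # c"] exI[of _ d]) auto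
  qed
qed simp

lemma word_act_merge:
  "word_act w (z - 1) = word_act w z \<Longrightarrow>
    \<exists>a b. w = a @ [letter (word_act b z)] @ b \<and> word_act b (z - 1) = word_act b z - 1"
proof (induction w)
  case (Cons k w)
  show ?case
  proof (cases "word_act w (z - 1) = word_act w z")
    case True
    then obtain a b where "w = a @ [letter (word_act b z)] @ b" "word_act b (z - 1) = word_act b z - 1"
      using Cons by blast
    thus ?thesis by (intro exI[of _ "k # a"] exI[of _ b]) auto
  next
    case False
    hence lt: "word_act w (z - 1) < word_act w z" using word_act_mono[of "z - 1" z w] by simp
    have eq: "letter_act k (word_act w (z - 1)) = letter_act k (word_act w z)" using Cons.prems by simp
    have k: "k = letter (word_act w z)"
      using lt eq letter_act_le[of k "word_act w (z - 1)"] by (rule_tac ccontr) (simp add: letter_act_def)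
    have "word_act w (z - 1) = word_act w z - 1"
      using lt eq letter_act_le[of k "word_act w (z - 1)"] k by (simp add: letter_act_def split: if_splits)
    with k show ?thesis by (intro exI[of _ "[]"] exI[of _ w]) simp
  qed
qed simp

text \<open>
  If \<open>z - 1\<close> had been moved before the two points meet, both would have arrived at the common
  position by the same letter \<open>p\<close>, with no predecessor of \<open>p\<close> in between, contradicting
  \<open>shortest_between\<close>. So the points meet where \<open>z - 1\<close> started, and the letter that makes them meet is
  the first to move \<open>z\<close>.
\<close>

lemma shortest_merge:
  assumes m: "shortest w" and "word_act w (z - 1) = word_act w z"
  shows "\<exists>a b. w = a @ [letter z] @ b \<and> letter z \<notin> set b \<and> letter (z - 1) \<notin> set b"
proof -
  obtain a b where w: "w = a @ [letter (word_act b z)] @ b" and e: "word_act b (z - 1) = word_act b z - 1"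
    using word_act_merge assms by blast
  \<comment> \<open>Otherwise the lower point arrived by the letter that makes the upper point arrive.\<close>
  have "word_act b (z - 1) = z - 1"
  proof (rule ccontr)
    assume "\<not> ?thesis"
    hence "word_act b (z - 1) < z - 1" using word_act_le[of b "z - 1"] by simp
    from word_act_last_move[OF this] e obtain c d where
      b: "b = c @ [letter (word_act b z)] @ d" and c: "letter (word_act b z - 1) \<notin> set c"
      by auto
    have "shortest (a @ [letter (word_act b z)] @ c @ [letter (word_act b z)] @ d)"
      using m w b by metis
    from shortest_between(1)[OF this] c show False by blast
  qed
  hence "letter (z - 1) \<notin> set b" using word_act_unmoved_iff by blast
  moreover have bz: "word_act b z = z" using e \<open>word_act b (z - 1) = z - 1\<close> by simp
  moreover have "letter z \<notin> set b" using bz word_act_unmoved_iff by blast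
  ultimately show ?thesis using w by metis
qed

lemma last_occurrence: "x \<in> set b \<Longrightarrow> \<exists>c d. b = c @ [x] @ d \<and> x \<notin> set d"
  using split_list_last by fastforce

text \<open>
  The point \<open>z + 1\<close> first falls onto \<open>z\<close> and then follows it, because the next letter to move either
  of them is the displayed one.
\<close>

lemma merge_up:
  assumes "letter z \<notin> set b" "letter (z + 1) \<in> set b"
  shows "word_act (a @ [letter z] @ b) (z + 1) = word_act (a @ [letter z] @ b) z"
proof -
  obtain c d where b: "b = c @ [letter (z + 1)] @ d" "letter (z + 1) \<notin> set d"
    using last_occurrence[OF assms(2)] by blast
  have "word_act d (z + 1) = z + 1" "word_act c z = z" using b assms(1) by (auto intro!: word_act_unmoved)
  hence "word_act b (z + 1) = z" using b by (simp add: letter_act_def)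
  moreover have "word_act b z = z" using assms(1) word_act_unmoved by blast
  ultimately show ?thesis by simp
qed

text \<open>
  Deleting the last letter of a shortest word undoes as much of the merging as possible: if the
  letter occurs a second time, its successor occurs in between, and \<open>merge_up\<close> makes \<open>y\<close> and \<open>y + 1\<close>
  meet. Hence the map of the shorter word is determined by the map of the longer one.
\<close>

lemma shortest_lift:
  assumes m: "shortest (u @ [letter z])" and y: "letter y = letter z"
  shows "word_act u y = min y (word_act u (y + 1))"
proof (cases "letter y \<in> set u")
  case False
  thus ?thesis using word_act_unmoved[of y u] word_act_mono[of y "y + 1" u] by simp
next
  case True
  then obtain a b where u: "u = a @ [letter y] @ b" "letter y \<notin> set b"
    using last_occurrence[OF True] by blast
  have "shortest (a @ [letter y] @ b @ [letter y] @ [])" using m u y by simp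
  hence "letter (y + 1) \<in> set b" by (rule shortest_between)
  from merge_up[OF u(2) this, of a] u word_act_le[of u y] show ?thesis by simp
qed

text \<open>
  The letter that merges \<open>z\<close> with \<open>z - 1\<close> commutes with everything to its right: neither it nor its
  predecessor occurs there by \<open>shortest_merge\<close>, and its successor would also merge \<open>z + 1\<close> with \<open>z\<close>. So
  it can be moved to the end of the word.
\<close>

lemma merge_letter_last:
  assumes m: "shortest w" and "word_act w (z - 1) = word_act w z" "word_act w z < word_act w (z + 1)"
  shows "\<exists>u. w \<approx> u @ [letter z] \<and> length w = length u + 1 \<and> shortest u \<and> shortest (u @ [letter z]) \<and>
    (\<forall>y. word_act u y = (if letter y = letter z then min y (word_act w (y + 1)) else word_act w y))"
proof -
  obtain a b where w: "w = a @ [letter z] @ b" and b: "letter z \<notin> set b" "letter (z - 1) \<notin> set b"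
    using shortest_merge[OF assms(1,2)] by blast
  have b': "letter (z + 1) \<notin> set b" using merge_up[OF b(1), of a] assms(3) w by auto
  have W: "a \<in> W" "b \<in> W" using m w by (auto simp: shortest_def)
  define u where "u = a @ b"
  have c: "w \<approx> u @ [letter z]"
    using cong_context[OF commute_past[OF W(2) b b'] W(1), of "[]"] w by (simp add: u_def)
  have l: "length w = length u + 1" by (simp add: w u_def)
  have m': "shortest (u @ [letter z])"
  proof -
    have "u @ [letter z] \<in> W" using W by (simp add: u_def)
    moreover have "length (u @ [letter z]) \<le> length x" if "u @ [letter z] \<approx> x" for x
      using pres_cong.trans[OF c that] m l unfolding shortest_def by simp
    ultimately show ?thesis by (simp add: shortest_def)
  qed
  have "word_act u y = (if letter y = letter z then min y (word_act w (y + 1)) else word_act w y)" for y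
  proof -
    have e: "word_act w x = word_act u (letter_act (letter z) x)" for x using word_act_cong[OF c] by simp
    have "word_act u y = word_act w y" if "letter y \<noteq> letter z" using that e[of y] by (auto simp: letter_act_def)
    moreover have "word_act u (y + 1) = word_act w (y + 1)" if "letter y = letter z"
    proof -
      have "letter (y + 1) \<noteq> letter z" using that letter_neq[of y] by metis
      thus ?thesis using e[of "y+1"] by (auto simp: letter_act_def)
    qed
    ultimately show ?thesis using shortest_lift[OF m'] by auto
  qed
  thus ?thesis using c l m' shortest_factor[of "[]" u "[letter z]"] by auto
qed

lemma ex_ascent_after_merge:
  fixes f :: "int \<Rightarrow> int"
  assumes "f z0 = f (z0 - 1)" and per: "\<And>z. f (z + int n) = f z + int n"
   and mono: "\<And>x y. x \<le> y \<Longrightarrow> f x \<le> f y"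
  shows "\<exists>z. f (z - 1) = f z \<and> f z < f (z + 1)"
proof -
  have "\<exists>t::nat. f z0 < f (z0 + int t)" using per[of z0] n3 by (intro exI[of _ n]) auto
  \<comment> \<open>The last point of the level set of \<open>z0\<close> is found at the first strict increase.\<close>
  then obtain t where t: "f z0 < f (z0 + int t)" and l: "\<And>s. s < t \<Longrightarrow> \<not> f z0 < f (z0 + int s)"
    using exists_least_iff[of "\<lambda>t. f z0 < f (z0 + int t)"] by blast
  obtain m where m: "t = Suc m" using t by (cases t) auto
  have s: "f (z0 + int s) = f z0" if "s < t" for s using l[OF that] mono[of z0 "z0 + int s"] by simp
  define z where "z = z0 + int m"
  have "f z = f z0" using s[of m] m by (simp add: z_def)
  moreover have "f (z + 1) > f z0" using t m by (simp add: z_def algebra_simps)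
  moreover have "f (z - 1) = f z0"
  proof (cases m)
    case 0 thus ?thesis using assms(1) by (simp add: z_def)
  next
    case (Suc p)
    thus ?thesis using s[of p] m by (simp add: z_def)
  qed
  ultimately show ?thesis by (intro exI[of _ z]) simp
qed

lemma word_act_snoc_merge: "k \<in> X \<Longrightarrow> word_act (w @ [k]) (int k + 1) = word_act (w @ [k]) (int k + 1 - 1)"
proof -
  assume k: "k \<in> X"
  have "letter (int k + 1) = k" by (rule letter_of_succ[OF k])
  moreover have "letter (int k) \<noteq> k" using letter_neq(4)[of "int k + 1"] calculation by simp
  ultimately show ?thesis by (simp add: letter_act_def)
qed

text \<open>
  Both words can be rewritten to end in the same letter, and by \<open>merge_letter_last\<close> the maps of
  what remains are given by the same formula.
\<close>

lemma faithful_shortest: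
  "shortest w \<Longrightarrow> shortest v \<Longrightarrow> word_act w = word_act v \<Longrightarrow> w \<approx> v"
proof (induction "length w" arbitrary: w v rule: less_induct)
  case less
  have W: "w \<in> W" "v \<in> W" using less by (auto simp: shortest_def)
  \<comment> \<open>The last letter of a nonempty word merges two points, which the identity does not.\<close>
  have moves: "word_act (x @ [k]) \<noteq> word_act []" if "k \<in> X" for k x
  proof
    assume "word_act (x @ [k]) = word_act []"
    hence "word_act (x @ [k]) (int k + 1) = int k + 1" "word_act (x @ [k]) (int k + 1 - 1) = int k" by simp_all
    thus False using word_act_snoc_merge[OF that, of x] by simp
  qed
  show ?case
  proof (cases w rule: rev_cases)
    case Nil
    hence "v = []" using less.prems(3) moves W by (cases v rule: rev_cases) auto
    thus ?thesis using Nil by (auto intro: pres_cong.refl)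
  next
    case (snoc x k)
    hence k: "k \<in> X" using W by auto
    obtain z where z: "word_act w (z - 1) = word_act w z" "word_act w z < word_act w (z + 1)"
      using ex_ascent_after_merge[of "word_act w" "int k + 1", OF _ word_act_period word_act_mono]
        word_act_snoc_merge[OF k, of x] unfolding snoc by blast
    obtain u where u: "w \<approx> u @ [letter z]" "length w = length u + 1" "shortest u"
      "\<forall>y. word_act u y = (if letter y = letter z then min y (word_act w (y + 1)) else word_act w y)"
      using merge_letter_last[OF less.prems(1) z] by blast
    obtain u' where u': "v \<approx> u' @ [letter z]" "shortest u'"
      "\<forall>y. word_act u' y = (if letter y = letter z then min y (word_act v (y + 1)) else word_act v y)"
      using merge_letter_last[OF less.prems(2) z[unfolded less.prems(3)]] by blast
    have "word_act u = word_act u'" using u(4) u'(3) less.prems(3) by (simp add: fun_eq_iff)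
    hence "u \<approx> u'" using less.hyps[of u u'] u(2,3) u'(2) by simp
    from cong_context[OF this, of "[]" "[letter z]"] have "u @ [letter z] \<approx> u' @ [letter z]" by simp
    thus ?thesis using u(1) u'(1) by (blast intro: pres_cong.trans pres_cong.sym)
  qed
qed

theorem cong_iff_word_act:
  assumes "w \<in> W" "v \<in> W" shows "w \<approx> v \<longleftrightarrow> word_act w = word_act v"
proof
  assume e: "word_act w = word_act v"
  obtain w' v' where "w \<approx> w'" "shortest w'" "v \<approx> v'" "shortest v'"
    using ex_shortest assms by metis
  thus "w \<approx> v" using faithful_shortest[of w' v'] e word_act_cong
    by (metis pres_cong.trans pres_cong.sym)
qed (rule word_act_cong)

end

section \<open>Monotone quasi-periodic maps of the integers\<close>

lemma quasi_periodic_mult: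
  fixes f :: "int \<Rightarrow> int"
  assumes "\<And>z. f (z + q) = f z + r"
  shows "f (z + q * k) = f z + r * k"
proof (induction k rule: int_induct[where k = 0])
  case base thus ?case by simp
next
  case (step1 i)
  have "f (z + q * (i + 1)) = f (z + q * i + q)" by (simp add: algebra_simps)
  also have "\<dots> = f (z + q * i) + r" by (rule assms)
  also have "\<dots> = f z + r * (i + 1)" using step1 by (simp add: distrib_left)
  finally show ?case .
next
  case (step2 i)
  have e: "z + q * (i - 1) + q = z + q * i" by (simp add: algebra_simps)
  have "f (z + q * i) = f (z + q * (i - 1)) + r" using assms[of "z + q * (i - 1)", unfolded e] .
  hence "f (z + q * (i - 1)) = f z + r * i - r" using step2 by linarith
  thus ?case by (simp add: right_diff_distrib)
qed

text \<open>
  A monotone quasi-periodic map of the integers is unbounded in both directions, so it has an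
  upper adjoint. Adjoints serve as partial inverses from which the cofactors in the divisibility
  statements are built.
\<close>

lemma upper_adjoint:
  fixes F :: "int \<Rightarrow> int"
  assumes "mono F" and per: "\<And>k. F (k + r) = F k + q" and "0 < r" "0 < q"
  shows "\<exists>g. mono g \<and> (\<forall>z. g (z + q) = g z + r) \<and> (\<forall>z k. F k \<le> z \<longleftrightarrow> k \<le> g z)"
proof -
  have "\<exists>m. \<forall>k. F k \<le> z \<longleftrightarrow> k \<le> m" for z
  proof -
    define B where "B = \<bar>F 0\<bar> + \<bar>z\<bar> + 1"
    have "B \<le> q * B" using \<open>0 < q\<close> by (simp add: B_def)
    moreover have "F (r * t) = F 0 + q * t" for t
      using quasi_periodic_mult[of F r q 0, OF per] by simp
    hence "F (r * (- B)) = F 0 - q * B" "F (r * B) = F 0 + q * B"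
      by (metis mult_minus_right uminus_add_conv_diff add.commute) (simp add: \<open>\<And>t. F (r * t) = F 0 + q * t\<close>)
    ultimately have lo: "F (r * (- B)) \<le> z" and hi: "z < F (r * B)"
      unfolding B_def by linarith+
    define S where "S = {k \<in> {r * (- B)..r * B}. F k \<le> z}"
    have "finite S" unfolding S_def by (rule finite_subset[of _ "{r * (- B)..r * B}"]) auto
    have "r * - B \<in> S" using lo \<open>0 < r\<close> by (simp add: S_def B_def)
    have "F k \<le> z \<longleftrightarrow> k \<le> Max S" for k
    proof
      assume k: "F k \<le> z"
      show "k \<le> Max S"
      proof (cases "k < r * - B")
        case True thus ?thesis using Max_ge[OF \<open>finite S\<close> \<open>r * - B \<in> S\<close>] by simp
      next
        case False
        have "k < r * B" using hi k monoD[OF \<open>mono F\<close>, of "r * B" k] by linarith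
        hence "k \<in> S" using False k by (simp add: S_def)
        thus ?thesis using \<open>finite S\<close> by simp
      qed
    next
      assume "k \<le> Max S"
      moreover have "Max S \<in> S" using \<open>finite S\<close> \<open>r * - B \<in> S\<close> by (intro Max_in) auto
      ultimately show "F k \<le> z" using monoD[OF \<open>mono F\<close>, of k "Max S"] by (simp add: S_def)
    qed
    thus ?thesis by blast
  qed
  then obtain g where g: "F k \<le> z \<longleftrightarrow> k \<le> g z" for z k by metis
  have "mono g"
  proof (rule monoI)
    fix x y :: int assume "x \<le> y"
    moreover have "F (g x) \<le> x" by (simp add: g)
    ultimately have "F (g x) \<le> y" by simp
    thus "g x \<le> g y" by (simp add: g)
  qed
  moreover have "g (z + q) = g z + r" for z
  proof (rule antisym)
    have "F (g (z + q) - r + r) \<le> z + q" by (simp add: g)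
    hence "F (g (z + q) - r) \<le> z" unfolding per by simp
    thus "g (z + q) \<le> g z + r" by (simp add: g)
    have "F (g z + r) \<le> z + q" by (simp add: per g)
    thus "g z + r \<le> g (z + q)" by (simp add: g)
  qed
  ultimately show ?thesis using g by blast
qed

lemma mono_int_step: "(\<And>z::int. f z \<le> f (z + 1)) \<Longrightarrow> mono (f :: int \<Rightarrow> int)"
proof (rule monoI)
  fix x y :: int assume s: "\<And>z. f z \<le> f (z + 1)" and "x \<le> y"
  from \<open>x \<le> y\<close> show "f x \<le> f y"
    by (induction y rule: int_ge_induct) (auto intro: order_trans s)
qed

lemma periodic_bounded:
  fixes h :: "int \<Rightarrow> int"
  assumes "\<And>z. h (z + q) = h z + q" "0 < q"
  shows "\<exists>B\<ge>0. \<forall>z. h z \<le> z + B"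
proof -
  define B where "B = Max ((\<lambda>z. \<bar>h z - z\<bar>) ` {0..<q})"
  have B: "\<bar>h z - z\<bar> \<le> B" if "z \<in> {0..<q}" for z
    unfolding B_def using that by (intro Max_ge) auto
  have "h z \<le> z + B" for z
  proof -
    have "h z = h (z mod q + q * (z div q))" by simp
    also have "\<dots> = h (z mod q) + q * (z div q)" by (rule quasi_periodic_mult) (rule assms)
    finally have e: "h z = h (z mod q) + q * (z div q)" .
    have "\<bar>h (z mod q) - z mod q\<bar> \<le> B" using B[of "z mod q"] assms(2) by simp
    hence "h (z mod q) \<le> z mod q + B" by linarith
    moreover have "z = z mod q + q * (z div q)" by simp
    ultimately show ?thesis using e by linarith
  qed
  moreover have "0 \<le> B" using B[of 0] assms(2) by simp
  ultimately show ?thesis by blast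
qed

text \<open>
  An injective monotone map rises by at least \<open>n\<close> over \<open>n\<close> steps. This is how the maps constructed
  below are seen to come from words.
\<close>

lemma repeats_if_compressing:
  fixes h :: "int \<Rightarrow> int"
  assumes "mono h" "\<And>z. h (z + int n) = h z + r" "r < int n"
  shows "\<exists>z. h (z - 1) = h z"
proof (rule ccontr)
  assume "\<not> ?thesis"
  hence s: "h z < h (z + 1)" for z using monoD[OF assms(1), of z "z + 1"]
    by (metis add_diff_cancel_right' le_less zle_add1_eq_le order_refl)
  have "h (int k) \<ge> h 0 + int k" for k
  proof (induction k)
    case (Suc k) thus ?case using s[of "int k"] by (simp add: add.commute)
  qed simp
  from this[of n] assms(2)[of 0] assms(3) show False by simp
qed

section \<open>Maps that come from words\<close>

context oriented_cycle begin

definition lowering_map :: "(int \<Rightarrow> int) \<Rightarrow> bool" where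
  "lowering_map f \<longleftrightarrow> mono f \<and> (\<forall>z. f (z + int n) = f z + int n) \<and> (\<forall>z. f z \<le> z)"

definition displacement :: "(int \<Rightarrow> int) \<Rightarrow> nat" where
  "displacement f = (\<Sum>z = 1..int n. nat (z - f z))"

lemma lowering_map_word_act: "lowering_map (word_act w)"
  by (auto simp: lowering_map_def word_act_period word_act_le intro!: monoI word_act_mono)

lemma ex_window: "\<exists>y \<in> {1..int n}. \<exists>k. z = y + int n * k"
proof -
  have "z = ((z - 1) mod int n + 1) + int n * ((z - 1) div int n)" by simp
  moreover have "(z - 1) mod int n + 1 \<in> {1..int n}" using n3 by (auto simp: add1_zle_eq)
  ultimately show ?thesis by blast
qed

lemma lowering_map_eqI:
  assumes "lowering_map f" "lowering_map g" "\<And>z. z \<in> {1..int n} \<Longrightarrow> f z = g z"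
  shows "f = g"
proof
  fix z
  obtain y k where "y \<in> {1..int n}" "z = y + int n * k" using ex_window by blast
  thus "f z = g z" using assms quasi_periodic_mult[of f "int n" "int n" y k]
      quasi_periodic_mult[of g "int n" "int n" y k] by (simp add: lowering_map_def)
qed

lemma displacement_less:
  assumes "lowering_map f" "lowering_map g" "\<And>z. f z \<le> g z" "f \<noteq> g"
  shows "displacement g < displacement f"
proof -
  obtain z where z: "z \<in> {1..int n}" "f z \<noteq> g z" using lowering_map_eqI assms(1,2,4) by blast
  have "g z \<le> z" using assms(2) by (simp add: lowering_map_def)
  hence "nat (z - g z) < nat (z - f z)" using z(2) assms(3)[of z] by simp
  thus ?thesis unfolding displacement_def using z(1) assms(3)
    by (intro sum_strict_mono_ex1) (auto intro!: nat_mono)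
qed

text \<open>
  Peeling off one letter. Raising the value at the points congruent to \<open>z\<close> as far as possible
  makes \<open>f\<close> factor through the letter moving \<open>z\<close>. Raising it by one only would not do: the resulting
  map could be a nontrivial shift, which does not come from a word. With the choice made here an
  injective result has the fixed point \<open>z\<close>, and an injective map of this kind with a fixed point
  is the identity.
\<close>

lemma lower_letter:
  assumes f: "lowering_map f" and z: "f (z - 1) = f z" "f z < f (z + 1)"
  defines "g \<equiv> \<lambda>y. if letter y = letter z then min y (f (y + 1)) else f y"
  shows "lowering_map g" "f = (\<lambda>y. g (letter_act (letter z) y))" "displacement g < displacement f"
    "g = (\<lambda>y. y) \<or> (\<exists>y. g (y - 1) = g y)"
proof -
  have m: "f x \<le> f y" if "x \<le> y" for x y using f that by (auto simp: lowering_map_def dest: monoD)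
  have p: "f (y + int n) = f y + int n" and l: "f y \<le> y" for y using f by (auto simp: lowering_map_def)
  have pk: "f (y + int n * k) = f y + int n * k" for y k by (rule quasi_periodic_mult) (rule p)
  have merge: "f (y - 1) = f y" if "letter y = letter z" for y
  proof -
    have "int n dvd y - z" using that by (simp add: letter_eq_iff_dvd)
    then obtain k where "y - z = int n * k" by (rule dvdE)
    hence e: "y = z + int n * k" "y - 1 = (z - 1) + int n * k" by simp_all
    have "f (y - 1) = f (z - 1) + int n * k" unfolding e(2) by (rule pk)
    also have "\<dots> = f y" unfolding e(1) by (simp only: pk z(1))
    finally show ?thesis .
  qed
  have nxt: "letter (y + 1) \<noteq> letter z" if "letter y = letter z" for y
    using that letter_neq(2)[of y] by simp
  show g: "lowering_map g"
    unfolding lowering_map_def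
  proof (intro conjI allI)
    show "mono g"
    proof (rule mono_int_step)
      fix y
      show "g y \<le> g (y + 1)"
        using nxt[of y] m[of y "y + 1"] l[of y] m[of y "y + 1 + 1"] unfolding g_def by auto
    qed
    fix y
    have "y + int n + 1 = y + 1 + int n" by simp
    hence "f (y + int n + 1) = f (y + 1) + int n" by (simp only: p)
    thus "g (y + int n) = g y + int n" by (simp add: g_def p min_def)
    show "g y \<le> y" using l by (simp add: g_def)
  qed
  show fg: "f = (\<lambda>y. g (letter_act (letter z) y))"
  proof
    fix y
    show "f y = g (letter_act (letter z) y)"
    proof (cases "letter y = letter z")
      case True
      hence "letter (y - 1) \<noteq> letter z" using letter_neq(1)[of y] by simp
      thus ?thesis using True merge[OF True] by (simp add: letter_act_def g_def)
    next
      case False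
      thus ?thesis by (simp add: letter_act_def g_def)
    qed
  qed
  have "f z < z" using z(1) l[of "z - 1"] by simp
  hence "f z < g z" using z(2) by (simp add: g_def)
  hence "f \<noteq> g" by auto
  moreover have "f y \<le> g y" for y using l[of y] m[of y "y + 1"] by (simp add: g_def)
  ultimately show "displacement g < displacement f" using displacement_less[OF f g] by blast
  have "letter (z + 1) \<noteq> letter z" by simp
  show "g = (\<lambda>y. y) \<or> (\<exists>y. g (y - 1) = g y)"
  proof (rule ccontr)
    assume c: "\<not> ?thesis"
    have gm: "mono g" using g by (simp add: lowering_map_def)
    have s: "g y + 1 \<le> g (y + 1)" for y
    proof -
      have "g (y + 1 - 1) \<noteq> g (y + 1)" using c by blast
      thus ?thesis using monoD[OF gm, of y "y + 1"] by simp
    qed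
    \<comment> \<open>The value at \<open>z\<close> is \<open>z\<close> or the value at \<open>z + 1\<close>; the latter contradicts injectivity.\<close>
    have "g z = z"
    proof (rule ccontr)
      assume "g z \<noteq> z"
      hence "g z = g (z + 1)" by (simp add: g_def min_def split: if_splits)
      thus False using s[of z] by simp
    qed
    have up: "z + int k \<le> g (z + int k)" for k
    proof (induction k)
      case (Suc k)
      have e: "z + int (Suc k) = z + int k + 1" by simp
      show ?case unfolding e using Suc s[of "z + int k"] by linarith
    qed (simp add: \<open>g z = z\<close>)
    have "g y = y" for y
    proof -
      define t where "t = \<bar>z - y\<bar>"
      have "t \<le> int n * t" using n3 by (simp add: t_def mult_le_cancel_right1)
      hence "z \<le> y + int n * t" unfolding t_def by linarith
      hence "y + int n * t \<le> g (y + int n * t)" using up[of "nat (y + int n * t - z)"] by simp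
      also have "\<dots> = g y + int n * t"
        using quasi_periodic_mult[of g "int n" "int n" y t] g by (simp add: lowering_map_def)
      finally show ?thesis using g by (simp add: lowering_map_def antisym)
    qed
    hence "g = (\<lambda>y. y)" by (rule ext)
    thus False using c by blast
  qed
qed

lemma word_act_surj:
  "lowering_map f \<Longrightarrow> f = (\<lambda>y. y) \<or> (\<exists>z. f (z - 1) = f z) \<Longrightarrow> \<exists>w \<in> W. word_act w = f"
proof (induction "displacement f" arbitrary: f rule: less_induct)
  case less
  show ?case
  proof (cases "f = (\<lambda>y. y)")
    case True
    thus ?thesis by (intro bexI[of _ "[]"]) auto
  next
    case False
    then obtain z0 where "f (z0 - 1) = f z0" using less by blast
    then obtain z where z: "f (z - 1) = f z" "f z < f (z + 1)"
      using ex_ascent_after_merge[of f z0] less.prems(1) by (auto simp: lowering_map_def dest: monoD)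
    note g = lower_letter[OF less.prems(1) z]
    obtain w where w: "w \<in> W" "word_act w = (\<lambda>y. if letter y = letter z then min y (f (y + 1)) else f y)"
      using less.hyps[OF g(3) g(1) g(4)] by blast
    have "word_act (w @ [letter z]) = f"
      by (subst g(2)) (simp add: fun_eq_iff w(2)[THEN fun_cong])
    thus ?thesis using w(1) by (intro bexI[of _ "w @ [letter z]"]) auto
  qed
qed

text \<open>
  A map that factors through a smaller period is not injective, so it comes from a word as soon
  as it lowers every integer. All cofactors are obtained in this way.
\<close>

lemma word_act_factor:
  assumes "mono \<kappa>" "\<And>z. \<kappa> (z + int n) = \<kappa> z + r" "r < int n"
    and "mono p" "\<And>k. p (k + r) = p k + int n" "\<And>z. p (\<kappa> z) \<le> z"
  shows "\<exists>w \<in> W. word_act w = (\<lambda>z. p (\<kappa> z))"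
proof (rule word_act_surj)
  show "lowering_map (\<lambda>z. p (\<kappa> z))"
    unfolding lowering_map_def using assms(2,5,6) by (auto intro!: monoI monoD[OF assms(1)] monoD[OF assms(4)])
  obtain z where "\<kappa> (z - 1) = \<kappa> z" using repeats_if_compressing[OF assms(1-3)] by blast
  thus "(\<lambda>z. p (\<kappa> z)) = (\<lambda>y. y) \<or> (\<exists>z. p (\<kappa> (z - 1)) = p (\<kappa> z))" by (metis (full_types))
qed

section \<open>Counting ascents\<close>

definition ascents :: "(int \<Rightarrow> int) \<Rightarrow> nat" where
  "ascents f = card {t \<in> {0..<int n}. f t < f (t + 1)}"

text \<open>
  \<open>K\<close> counts ascents, truncated at \<open>r\<close> in each period and padded to exactly \<open>r\<close> per period. If there
  are at least \<open>r\<close> ascents it increases by steps of one and only at ascents, so it selects \<open>r\<close> of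
  them in each period; if there are at most \<open>r\<close> it increases at all of them, so \<open>f\<close> factors through
  it.
\<close>

lemma ascent_counting:
  fixes f :: "int \<Rightarrow> int" and r :: int
  assumes f: "lowering_map f" and r: "0 < r"
  shows "\<exists>K. mono K \<and> (\<forall>z. K (z + int n) = K z + r) \<and>
    (\<forall>z. r * (z div int n) \<le> K z \<and> K z \<le> r * (z div int n) + r) \<and>
    (r \<le> int (ascents f) \<longrightarrow> (\<forall>z. K (z + 1) \<le> K z + 1 \<and> (K z < K (z + 1) \<longrightarrow> f z < f (z + 1)))) \<and>
    (int (ascents f) \<le> r \<longrightarrow> (\<forall>z. f z < f (z + 1) \<longrightarrow> K z < K (z + 1)))"
proof -
  define c where "c = (\<lambda>m. int (card {t \<in> {0..<m}. f t < f (t + 1)}))"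
  define K where "K = (\<lambda>z. r * (z div int n) + min r (c (z mod int n)))"
  have n0: "0 < int n" using n3 by simp
  have c0: "0 \<le> c m" for m by (simp add: c_def)
  have fin: "finite {t \<in> {0..<m}. f t < f (t + 1)}" for m
    by (rule finite_subset[of _ "{0..<m}"]) auto
  have cmono: "c a \<le> c b" if "a \<le> b" for a b
  proof -
    have "{t \<in> {0..<a}. f t < f (t + 1)} \<subseteq> {t \<in> {0..<b}. f t < f (t + 1)}" using that by auto
    from card_mono[OF fin this] show ?thesis by (simp add: c_def)
  qed
  have c_Suc: "c (m + 1) = c m + (if f m < f (m + 1) then 1 else 0)" if "0 \<le> m" for m
  proof -
    have "{0..<m + 1} = insert m {0..<m}" using that by auto
    hence "{t \<in> {0..<m + 1}. f t < f (t + 1)} =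
        (if f m < f (m + 1) then insert m {t \<in> {0..<m}. f t < f (t + 1)} else {t \<in> {0..<m}. f t < f (t + 1)})"
      by auto
    thus ?thesis using fin[of m] by (simp add: c_def)
  qed
  have cn: "c (int n) = int (ascents f)" by (simp add: c_def ascents_def)
  have asc: "f z < f (z + 1) \<longleftrightarrow> f (z mod int n) < f (z mod int n + 1)" for z
  proof -
    have q: "f (y + int n * (z div int n)) = f y + int n * (z div int n)" for y
      by (rule quasi_periodic_mult) (use f in \<open>auto simp: lowering_map_def\<close>)
    have e: "z + 1 = (z mod int n + 1) + int n * (z div int n)" by simp
    have "f z = f (z mod int n) + int n * (z div int n)" using q[of "z mod int n"] by simp
    moreover have "f (z + 1) = f (z mod int n + 1) + int n * (z div int n)"
      by (subst e) (rule q)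
    ultimately show ?thesis by simp
  qed
  have per: "K (z + int n) = K z + r" for z
    using n0 by (simp add: K_def distrib_left)
  have step_in: "K (z + 1) = r * (z div int n) + min r (c (z mod int n + 1))"
    if "z mod int n + 1 < int n" for z
  proof -
    have gen: "(a + int n * b) div int n = b \<and> (a + int n * b) mod int n = a"
      if "0 \<le> a" "a < int n" for a b using that by simp
    have e: "z + 1 = (z mod int n + 1) + int n * (z div int n)" by simp
    have "0 \<le> z mod int n + 1" using n0 by (simp add: add_nonneg_nonneg)
    from gen[OF this that, of "z div int n"]
    have "(z + 1) div int n = z div int n" "(z + 1) mod int n = z mod int n + 1"
      unfolding e[symmetric] by blast+
    thus ?thesis by (simp add: K_def)
  qed
  have step_end: "K (z + 1) = r * (z div int n) + r" if "z mod int n + 1 = int n" for z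
  proof -
    have gen: "K (int n * b) = r * b" for b
    proof -
      have "{t \<in> {0..<0::int}. f t < f (t + 1)} = {}" by auto
      hence "c 0 = 0" unfolding c_def by (simp only: card.empty of_nat_0)
      thus ?thesis using n0 r by (simp add: K_def)
    qed
    have "z mod int n + int n * (z div int n) = z" by simp
    hence "z + 1 = int n * (z div int n + 1)" using that unfolding distrib_left by linarith
    hence "K (z + 1) = r * (z div int n + 1)" by (simp only: gen)
    thus ?thesis by (simp only: distrib_left mult_1_right)
  qed
  have m: "0 \<le> z mod int n" "z mod int n < int n" for z using n0 by simp_all
  have last: "c (z mod int n + 1) \<le> int (ascents f)" for z
    using cmono[of "z mod int n + 1" "int n"] m[of z] cn by simp
  have "mono K"
  proof (rule mono_int_step)
    fix z
    show "K z \<le> K (z + 1)"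
    proof (cases "z mod int n + 1 < int n")
      case True
      show ?thesis unfolding step_in[OF True]
        using cmono[of "z mod int n" "z mod int n + 1"] by (simp add: K_def)
    next
      case False
      hence e: "z mod int n + 1 = int n" using m(2)[of z] by simp
      show ?thesis unfolding step_end[OF e] by (simp add: K_def)
    qed
  qed
  moreover have "r * (z div int n) \<le> K z \<and> K z \<le> r * (z div int n) + r" for z
    using c0[of "z mod int n"] r by (simp add: K_def)
  moreover have "K (z + 1) \<le> K z + 1 \<and> (K z < K (z + 1) \<longrightarrow> f z < f (z + 1))"
    if "r \<le> int (ascents f)" for z
  proof -
    have "K (z + 1) = r * (z div int n) + min r (c (z mod int n + 1))"
    proof (cases "z mod int n + 1 < int n")
      case False
      hence e: "z mod int n + 1 = int n" using m(2)[of z] by simp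
      show ?thesis unfolding step_end[OF e] unfolding e cn using that by simp
    qed (rule step_in)
    thus ?thesis using c_Suc[OF m(1), of z] asc[of z] by (auto simp: K_def min_def)
  qed
  moreover have "K z < K (z + 1)" if "int (ascents f) \<le> r" "f z < f (z + 1)" for z
  proof -
    have c: "c (z mod int n + 1) = c (z mod int n) + 1"
      using c_Suc[OF m(1), of z] asc[of z] that(2) by simp
    have "c (z mod int n + 1) \<le> r" using last[of z] that(1) by linarith
    show ?thesis
    proof (cases "z mod int n + 1 < int n")
      case True
      show ?thesis unfolding step_in[OF True]
        using c \<open>c (z mod int n + 1) \<le> r\<close> by (simp add: K_def)
    next
      case False
      hence e: "z mod int n + 1 = int n" using m(2)[of z] by simp
      show ?thesis unfolding step_end[OF e]
        using c \<open>c (z mod int n + 1) \<le> r\<close> by (simp add: K_def)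
    qed
  qed
  ultimately show ?thesis using per by (intro exI[of _ K]) blast
qed

lemma ascents_pos: "0 < ascents (word_act w)"
proof -
  let ?S = "{t \<in> {0..<int n}. word_act w t < word_act w (t + 1)}"
  have fin: "finite ?S" by (rule finite_subset[of _ "{0..<int n}"]) auto
  have "?S \<noteq> {}"
  proof
    assume e: "?S = {}"
    have "word_act w (int k) = word_act w 0" if "k \<le> n" for k
      using that
    proof (induction k)
      case (Suc k)
      have "int k \<notin> ?S" using e by blast
      hence "\<not> word_act w (int k) < word_act w (int k + 1)" using Suc.prems by simp
      hence "word_act w (int k + 1) = word_act w (int k)" using word_act_mono[of "int k" "int k + 1" w] by simp
      thus ?case using Suc by (simp add: add.commute)
    qed simp
    from this[of n] word_act_period[of w 0] n3 show False by simp
  qed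
  thus ?thesis unfolding ascents_def using fin by (simp add: card_gt_0_iff)
qed

lemma ascents_le:
  assumes "w \<in> W" "w \<noteq> []"
  shows "ascents (word_act w) \<le> n - 1"
proof -
  obtain x k where w: "w = x @ [k]" "k \<in> X" using assms by (cases w rule: rev_cases) auto
  let ?S = "{t \<in> {0..<int n}. word_act w t < word_act w (t + 1)}"
  define d where "d = int k div int n"
  define t where "t = int k mod int n"
  have k: "int k = t + int n * d" by (simp add: t_def d_def)
  have t: "t \<in> {0..<int n}" using n3 by (simp add: t_def)
  have "word_act w (int k + 1) = word_act w (int k)" using word_act_snoc_merge[OF w(2), of x] w(1) by simp
  moreover have per: "word_act w (z + int n * d) = word_act w z + int n * d" for z
    by (rule quasi_periodic_mult) (rule word_act_period)
  have "word_act w (int k + 1) = word_act w (t + 1) + int n * d" using per[of "t + 1"] k by (simp add: algebra_simps)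
  moreover have "word_act w (int k) = word_act w t + int n * d" using per[of t] k by simp
  ultimately have "word_act w (t + 1) = word_act w t" by simp
  hence "?S \<subseteq> {0..<int n} - {t}" by auto
  hence "card ?S \<le> card ({0..<int n} - {t})" by (intro card_mono) auto
  thus ?thesis using t by (simp add: ascents_def)
qed

section \<open>The maps of the words for the generators of the principal factors\<close>

definition s_word :: "nat \<Rightarrow> nat list" where
  "s_word i = n # [1..<i+1] @ rev [i+1..<n]"

lemma s_word_in: "i + 2 \<le> n \<Longrightarrow> s_word i \<in> W"
  unfolding s_word_def by (auto simp del: upt_Suc)

lemma concat_replicate_in: "w \<in> W \<Longrightarrow> concat (replicate m w) \<in> W"
  by (induction m) auto

lemma letter_window:
  assumes "1 \<le> j" "j \<le> n"
  shows "letter (int j + int n * q) = (if j = 1 then n else j - 1)"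
proof -
  have "letter (int j + int n * q) = letter (int j)" by (simp add: letter_eq_iff)
  also have "\<dots> = (if j = 1 then n else j - 1)"
  proof (cases "j = 1")
    case True
    have "letter 1 = letter (int n + 1)" by (simp add: letter_eq_iff)
    also have "\<dots> = n" using n3 by (intro letter_of_succ) simp
    finally show ?thesis using True by simp
  next
    case False
    have e: "int (j - 1) + 1 = int j" using assms by simp
    have "letter (int (j - 1) + 1) = j - 1" using assms False by (intro letter_of_succ) auto
    thus ?thesis using False unfolding e by simp
  qed
  finally show ?thesis .
qed

lemma letter_act_window:
  assumes "1 \<le> j" "j \<le> n" "1 \<le> l" "l < n"
  shows "letter_act l (int j + int n * q) = int (if j = l + 1 then l else j) + int n * q"
  using assms letter_window[OF assms(1,2)] by (auto simp: letter_act_def)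

lemma word_act_descending:
  assumes "1 \<le> a" "a \<le> b" "b \<le> n" "1 \<le> j" "j \<le> n"
  shows "word_act (rev [a..<b]) (int j + int n * q) =
    int (if a < j \<and> j \<le> b then j - 1 else j) + int n * q"
  using assms(2,3)
proof (induction b rule: dec_induct)
  case base thus ?case by simp
next
  case (step b)
  let ?j = "if a < j \<and> j \<le> b then j - 1 else j"
  have "word_act (rev [a..<Suc b]) (int j + int n * q) = letter_act b (int ?j + int n * q)"
    using step by simp
  also have "\<dots> = int (if ?j = b + 1 then b else ?j) + int n * q"
    using step assms by (intro letter_act_window) auto
  also have "(if ?j = b + 1 then b else ?j) = (if a < j \<and> j \<le> Suc b then j - 1 else j)"
    using step by auto
  finally show ?case .
qed

lemma word_act_ascending:
  assumes "a \<le> b" "1 \<le> a" "b \<le> n" "1 \<le> j" "j \<le> n"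
  shows "word_act [a..<b] (int j + int n * q) =
    int (if a < j \<and> j \<le> b then a else j) + int n * q"
  using assms(1,2)
proof (induction a rule: inc_induct)
  case base thus ?case by simp
next
  case (step a)
  let ?j = "if Suc a < j \<and> j \<le> b then Suc a else j"
  have "word_act [a..<b] (int j + int n * q) = letter_act a (int ?j + int n * q)"
    using step by (simp add: upt_conv_Cons)
  also have "\<dots> = int (if ?j = a + 1 then a else ?j) + int n * q"
    using step assms by (intro letter_act_window) auto
  also have "(if ?j = a + 1 then a else ?j) = (if a < j \<and> j \<le> b then a else j)"
    using step by auto
  finally show ?case .
qed

text \<open>
  Computed on the period \<open>{1..n}\<close>: the integers up to \<open>i + 2\<close> all fall to \<open>0\<close>, the others descend by
  one.
\<close>

lemma s_word_window:
  assumes i: "i + 2 \<le> n" and j: "1 \<le> j" "j \<le> n"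
  shows "word_act (s_word i) (int j + int n * q) =
    int (if j \<le> i + 2 then 0 else j - 1) + int n * q"
proof -
  let ?j = "if i + 1 < j \<and> j \<le> n then j - 1 else j"
  let ?j' = "if 1 < ?j \<and> ?j \<le> i + 1 then 1 else ?j"
  have "word_act (rev [i + 1..<n]) (int j + int n * q) = int ?j + int n * q"
    using i j by (intro word_act_descending) auto
  moreover have "word_act [1..<i + 1] (int ?j + int n * q) = int ?j' + int n * q"
    using i j by (intro word_act_ascending) auto
  moreover have "letter_act n (int ?j' + int n * q) = int (if ?j' = 1 then 0 else ?j') + int n * q"
  proof -
    have "1 \<le> ?j'" "?j' \<le> n" using i j by auto
    from letter_window[OF this, of q] show ?thesis using n3 \<open>?j' \<le> n\<close> by (auto simp: letter_act_def)
  qed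
  ultimately have "word_act (s_word i) (int j + int n * q) = int (if ?j' = 1 then 0 else ?j') + int n * q"
    by (simp add: s_word_def del: upt_Suc)
  also have "(if ?j' = 1 then 0 else ?j') = (if j \<le> i + 2 then 0 else j - 1)" using i j by auto
  finally show ?thesis .
qed

text \<open>
  The map of \<open>s\<^sub>i\<close> is a shift on its image: \<open>y\<close> enumerates the image, \<open>\<kappa>\<close> takes an integer to the index
  of its value, and the value of the \<open>k\<close>-th member of the image is the one with index \<open>k - 1\<close>.
  Powers of \<open>s\<^sub>i\<close> are then \<open>y (\<kappa> z - m)\<close>.
\<close>

lemma s_word_factors:
  assumes i: "i + 2 \<le> n"
  defines "r \<equiv> int n - 1 - int i"
  shows "\<exists>\<kappa> y. mono \<kappa> \<and> (\<forall>z. \<kappa> (z + int n) = \<kappa> z + r) \<and> mono y \<and> (\<forall>k. y (k + r) = y k + int n) \<and>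
     (\<forall>z. word_act (s_word i) z = y (\<kappa> z)) \<and> (\<forall>k. \<kappa> (y k) = k - 1) \<and> y 0 = 0 \<and>
     (\<forall>z. \<kappa> z \<le> r * (z div int n) + r)"
proof -
  define y where "y = (\<lambda>k. int n * (k div r) + (if k mod r = 0 then 0 else k mod r + int i + 1))"
  define \<kappa> where "\<kappa> = (\<lambda>z. r * ((z - 1) div int n) + max 0 ((z - 1) mod int n - int i - 1))"
  have r: "0 < r" "r < int n" using i by (auto simp: r_def)
  have n0: "0 < int n" using n3 by simp
  have ydec: "y (c + r * q) = int n * q + (if c = 0 then 0 else c + int i + 1)"
    if "0 \<le> c" "c < r" for c q
    using that by (simp add: y_def)
  have kdec: "\<kappa> (j + int n * q) = r * q + max 0 (j - int i - 2)" if "1 \<le> j" "j \<le> int n" for j q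
  proof -
    have e: "j + int n * q - 1 = (j - 1) + int n * q" by simp
    show ?thesis unfolding \<kappa>_def e using that by simp
  qed
  have yper: "y (k + r) = y k + int n" for k
    using r by (simp add: y_def distrib_left)
  have kper: "\<kappa> (z + int n) = \<kappa> z + r" for z
  proof -
    have e: "z + int n - 1 = z - 1 + int n" by simp
    show ?thesis unfolding \<kappa>_def e using n0 by (simp add: distrib_left)
  qed
  have "mono y"
  proof (rule mono_int_step)
    fix k
    define c q where "c = k mod r" and "q = k div r"
    have c: "0 \<le> c" "c < r" and k: "k = c + r * q" using r by (simp_all add: c_def q_def)
    show "y k \<le> y (k + 1)"
    proof (cases "c + 1 < r")
      case True
      have e: "k + 1 = (c + 1) + r * q" using k by simp
      have "y (k + 1) = int n * q + (c + 1 + int i + 1)" unfolding e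
        using c True by (subst ydec) auto
      moreover have "y k = int n * q + (if c = 0 then 0 else c + int i + 1)"
        unfolding k using c by (rule ydec)
      ultimately show ?thesis using c by simp
    next
      case False
      have e: "k + 1 = 0 + r * (q + 1)" using k c False by (simp add: distrib_left)
      have "y (k + 1) = int n * (q + 1)" unfolding e using r by (subst ydec) auto
      moreover have "y k = int n * q + (if c = 0 then 0 else c + int i + 1)"
        unfolding k using c by (rule ydec)
      ultimately show ?thesis using c by (simp add: distrib_left r_def)
    qed
  qed
  moreover have "mono \<kappa>"
  proof (rule mono_int_step)
    fix z
    obtain j q where j: "j \<in> {1..int n}" and z: "z = j + int n * q" using ex_window by blast
    have kz: "\<kappa> z = r * q + max 0 (j - int i - 2)" unfolding z using j by (intro kdec) auto
    show "\<kappa> z \<le> \<kappa> (z + 1)"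
    proof (cases "j = int n")
      case True
      have e: "z + 1 = 1 + int n * (q + 1)" using z True by (simp add: distrib_left)
      have "\<kappa> (z + 1) = r * (q + 1) + max 0 (1 - int i - 2)" unfolding e
        using n0 by (intro kdec) auto
      thus ?thesis using kz True r by (simp add: distrib_left r_def)
    next
      case False
      have e: "z + 1 = (j + 1) + int n * q" using z by simp
      have "\<kappa> (z + 1) = r * q + max 0 (j + 1 - int i - 2)" unfolding e
        using j False by (intro kdec) auto
      thus ?thesis using kz by simp
    qed
  qed
  moreover have "word_act (s_word i) z = y (\<kappa> z)" for z
  proof -
    obtain j' q where j': "j' \<in> {1..int n}" and z': "z = j' + int n * q" using ex_window by blast
    define j where "j = nat j'"
    have j: "1 \<le> j" "j \<le> n" "j' = int j" using j' by (auto simp: j_def)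
    hence z: "z = int j + int n * q" using z' by simp
    have kz: "\<kappa> z = max 0 (int j - int i - 2) + r * q" unfolding z using j by (subst kdec) auto
    have "y (\<kappa> z) = int n * q + (if max 0 (int j - int i - 2) = 0 then 0
            else max 0 (int j - int i - 2) + int i + 1)"
      unfolding kz using j r by (intro ydec) (auto simp: r_def)
    also have "\<dots> = int (if j \<le> i + 2 then 0 else j - 1) + int n * q" using j by auto
    finally show ?thesis using s_word_window[OF i j(1,2), of q] z by simp
  qed
  moreover have "\<kappa> (y k) = k - 1" for k
  proof -
    define c q where "c = k mod r" and "q = k div r"
    have c: "0 \<le> c" "c < r" and k: "k = c + r * q" using r by (simp_all add: c_def q_def)
    show ?thesis
    proof (cases "c = 0")
      case True
      have "y k = int n * q" unfolding k using ydec[OF c] True by simp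
      hence e: "y k = int n + int n * (q - 1)" by (simp add: right_diff_distrib)
      have "\<kappa> (y k) = r * (q - 1) + max 0 (int n - int i - 2)" unfolding e
        using n0 by (intro kdec) auto
      thus ?thesis using k True i by (simp add: right_diff_distrib r_def)
    next
      case False
      have e: "y k = (c + int i + 1) + int n * q" unfolding k using ydec[OF c, of q] False by simp
      have "\<kappa> (y k) = r * q + max 0 (c + int i + 1 - int i - 2)" unfolding e
        using c by (intro kdec) (auto simp: r_def)
      thus ?thesis using k c False by simp
    qed
  qed
  moreover have "y 0 = 0" by (simp add: y_def)
  moreover have "\<kappa> z \<le> r * (z div int n) + r" for z
  proof -
    have "(z - 1) div int n \<le> z div int n" using n0 by (intro zdiv_mono1) auto
    hence "r * ((z - 1) div int n) \<le> r * (z div int n)" using r by (intro mult_left_mono) auto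
    moreover have "(z - 1) mod int n - int i - 1 \<le> r"
      using pos_mod_bound[OF n0, of "z - 1"] unfolding r_def by linarith
    hence "max 0 ((z - 1) mod int n - int i - 1) \<le> r" using r(1) by simp
    ultimately show ?thesis unfolding \<kappa>_def by linarith
  qed
  ultimately show ?thesis using yper kper by blast
qed

section \<open>Divisibility by and of powers of these elements\<close>

text \<open>
  The composite of \<open>\<kappa>\<close> and \<open>p\<close> changes integers by a bounded amount, which a shift of the index by
  multiples of \<open>r\<close> compensates.
\<close>

lemma compress_below:
  fixes \<kappa> p :: "int \<Rightarrow> int"
  assumes "\<And>z. \<kappa> (z + int n) = \<kappa> z + r" "\<And>k. p (k + r) = p k + int n"
  shows "\<exists>B. \<forall>t\<ge>B. \<forall>z. p (\<kappa> z - r * t) \<le> z"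
proof -
  have "\<exists>B\<ge>0. \<forall>z. p (\<kappa> z) \<le> z + B"
    using n3 by (intro periodic_bounded[of _ "int n"]) (simp_all add: assms)
  then obtain B where B: "B \<ge> 0" "\<And>z. p (\<kappa> z) \<le> z + B" by blast
  have "p (\<kappa> z - r * t) \<le> z" if "B \<le> t" for t z
  proof -
    have "p (\<kappa> z + r * (- t)) = p (\<kappa> z) + int n * (- t)"
      by (rule quasi_periodic_mult) (rule assms(2))
    moreover have "t \<le> int n * t" using that B(1) n3 by (simp add: mult_le_cancel_right1)
    ultimately show ?thesis using B(2)[of z] that by simp
  qed
  thus ?thesis by blast
qed

lemma word_act_replicate:
  assumes "\<And>z. word_act s z = y (\<kappa> z)" "\<And>k. \<kappa> (y k) = k - 1"
  shows "word_act (concat (replicate (Suc m) s)) z = y (\<kappa> z - int m)"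
  by (induction m) (simp_all add: assms algebra_simps)

text \<open>
  Choose \<open>r\<close> ascents of the map \<open>f\<close> of \<open>w\<close> in each period, enumerated by \<open>p\<close>; then \<open>f\<close> is injective on
  them. The right cofactor sends an integer to the chosen point with index \<open>\<kappa> z\<close>, shifted down far
  enough; the left cofactor reads off the index from the value under \<open>f\<close> and evaluates \<open>y\<close>. Shifting
  both sufficiently makes the two maps descend.
\<close>

lemma many_ascents_divides_power:
  assumes w: "w \<in> W" and i: "i + 2 \<le> n" and asc: "n - 1 - i \<le> ascents (word_act w)"
  shows "\<exists>a \<in> W. \<exists>b \<in> W. \<exists>m. a @ w @ b \<approx> concat (replicate m (s_word i))"
proof -
  define r where "r = int n - 1 - int i"
  have r: "0 < r" "r < int n" "r \<le> int (ascents (word_act w))" using i asc by (auto simp: r_def)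
  obtain \<kappa> y where ky: "mono \<kappa>" "\<And>z. \<kappa> (z + int n) = \<kappa> z + r" "mono y" "\<And>k. y (k + r) = y k + int n"
     "\<And>z. word_act (s_word i) z = y (\<kappa> z)" "\<And>k. \<kappa> (y k) = k - 1"
    using s_word_factors[OF i] unfolding r_def by blast
  define f where "f = word_act w"
  have f: "lowering_map f" by (simp add: f_def lowering_map_word_act)
  obtain K where K: "mono K" "\<And>z. K (z + int n) = K z + r"
     "\<And>z. K (z + 1) \<le> K z + 1" "\<And>z. K z < K (z + 1) \<Longrightarrow> f z < f (z + 1)"
    using ascent_counting[OF f r(1)] r(3) unfolding f_def by blast
  obtain p where p: "mono p" "\<And>z. p (z + r) = p z + int n" "\<And>z k. K k \<le> z \<longleftrightarrow> k \<le> p z"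
    using upper_adjoint[OF K(1,2)] r(1) n3 by auto
  have Kp: "K (p k) \<le> k" "k < K (p k + 1)" for k
    using p(3)[of "p k" k] p(3)[of "p k + 1" k] by auto
  define F where "F = (\<lambda>k. f (p k))"
  have Fper: "F (k + r) = F k + int n" for k using f by (simp add: F_def p lowering_map_def)
  have Fstep: "F k < F (k + 1)" for k
  proof -
    have "p k < p (k + 1)"
    proof (rule ccontr)
      assume "\<not> ?thesis"
      hence "p (k + 1) = p k" using monoD[OF p(1), of k "k + 1"] by simp
      thus False using Kp(1)[of k] Kp(2)[of "k + 1"] K(3)[of "p k"] by simp
    qed
    moreover have "f (p k) < f (p k + 1)" using Kp[of k] by (intro K(4)) simp
    ultimately show ?thesis
      using f monoD[of f "p k + 1" "p (k + 1)"] by (simp add: F_def lowering_map_def)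
  qed
  have "mono F" by (rule mono_int_step) (simp add: less_imp_le Fstep)
  obtain g where g: "mono g" "\<And>z. g (z + int n) = g z + r" "\<And>z k. F k \<le> z \<longleftrightarrow> k \<le> g z"
    using upper_adjoint[OF \<open>mono F\<close> Fper] r(1) n3 by auto
  have gF: "g (F k) = k" for k
  proof (rule antisym)
    show "k \<le> g (F k)" using g(3) by blast
    show "g (F k) \<le> k"
    proof (rule ccontr)
      assume "\<not> ?thesis"
      hence "F (k + 1) \<le> F k" using g(3)[of "k + 1" "F k"] by simp
      thus False using Fstep[of k] by simp
    qed
  qed
  obtain t where t: "\<And>z. p (\<kappa> z - r * t) \<le> z"
    using compress_below[where \<kappa> = \<kappa> and p = p, OF ky(2) p(2)] by blast
  obtain B where B: "\<And>t z. t \<ge> B \<Longrightarrow> y (g z - r * t) \<le> z"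
    using compress_below[where \<kappa> = g and p = y, OF g(2) ky(4)] by blast
  \<comment> \<open>\<open>u\<close> makes the left cofactor descend and keeps the exponent \<open>r (u + t)\<close> nonnegative.\<close>
  define u where "u = max B (max 0 (- t))"
  define m where "m = nat (r * (u + t))"
  have m: "int m = r * (u + t)" using r(1) by (simp add: m_def u_def)
  have "\<exists>b \<in> W. word_act b = (\<lambda>z. p (\<kappa> z - r * t))"
    using word_act_factor[where \<kappa> = "\<lambda>z. \<kappa> z - r * t" and p = p and r = r] t
    by (simp add: ky(2) p r monoI monoD[OF ky(1)])
  then obtain b where b: "b \<in> W" "\<And>z. word_act b z = p (\<kappa> z - r * t)" by metis
  have "\<exists>a \<in> W. word_act a = (\<lambda>z. y (g z - r * u))"
    using word_act_factor[where \<kappa> = "\<lambda>z. g z - r * u" and p = y and r = r] B[of u]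
    by (simp add: ky g r monoI monoD[OF g(1)] u_def)
  then obtain a where a: "a \<in> W" "\<And>z. word_act a z = y (g z - r * u)" by metis
  have "word_act (a @ w @ b) z = word_act (concat (replicate (Suc m) (s_word i))) z" for z
  proof -
    have "word_act (a @ w @ b) z = y (g (F (\<kappa> z - r * t)) - r * u)"
      by (simp add: a b F_def f_def)
    also have "\<dots> = y (\<kappa> z - int m)" by (simp add: gF m distrib_left algebra_simps)
    finally show ?thesis unfolding word_act_replicate[OF ky(5,6)] .
  qed
  moreover have "concat (replicate (Suc m) (s_word i)) \<in> W"
    using s_word_in[OF i] by (rule concat_replicate_in)
  ultimately have "a @ w @ b \<approx> concat (replicate (Suc m) (s_word i))"
    using a(1) b(1) w by (subst cong_iff_word_act) (auto simp: fun_eq_iff)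
  thus ?thesis using a(1) b(1) by blast
qed

text \<open>
  As \<open>f\<close> has at most \<open>r\<close> ascents, it is a function of the ascent count \<open>K\<close>. The right cofactor places
  \<open>z\<close> at the member of the image of \<open>s\<^sub>i\<close> with index \<open>K z - r\<close>, which \<open>s\<^sub>i\<close> turns into index \<open>K z - r - 1\<close>;
  the left cofactor recovers \<open>K z\<close> from it and applies \<open>f\<close>. The left cofactor may overshoot \<open>z\<close> by up
  to \<open>5 n\<close> before \<open>f\<close> is applied, which the displacement of \<open>f\<close> compensates.
\<close>

lemma few_ascents_divisible:
  assumes w: "w \<in> W" and i: "i + 2 \<le> n" and asc: "ascents (word_act w) \<le> n - 1 - i"
    and far: "\<And>z. word_act w z \<le> z - 5 * int n"
  shows "\<exists>a \<in> W. \<exists>b \<in> W. a @ s_word i @ b \<approx> w"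
proof -
  define r where "r = int n - 1 - int i"
  have r: "0 < r" "r < int n" "int (ascents (word_act w)) \<le> r" using i asc by (auto simp: r_def)
  obtain \<kappa> y where ky: "mono \<kappa>" "\<And>z. \<kappa> (z + int n) = \<kappa> z + r" "mono y" "\<And>k. y (k + r) = y k + int n"
     "\<And>z. word_act (s_word i) z = y (\<kappa> z)" "\<And>k. \<kappa> (y k) = k - 1" "y 0 = 0"
     "\<And>z. \<kappa> z \<le> r * (z div int n) + r"
    using s_word_factors[OF i] unfolding r_def by blast
  define f where "f = word_act w"
  have f: "lowering_map f" by (simp add: f_def lowering_map_word_act)
  obtain K where K: "mono K" "\<And>z. K (z + int n) = K z + r"
     "\<And>z. r * (z div int n) \<le> K z" "\<And>z. K z \<le> r * (z div int n) + r"
     "\<And>z. f z < f (z + 1) \<Longrightarrow> K z < K (z + 1)"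
    using ascent_counting[OF f r(1)] r(3) unfolding f_def by blast
  obtain p where p: "mono p" "\<And>z. p (z + r) = p z + int n" "\<And>z k. K k \<le> z \<longleftrightarrow> k \<le> p z"
    using upper_adjoint[OF K(1,2)] r(1) n3 by auto
  \<comment> \<open>A strict increase of \<open>f\<close> would force one of \<open>K\<close>.\<close>
  have fK: "f x = f z" if "z \<le> x" "K x = K z" for x z
    using that
  proof (induction x rule: int_ge_induct)
    case (step x)
    have "K z \<le> K x" "K x \<le> K (x + 1)" using step.hyps by (simp_all add: monoD[OF K(1)])
    hence e: "K x = K z" "K x = K (x + 1)" using step.prems by auto
    have "f (x + 1) \<le> f x" using K(5)[of x] e(2) by (rule_tac ccontr) simp
    moreover have "f x \<le> f (x + 1)" using f monoD[of f x "x + 1"] by (simp add: lowering_map_def)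
    ultimately show ?case using step.IH e(1) by simp
  qed simp
  have fp: "f (p (K z)) = f z" for z
  proof (rule fK)
    show "z \<le> p (K z)" using p(3) by blast
    hence "K z \<le> K (p (K z))" by (rule monoD[OF K(1)])
    moreover have "K (p (K z)) \<le> K z" using p(3) by blast
    ultimately show "K (p (K z)) = K z" by simp
  qed
  have dvle: "int n * (z div int n) \<le> z" for z
    using pos_mod_sign[of "int n" z] mult_div_mod_eq[of "int n" z] n3 by linarith
  have below: "y (K z - r) \<le> z" for z
  proof -
    have "y (K z - r) \<le> y (r * (z div int n))" using K(4)[of z] by (intro monoD[OF ky(3)]) simp
    also have "\<dots> = int n * (z div int n)"
      using quasi_periodic_mult[of y r "int n" 0, OF ky(4)] ky(7) by simp
    also have "\<dots> \<le> z" by (rule dvle)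
    finally show ?thesis .
  qed
  have "\<exists>b \<in> W. word_act b = (\<lambda>z. y (K z - r))"
    using word_act_factor[where \<kappa> = "\<lambda>z. K z - r" and p = y and r = r] below
    by (simp add: ky K r monoI monoD[OF K(1)])
  then obtain b where b: "b \<in> W" "\<And>z. word_act b z = y (K z - r)" by metis
  \<comment> \<open>The point chosen by \<open>p\<close> lies at most \<open>5 n\<close> above \<open>z\<close>.\<close>
  have below': "f (p (\<kappa> z + (r + 2))) \<le> z" for z
  proof -
    define k where "k = \<kappa> z + (r + 2)"
    have "r * (p k div int n) \<le> K (p k)" by (rule K(3))
    also have "\<dots> \<le> k" using p(3) by blast
    also have "k \<le> r * (z div int n) + r + r + 2 * r" using ky(8)[of z] r(1) by (simp add: k_def)
    also have "\<dots> = r * (z div int n + 4)" by (simp add: distrib_left)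
    finally have "p k div int n \<le> z div int n + 4" using r(1) by simp
    hence "int n * (p k div int n) \<le> int n * (z div int n + 4)" using n3 by (intro mult_left_mono) auto
    moreover have "p k = int n * (p k div int n) + p k mod int n" "p k mod int n < int n"
      using n3 by simp_all
    moreover have "int n * (z div int n) \<le> z" by (rule dvle)
    ultimately have "p k \<le> z + 5 * int n" unfolding distrib_left by linarith
    thus ?thesis using far[of "p k"] by (simp add: f_def k_def)
  qed
  have "\<exists>a \<in> W. word_act a = (\<lambda>z. f (p (\<kappa> z + (r + 2))))"
    using word_act_factor[where \<kappa> = "\<lambda>z. \<kappa> z + (r + 2)" and p = "\<lambda>k. f (p k)" and r = r] below' f
    by (simp add: ky p r monoI monoD[OF ky(1)] monoD[OF p(1)] lowering_map_def monoD[of f])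
  then obtain a where a: "a \<in> W" "\<And>z. word_act a z = f (p (\<kappa> z + (r + 2)))" by metis
  have "word_act (a @ s_word i @ b) z = word_act w z" for z
    by (simp add: a b ky(5,6) fp) (simp add: f_def)
  moreover have "s_word i \<in> W" by (rule s_word_in[OF i])
  ultimately have "a @ s_word i @ b \<approx> w"
    using a(1) b(1) w by (subst cong_iff_word_act) (auto simp: fun_eq_iff)
  thus ?thesis using a(1) b(1) by blast
qed

end

section \<open>Burnside's theorem\<close>

definition mscale :: "'k \<Rightarrow> 'k::field^'j^'j \<Rightarrow> 'k^'j^'j" where
  "mscale c A = (\<chi> p q. c * A $ p $ q)"

lemma mscale_mult_vec: "mscale c A *v x = c *s (A *v x)"
  by (simp add: vec_eq_iff mscale_def matrix_vector_mult_def sum_distrib_left mult.assoc)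

lemma mult_vec_scale: "(A :: 'k::field^'j^'i) *v (c *s x) = c *s (A *v x)"
  by (rule vec.linear_scale) simp

text \<open>
  A polynomial of least degree that annihilates \<open>v\<close> in the sense of \<open>act p = 0\<close> has a root \<open>l\<close>;
  dividing by the linear factor and applying the quotient to \<open>v\<close> gives an eigenvector, nonzero by
  minimality of the degree.
\<close>

lemma eigenvector_exists:
  fixes B :: "'k::alg_closed_field^'j^'j"
  assumes "vec.subspace U" and inv: "\<And>u. u \<in> U \<Longrightarrow> B *v u \<in> U" and v: "v \<in> U" "v \<noteq> 0"
  shows "\<exists>l. \<exists>w \<in> U. w \<noteq> 0 \<and> B *v w = l *s w"
proof -
  define iter where "iter i = (((*v) B) ^^ i) v" for i
  have iter_Suc: "iter (Suc i) = B *v iter i" for i by (simp add: iter_def)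
  have iter_U: "iter i \<in> U" for i by (induction i) (simp_all add: iter_def v inv)
  define act where "act p = (\<Sum>i\<le>degree p. coeff p i *s iter i)" for p :: "'k poly"
  have act: "act p = (\<Sum>i\<le>m. coeff p i *s iter i)" if "degree p \<le> m" for p m
    unfolding act_def using that by (intro sum.mono_neutral_left) (auto simp: coeff_eq_0)
  have act_U: "act p \<in> U" for p
    unfolding act_def using assms(1) by (intro vec.subspace_sum vec.subspace_scale iter_U)
  \<comment> \<open>Otherwise the first \<open>k\<close> iterates would be independent for every \<open>k\<close>.\<close>
  have "\<exists>k. iter k \<in> vec.span (iter ` {..<k})"
  proof (rule ccontr)
    assume c: "\<not> ?thesis"
    have "vec.independent (iter ` {..<k}) \<and> card (iter ` {..<k}) = k" for k
    proof (induction k)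
      case (Suc k)
      have nk: "iter k \<notin> vec.span (iter ` {..<k})" using c by blast
      hence "iter k \<notin> iter ` {..<k}" using vec.span_base[of "iter k" "iter ` {..<k}"] by blast
      thus ?case using Suc nk by (simp add: lessThan_Suc vec.independent_insertI)
    qed (simp add: vec.independent_empty)
    hence "vec.independent (iter ` {..<Suc CARD('j)})" "card (iter ` {..<Suc CARD('j)}) = Suc CARD('j)"
      by blast+
    hence "Suc CARD('j) \<le> vec.dim (iter ` {..<Suc CARD('j)})"
      using vec.independent_bound_general[of "iter ` {..<Suc CARD('j)}"] by simp
    moreover have "vec.dim (iter ` {..<Suc CARD('j)}) \<le> CARD('j)" by (rule dim_subset_UNIV_cart_gen)
    ultimately show False by simp
  qed
  then obtain k where k: "iter k \<in> vec.span (iter ` {..<k})" by blast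
  have "vec.span (iter ` {..<k}) \<subseteq> {x. \<exists>c. x = (\<Sum>i<k. c i *s iter i)}"
  proof (rule vec.span_minimal)
    show "iter ` {..<k} \<subseteq> {x. \<exists>c. x = (\<Sum>i<k. c i *s iter i)}"
    proof (rule image_subsetI)
      fix i assume "i \<in> {..<k}"
      hence "iter i = (\<Sum>m<k. (if m = i then 1 else 0) *s iter m)"
        by (simp add: if_distrib[where f = "\<lambda>c. c *s _"] sum.delta cong: if_cong)
      thus "iter i \<in> {x. \<exists>c. x = (\<Sum>i<k. c i *s iter i)}"
        by (intro CollectI exI[where x = "\<lambda>m. if m = i then 1 else 0"])
    qed
    show "vec.subspace {x. \<exists>c. x = (\<Sum>i<k. c i *s iter i)}"
    proof (rule vec.subspaceI)
      show "0 \<in> {x. \<exists>c. x = (\<Sum>i<k. c i *s iter i)}"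
        by (auto intro!: exI[of _ "\<lambda>_. 0"])
    next
      fix x y assume "x \<in> {x. \<exists>c. x = (\<Sum>i<k. c i *s iter i)}" "y \<in> {x. \<exists>c. x = (\<Sum>i<k. c i *s iter i)}"
      then obtain c d where "x = (\<Sum>i<k. c i *s iter i)" "y = (\<Sum>i<k. d i *s iter i)" by blast
      hence "x + y = (\<Sum>i<k. (c i + d i) *s iter i)"
        by (simp add: sum.distrib vec.scale_left_distrib)
      thus "x + y \<in> {x. \<exists>c. x = (\<Sum>i<k. c i *s iter i)}" by (auto intro!: exI[of _ "\<lambda>i. c i + d i"])
    next
      fix a x assume "x \<in> {x. \<exists>c. x = (\<Sum>i<k. c i *s iter i)}"
      then obtain c where "x = (\<Sum>i<k. c i *s iter i)" by blast
      hence "a *s x = (\<Sum>i<k. (a * c i) *s iter i)"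
        by (simp add: vec.scale_sum_right)
      thus "a *s x \<in> {x. \<exists>c. x = (\<Sum>i<k. c i *s iter i)}" by (auto intro!: exI[of _ "\<lambda>i. a * c i"])
    qed
  qed
  with k obtain c where c: "iter k = (\<Sum>i<k. c i *s iter i)" by blast
  define p0 where "p0 = monom 1 k - (\<Sum>i<k. monom (c i) i)"
  have cf: "coeff (\<Sum>i<k. monom (c i) i) m = (if m < k then c m else 0)" for m
    by (simp add: coeff_sum)
  have cp0: "coeff p0 m = (if m = k then 1 else if m < k then - c m else 0)" for m
    by (simp add: p0_def cf)
  have "degree p0 \<le> k" by (rule degree_le) (simp add: cp0)
  hence "act p0 = (\<Sum>i\<le>k. coeff p0 i *s iter i)" by (rule act)
  also have "\<dots> = (\<Sum>i<k. coeff p0 i *s iter i) + iter k"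
    by (simp add: lessThan_Suc_atMost[symmetric] cp0)
  also have "(\<Sum>i<k. coeff p0 i *s iter i) = - (\<Sum>i<k. c i *s iter i)"
    unfolding sum_negf[symmetric] by (intro sum.cong) (auto simp: cp0)
  finally have "act p0 = 0" using c by simp
  moreover have "p0 \<noteq> 0" using cp0[of k] by auto
  ultimately have "\<exists>p. (p \<noteq> 0 \<and> act p = 0) \<and> (\<forall>q. q \<noteq> 0 \<and> act q = 0 \<longrightarrow> degree p \<le> degree q)"
    using ex_has_least_nat[of "\<lambda>p. p \<noteq> 0 \<and> act p = 0" p0 degree] by blast
  then obtain p where p: "p \<noteq> 0" "act p = 0" "\<And>q. q \<noteq> 0 \<Longrightarrow> act q = 0 \<Longrightarrow> degree p \<le> degree q"
    by blast
  have "degree p > 0"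
  proof (rule ccontr)
    assume "\<not> ?thesis"
    hence "degree p = 0" by simp
    then obtain a where "p = [:a:]" by (rule degree_eq_zeroE)
    thus False using p(1,2) v(2) by (simp add: act_def iter_def)
  qed
  then obtain l where "poly p l = 0" using alg_closed_imp_poly_has_root[of p] by blast
  then obtain q where q: "p = [:- l, 1:] * q" by (auto simp: poly_eq_0_iff_dvd elim: dvdE)
  have q0: "q \<noteq> 0" using q p(1) by auto
  have "degree p = Suc (degree q)" unfolding q using q0 by (subst degree_mult_eq) auto
  hence w0: "act q \<noteq> 0" using p(3)[OF q0] by auto
  have "act p = (\<Sum>i\<le>Suc (degree q). coeff p i *s iter i)" by (rule act) (simp add: \<open>degree p = _\<close>)
  also have "\<dots> = (\<Sum>i\<le>Suc (degree q). (coeff (pCons 0 q) i) *s iter i - (l * coeff q i) *s iter i)"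
    by (intro sum.cong) (auto simp: q mult_pCons_left vec.scale_left_diff_distrib)
  also have "\<dots> = (\<Sum>i\<le>Suc (degree q). (coeff (pCons 0 q) i) *s iter i) -
      (\<Sum>i\<le>Suc (degree q). (l * coeff q i) *s iter i)" by (rule sum_subtractf)
  also have "(\<Sum>i\<le>Suc (degree q). (coeff (pCons 0 q) i) *s iter i) = (\<Sum>i\<le>degree q. coeff q i *s iter (Suc i))"
    by (subst sum.atMost_Suc_shift) simp
  also have "\<dots> = B *v act q"
    unfolding act_def iter_Suc by (simp add: vec.linear_sum[OF matrix_vector_mul_linear_gen] mult_vec_scale)
  also have "(\<Sum>i\<le>Suc (degree q). (l * coeff q i) *s iter i) = l *s act q"
    by (subst act[of q "Suc (degree q)"]) (simp_all add: vec.scale_sum_right vec.scale_right_distrib)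
  finally have "B *v act q = l *s act q" using p(2) by simp
  thus ?thesis using w0 act_U by blast
qed

text \<open>
  The identity matrix is not assumed to be a member, because the algebra will be the image of
  \<open>K\<^sub>0[M\<^sub>i]\<close>; a nonzero member is required to exclude the zero action in dimension one.
\<close>

locale irreducible_matrix_algebra =
  fixes A :: "('k::field^'j^'j) set"
  assumes add: "a \<in> A \<Longrightarrow> b \<in> A \<Longrightarrow> a + b \<in> A"
    and scale: "a \<in> A \<Longrightarrow> mscale c a \<in> A"
    and mult: "a \<in> A \<Longrightarrow> b \<in> A \<Longrightarrow> a ** b \<in> A"
    and nonzero: "\<exists>a \<in> A. a \<noteq> 0"
    and irr: "vec.subspace U \<Longrightarrow> (\<And>a u. a \<in> A \<Longrightarrow> u \<in> U \<Longrightarrow> a *v u \<in> U) \<Longrightarrow> U = {0} \<or> U = UNIV"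
begin

text \<open>
  The vectors killed by the algebra form an invariant subspace, which is zero. So the orbit of a
  nonzero vector is a nonzero invariant subspace.
\<close>

lemma transitive:
  assumes "v \<noteq> 0" shows "\<exists>a \<in> A. a *v v = x"
proof -
  define Z where "Z = {v. \<forall>a \<in> A. a *v v = 0}"
  have "Z = {0} \<or> Z = UNIV"
  proof (rule irr)
    show "vec.subspace Z"
      by (rule vec.subspaceI) (auto simp: Z_def matrix_vector_right_distrib mult_vec_scale)
    show "a *v u \<in> Z" if "a \<in> A" "u \<in> Z" for a u using that by (auto simp: Z_def)
  qed
  moreover obtain a where "a \<in> A" "a \<noteq> 0" using nonzero by blast
  hence "Z \<noteq> UNIV" using matrix_eq[of a 0] by (auto simp: Z_def)
  ultimately have "v \<notin> Z" using assms by auto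
  define R where "R = {a *v v | a. a \<in> A}"
  have "R = {0} \<or> R = UNIV"
  proof (rule irr)
    show "vec.subspace R"
    proof (rule vec.subspaceI)
      show "0 \<in> R" using scale[OF \<open>a \<in> A\<close>, of 0] mscale_mult_vec[of 0 a v]
        by (auto simp: R_def intro!: exI[of _ "mscale 0 a"])
      show "x + y \<in> R" if "x \<in> R" "y \<in> R" for x y
      proof -
        from that obtain a b where "a \<in> A" "b \<in> A" "x = a *v v" "y = b *v v" by (auto simp: R_def)
        thus ?thesis using add[of a b] matrix_vector_mult_add_rdistrib[of a b v]
          unfolding R_def by (auto intro!: exI[of _ "a + b"])
      qed
      show "c *s x \<in> R" if "x \<in> R" for c x
      proof -
        from that obtain a where "a \<in> A" "x = a *v v" by (auto simp: R_def)
        thus ?thesis using scale[of a c] mscale_mult_vec[of c a v]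
          unfolding R_def by (auto intro!: exI[of _ "mscale c a"])
      qed
    qed
    show "b *v u \<in> R" if "b \<in> A" "u \<in> R" for b u
    proof -
      from that obtain a where "a \<in> A" "u = a *v v" by (auto simp: R_def)
      thus ?thesis using mult[OF that(1), of a] unfolding R_def
        by (auto simp: matrix_vector_mul_assoc intro!: exI[of _ "b ** a"])
    qed
  qed
  moreover have "R \<noteq> {0}" using \<open>v \<notin> Z\<close> by (auto simp: Z_def R_def)
  ultimately have "x \<in> R" by auto
  thus ?thesis by (auto simp: R_def)
qed

lemma sum_closed: "finite S \<Longrightarrow> (\<And>s. s \<in> S \<Longrightarrow> f s \<in> A) \<Longrightarrow> sum f S \<in> A"
proof (induction S rule: finite_induct)
  case empty
  obtain a where "a \<in> A" using nonzero by blast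
  from scale[OF this, of 0] show ?case by (simp add: mscale_def zero_vec_def)
qed (auto intro: add)

end

definition outer :: "'k::field^'j \<Rightarrow> 'k^'j \<Rightarrow> 'k^'j^'j" where
  "outer u f = (\<chi> p q. u $ p * f $ q)"

lemma mult_outer: "a ** outer u f = outer (a *v u) f"
  by (simp add: vec_eq_iff outer_def matrix_matrix_mult_def matrix_vector_mult_def sum_distrib_right mult.assoc)

lemma outer_mult: "outer u f ** b = outer u (f v* b)"
  by (simp add: vec_eq_iff outer_def matrix_matrix_mult_def vector_matrix_mult_def sum_distrib_left mult_ac)

lemma separating_functional:
  fixes F :: "('k::field^'j) set"
  assumes "vec.subspace F" "F \<noteq> UNIV"
  shows "\<exists>m. m \<noteq> 0 \<and> (\<forall>y \<in> F. (\<Sum>q\<in>UNIV. m $ q * y $ q) = 0)"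
proof -
  obtain x where x: "x \<notin> F" using assms(2) by blast
  obtain Bs where Bs: "Bs \<subseteq> F" "vec.independent Bs" "F \<subseteq> vec.span Bs" "card Bs = vec.dim F"
    by (rule vec.basis_exists)
  have sp: "vec.span Bs = F"
    using Bs assms(1) vec.span_minimal[OF Bs(1) assms(1)] by blast
  hence "vec.independent (insert x Bs)" using Bs x by (intro vec.independent_insertI) auto
  then obtain g where g: "Vector_Spaces.linear (*s) (*s) g" "\<And>y. y \<in> insert x Bs \<Longrightarrow> g y = (if y = x then x else 0)"
    using vec.linear_independent_extend[of "insert x Bs" "\<lambda>y. if y = x then x else (0 :: 'k^'j)"] by blast
  have g0: "g y = 0" if "y \<in> F" for y
  proof (rule vec.linear_eq_0_on_span[OF g(1), of Bs])
    show "g z = 0" if "z \<in> Bs" for z using g(2)[of z] that x Bs(1) by auto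
    show "y \<in> vec.span Bs" using that sp by simp
  qed
  have "x \<noteq> 0" using x vec.subspace_0[OF assms(1)] by blast
  then obtain p where p: "x $ p \<noteq> 0" by (auto simp: vec_eq_iff)
  define m where "m = matrix g $ p"
  have dot: "(\<Sum>q\<in>UNIV. m $ q * y $ q) = g y $ p" for y
  proof -
    have "g y = matrix g *v y" by (simp add: matrix_works[OF g(1)])
    thus ?thesis by (simp add: m_def matrix_vector_mult_def)
  qed
  have "m \<noteq> 0"
  proof
    assume "m = 0"
    hence "g x $ p = 0" unfolding dot[symmetric] by simp
    thus False using g(2)[of x] p by simp
  qed
  thus ?thesis using dot g0 by (intro exI[of _ m]) simp
qed

text \<open>
  The products \<open>a T b\<close> of a rank-one matrix \<open>T\<close> are the \<open>outer x g\<close> with arbitrary \<open>x\<close> by transitivity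
  and with \<open>g\<close> ranging over a space of functionals \<open>F\<close>. A nonzero vector annihilated by all of \<open>F\<close>
  would generate the whole space under the algebra, so \<open>f\<close> would vanish; hence \<open>F\<close> is everything,
  and matrices are sums of such outer products.
\<close>

lemma (in irreducible_matrix_algebra) rank_one_gives_everything:
  assumes T: "outer u f \<in> A" "u \<noteq> 0" "f \<noteq> 0"
  shows "A = UNIV"
proof -
  have o: "outer x (f v* b) \<in> A" if "b \<in> A" for x b
  proof -
    obtain a where a: "a \<in> A" "a *v u = x" using transitive[OF T(2)] by blast
    have "a ** outer u f ** b \<in> A" using a(1) that T(1) by (intro mult)
    thus ?thesis by (simp add: mult_outer outer_mult a(2))
  qed
  define F where "F = {f v* b | b. b \<in> A}"
  have dot: "(\<Sum>q\<in>UNIV. m $ q * (f v* b) $ q) = (\<Sum>q\<in>UNIV. f $ q * (b *v m) $ q)" for m b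
  proof -
    have "(\<Sum>q\<in>UNIV. m $ q * (f v* b) $ q) = (\<Sum>q\<in>UNIV. \<Sum>p\<in>UNIV. f $ p * (b $ p $ q * m $ q))"
      by (simp add: vector_matrix_mult_def sum_distrib_left mult_ac)
    also have "\<dots> = (\<Sum>p\<in>UNIV. \<Sum>q\<in>UNIV. f $ p * (b $ p $ q * m $ q))" by (rule sum.swap)
    finally show ?thesis by (simp add: matrix_vector_mult_def sum_distrib_left)
  qed
  have "F = UNIV"
  proof (rule ccontr)
    assume "F \<noteq> UNIV"
    moreover have "vec.subspace F"
    proof (rule vec.subspaceI)
      obtain a where "a \<in> A" using nonzero by blast
      from scale[OF this, of 0] have "0 \<in> A" by (simp add: mscale_def zero_vec_def)
      moreover have "f v* 0 = 0" by (simp add: vec_eq_iff vector_matrix_mult_def)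
      ultimately show "0 \<in> F" unfolding F_def by (auto intro!: exI[of _ 0])
      show "x + y \<in> F" if "x \<in> F" "y \<in> F" for x y
      proof -
        from that obtain a b where ab: "a \<in> A" "b \<in> A" "x = f v* a" "y = f v* b" by (auto simp: F_def)
        hence "x + y = f v* (a + b)"
          by (simp add: vec_eq_iff vector_matrix_mult_def distrib_right sum.distrib algebra_simps)
        thus ?thesis using add[OF ab(1,2)] by (auto simp: F_def)
      qed
      show "c *s x \<in> F" if "x \<in> F" for c x
      proof -
        from that obtain a where a: "a \<in> A" "x = f v* a" by (auto simp: F_def)
        hence "c *s x = f v* mscale c a"
          by (simp add: vec_eq_iff vector_matrix_mult_def mscale_def sum_distrib_left mult_ac)
        thus ?thesis using scale[OF a(1), of c] by (auto simp: F_def)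
      qed
    qed
    ultimately obtain m where m: "m \<noteq> 0" "\<And>y. y \<in> F \<Longrightarrow> (\<Sum>q\<in>UNIV. m $ q * y $ q) = 0"
      using separating_functional[of F] by blast
    have "f $ p = 0" for p
    proof -
      obtain b where b: "b \<in> A" "b *v m = axis p 1" using transitive[OF m(1)] by blast
      have "f v* b \<in> F" using b(1) by (auto simp: F_def)
      from m(2)[OF this] have "(\<Sum>q\<in>UNIV. f $ q * (b *v m) $ q) = 0" unfolding dot .
      thus ?thesis unfolding b(2) by (simp add: axis_def if_distrib cong: if_cong)
    qed
    thus False using T(3) by (simp add: vec_eq_iff)
  qed
  have "M \<in> A" for M
  proof -
    have "M = (\<Sum>p\<in>UNIV. outer (axis p 1) (M $ p))"
      by (simp add: vec_eq_iff outer_def axis_def if_distrib if_distribR sum.delta cong: if_cong)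
    moreover have "outer (axis p 1) (M $ p) \<in> A" for p
    proof -
      have "M $ p \<in> F" using \<open>F = UNIV\<close> by simp
      thus ?thesis using o by (auto simp: F_def)
    qed
    hence "(\<Sum>p\<in>UNIV. outer (axis p 1) (M $ p)) \<in> A" by (intro sum_closed) auto
    ultimately show ?thesis by simp
  qed
  thus ?thesis by blast
qed

text \<open>
  Only a matrix of rank one has to be found. A nonzero matrix \<open>T\<close> with kernel of largest dimension
  is one: if \<open>T x\<close> and \<open>T x1\<close> were independent, choose \<open>a\<close> with \<open>a T x1 = x\<close> and an eigenvalue \<open>l\<close> of \<open>T a\<close>
  on the range of \<open>T\<close>. Then \<open>T a T - l T\<close> is nonzero and has a larger kernel.
\<close>

theorem burnside:
  fixes A :: "('k::alg_closed_field^'j^'j) set"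
  assumes "irreducible_matrix_algebra A"
  shows "A = UNIV"
proof -
  interpret irreducible_matrix_algebra A by fact
  define kern where "kern T = {x. T *v x = 0}" for T :: "'k^'j^'j"
  have sub: "vec.subspace (kern T)" for T
    by (rule vec.subspaceI) (auto simp: kern_def matrix_vector_right_distrib mult_vec_scale)
  obtain T0 where T0: "T0 \<in> A" "T0 \<noteq> 0" using nonzero by blast
  have "\<exists>T. (T \<in> A \<and> T \<noteq> 0) \<and> (\<forall>S. S \<in> A \<and> S \<noteq> 0 \<longrightarrow> vec.dim (kern S) \<le> vec.dim (kern T))"
  proof (rule ex_has_greatest_nat[where k = T0 and b = "Suc CARD('j)"])
    show "\<forall>S. S \<in> A \<and> S \<noteq> 0 \<longrightarrow> vec.dim (kern S) < Suc CARD('j)"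
      by (simp add: dim_subset_UNIV_cart_gen less_Suc_eq_le)
  qed (use T0 in auto)
  then obtain T where T: "T \<in> A" "T \<noteq> 0" "\<And>S. S \<in> A \<Longrightarrow> S \<noteq> 0 \<Longrightarrow> vec.dim (kern S) \<le> vec.dim (kern T)"
    by blast
  obtain x1 where x1: "T *v x1 \<noteq> 0" using T(2) matrix_eq[of T 0] by auto
  have rank1: "\<exists>c. T *v x = c *s (T *v x1)" for x
  proof (rule ccontr)
    assume c: "\<not> ?thesis"
    obtain a where a: "a \<in> A" "a *v (T *v x1) = x" using transitive[OF x1] by blast
    have "\<exists>l. \<exists>w \<in> range ((*v) T). w \<noteq> 0 \<and> (T ** a) *v w = l *s w"
    proof (rule eigenvector_exists)
      show "vec.subspace (range ((*v) T))"
        by (rule vec.linear_subspace_image) simp_all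
      show "(T ** a) *v w \<in> range ((*v) T)" if "w \<in> range ((*v) T)" for w
        by (simp add: matrix_vector_mul_assoc[symmetric])
    qed (use x1 in auto)
    then obtain l z where z: "T *v z \<noteq> 0" "(T ** a) *v (T *v z) = l *s (T *v z)" by blast
    define S where "S = T ** a ** T + mscale (- l) T"
    have S: "S \<in> A" unfolding S_def using T(1) a(1) by (intro add mult scale)
    have Sx: "S *v y = T *v (a *v (T *v y)) - l *s (T *v y)" for y
      by (simp add: S_def matrix_vector_mult_add_rdistrib mscale_mult_vec matrix_vector_mul_assoc[symmetric]
          vec.scale_minus_left)
    have "S *v x1 \<noteq> 0" using c a(2) by (auto simp: Sx)
    hence "S \<noteq> 0" by auto
    moreover have "kern T \<subset> kern S"
    proof
      show "kern T \<subseteq> kern S" by (auto simp: kern_def Sx)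
      have "z \<in> kern S" using z(2) by (simp add: kern_def Sx matrix_vector_mul_assoc[symmetric])
      thus "kern T \<noteq> kern S" using z(1) by (auto simp: kern_def)
    qed
    hence "vec.dim (kern T) < vec.dim (kern S)"
      using sub by (intro vec.dim_psubset) (simp add: vec.span_eq_iff[THEN iffD2])
    ultimately show False using T(3)[OF S] by simp
  qed
  then obtain h where h: "\<And>x. T *v x = h x *s (T *v x1)" by metis
  define f where "f = (\<chi> q. h (axis q 1))"
  have "T = outer (T *v x1) f"
  proof -
    have "T $ p $ q = (T *v axis q 1) $ p" for p q
      by (simp add: matrix_vector_mult_def axis_def if_distrib cong: if_cong)
    also have "(T *v axis q 1) $ p = h (axis q 1) * (T *v x1) $ p" for p q
      by (subst h) simp
    finally have "T $ p $ q = outer (T *v x1) f $ p $ q" for p q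
      by (simp add: outer_def f_def mult.commute)
    thus ?thesis by (simp only: vec_eq_iff) simp
  qed
  moreover from this have "f \<noteq> 0" using T(2) by (auto simp: outer_def vec_eq_iff)
  ultimately show ?thesis using rank_one_gives_everything[of "T *v x1" f] T(1) x1 by metis
qed

section \<open>Representations of monoid algebras\<close>

text \<open>
  The vectors killed by the ideal \<open>Q\<close> form a submodule for the whole algebra, which must be zero.
  So a \<open>Q\<close>-submodule \<open>U \<noteq> 0\<close> has \<open>Q U \<noteq> 0\<close>; the span of \<open>Q U\<close> is a submodule for the whole algebra,
  hence everything, and lies in \<open>U\<close>.
\<close>

lemma irreducible_on_ideal:
  fixes R Q :: "('k::field^'j^'j) set"
  assumes irr: "\<And>U. vec.subspace U \<Longrightarrow> (\<And>r u. r \<in> R \<Longrightarrow> u \<in> U \<Longrightarrow> r *v u \<in> U) \<Longrightarrow> U = {0} \<or> U = UNIV"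
    and left: "\<And>r q. r \<in> R \<Longrightarrow> q \<in> Q \<Longrightarrow> r ** q \<in> Q" and right: "\<And>r q. r \<in> R \<Longrightarrow> q \<in> Q \<Longrightarrow> q ** r \<in> Q"
    and nonzero: "q0 \<in> Q" "q0 \<noteq> 0"
    and U: "vec.subspace U" "\<And>q u. q \<in> Q \<Longrightarrow> u \<in> U \<Longrightarrow> q *v u \<in> U"
  shows "U = {0} \<or> U = UNIV"
proof -
  define N where "N = {v. \<forall>q \<in> Q. q *v v = 0}"
  have "N = {0} \<or> N = UNIV"
  proof (rule irr)
    show "vec.subspace N"
      by (rule vec.subspaceI) (auto simp: N_def matrix_vector_right_distrib mult_vec_scale)
    show "r *v u \<in> N" if "r \<in> R" "u \<in> N" for r u
      using that right unfolding N_def by (auto simp: matrix_vector_mul_assoc)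
  qed
  moreover have "N \<noteq> UNIV" using nonzero matrix_eq[of q0 0] by (auto simp: N_def)
  ultimately have N: "N = {0}" by blast
  define S where "S = vec.span {q *v u | q u. q \<in> Q \<and> u \<in> U}"
  have "S = {0} \<or> S = UNIV"
  proof (rule irr)
    show "vec.subspace S" by (simp add: S_def vec.subspace_span)
    show "r *v x \<in> S" if r: "r \<in> R" and "x \<in> S" for r x
      using \<open>x \<in> S\<close> unfolding S_def
    proof (induction x rule: vec.span_induct_alt)
      case base
      show ?case by (simp add: vec.span_zero)
    next
      case (step c x y)
      obtain q u where q: "q \<in> Q" "u \<in> U" "x = q *v u" using step(1) by blast
      have "r *v x \<in> {q *v u | q u. q \<in> Q \<and> u \<in> U}"
        using left[OF r q(1)] q by (auto simp: matrix_vector_mul_assoc)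
      from vec.span_add[OF vec.span_scale[OF vec.span_base[OF this], of c] step(2)]
      have "c *s (r *v x) + r *v y \<in> vec.span {q *v u | q u. q \<in> Q \<and> u \<in> U}" .
      thus ?case by (simp add: matrix_vector_right_distrib mult_vec_scale)
    qed
  qed
  moreover have "S \<subseteq> U" unfolding S_def by (rule vec.span_minimal) (use U in auto)
  moreover have "U = {0}" if "S = {0}"
  proof -
    have "u = 0" if "u \<in> U" for u
    proof -
      have "q *v u = 0" if "q \<in> Q" for q
      proof -
        have "q *v u \<in> S" unfolding S_def using that \<open>u \<in> U\<close> by (intro vec.span_base) blast
        thus ?thesis using \<open>S = {0}\<close> by simp
      qed
      hence "u \<in> N" by (simp add: N_def)
      thus ?thesis using N by simp
    qed
    thus ?thesis using vec.subspace_0[OF U(1)] by blast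
  qed
  ultimately show ?thesis by blast
qed

lemma zero_mscale [simp]: "mscale 0 A = 0" "mscale c 0 = 0" "mscale 1 A = A"
  by (simp_all add: mscale_def vec_eq_iff)

lemma sum_mult_vec: "(sum f S :: 'k::field^'j^'j) *v v = (\<Sum>x\<in>S. f x *v v)"
  by (induction S rule: infinite_finite_induct) (simp_all add: matrix_vector_mult_add_rdistrib)

locale monoid_rep = monoid G for G :: "('m, 'b) monoid_scheme" (structure) +
  fixes \<phi> :: "('m \<Rightarrow> 'k::field) \<Rightarrow> 'k^'j^'j"
  assumes rep: "representation (semigroup_algebra G) \<phi>"
begin

definition \<rho> :: "'m \<Rightarrow> 'k^'j^'j" where "\<rho> x = \<phi> (basis_elem x)"

lemma phi_add: "f \<in> lin_span (carrier G) \<Longrightarrow> g \<in> lin_span (carrier G) \<Longrightarrow> \<phi> (\<lambda>x. f x + g x) = \<phi> f + \<phi> g"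
  using rep by (simp add: representation_def semigroup_algebra_def)

lemma phi_scale: "f \<in> lin_span (carrier G) \<Longrightarrow> \<phi> (\<lambda>x. c * f x) = mscale c (\<phi> f)"
  using rep by (simp add: representation_def semigroup_algebra_def mscale_def)

lemma phi_mult: "f \<in> lin_span (carrier G) \<Longrightarrow> g \<in> lin_span (carrier G) \<Longrightarrow>
    \<phi> (f \<otimes>\<^bsub>semigroup_algebra G\<^esub> g) = \<phi> f ** \<phi> g"
  using rep by (simp add: representation_def semigroup_algebra_def)

lemma basis_in: "x \<in> S \<Longrightarrow> basis_elem x \<in> lin_span S"
  by (auto simp: basis_elem_def lin_span_def)

lemma rho_mult: "x \<in> carrier G \<Longrightarrow> y \<in> carrier G \<Longrightarrow> \<rho> (x \<otimes> y) = \<rho> x ** \<rho> y"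
proof -
  assume xy: "x \<in> carrier G" "y \<in> carrier G"
  have "basis_elem x \<otimes>\<^bsub>semigroup_algebra G\<^esub> basis_elem y = (basis_elem (x \<otimes> y) :: 'm \<Rightarrow> 'k)"
  proof
    fix z
    have "{(u, v). (basis_elem x u :: 'k) \<noteq> 0 \<and> (basis_elem y v :: 'k) \<noteq> 0 \<and> u \<otimes> v = z} =
       (if x \<otimes> y = z then {(x, y)} else {})"
      by (auto simp: basis_elem_def split: if_splits)
    thus "(basis_elem x \<otimes>\<^bsub>semigroup_algebra G\<^esub> basis_elem y) z = (basis_elem (x \<otimes> y) z :: 'k)"
      by (simp add: semigroup_algebra_def basis_elem_def)
  qed
  thus ?thesis using phi_mult[OF basis_in[OF xy(1)] basis_in[OF xy(2)]] by (simp add: \<rho>_def)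
qed

lemma phi_expand:
  assumes "finite S" "S \<subseteq> carrier G" "\<And>x. f x \<noteq> 0 \<Longrightarrow> x \<in> S"
  shows "\<phi> f = (\<Sum>x\<in>S. mscale (f x) (\<rho> x))"
  using assms
proof (induction S arbitrary: f rule: finite_induct)
  case empty
  hence f: "f = (\<lambda>x. 0)" by (auto simp: fun_eq_iff)
  hence "f \<in> lin_span (carrier G)" by (simp add: lin_span_def)
  from phi_scale[OF this, of 0] show ?case by (simp add: f)
next
  case (insert x S)
  define g where "g = f(x := 0)"
  have g: "g \<in> lin_span (carrier G)"
    using insert.prems by (auto simp: g_def lin_span_def intro: finite_subset[OF _ insert.hyps(1)])
  have b: "(basis_elem x :: 'm \<Rightarrow> 'k) \<in> lin_span (carrier G)" using insert.prems by (intro basis_in) auto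
  hence cb: "(\<lambda>y. f x * basis_elem x y) \<in> lin_span (carrier G)" by (auto simp: lin_span_def)
  have e: "(\<lambda>y. g y + f x * basis_elem x y) = f" by (auto simp: g_def basis_elem_def)
  have "\<phi> f = \<phi> g + mscale (f x) (\<rho> x)"
    using phi_add[OF g cb] unfolding e phi_scale[OF b] \<rho>_def .
  also have "\<phi> g = (\<Sum>y\<in>S. mscale (g y) (\<rho> y))"
    using insert.prems by (intro insert.IH) (auto simp: g_def split: if_splits)
  also have "\<dots> = (\<Sum>y\<in>S. mscale (f y) (\<rho> y))"
    using insert.hyps by (intro sum.cong) (auto simp: g_def)
  finally show ?case using insert.hyps by (simp add: add.commute)
qed

lemma phi_expand': "f \<in> lin_span (carrier G) \<Longrightarrow> \<phi> f = (\<Sum>x | f x \<noteq> 0. mscale (f x) (\<rho> x))"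
  by (rule phi_expand) (auto simp: lin_span_def)

lemma vanishes_on_iff:
  assumes "S \<subseteq> carrier G"
  shows "vanishes_on \<phi> S \<longleftrightarrow> (\<forall>x \<in> S. \<rho> x = 0)"
proof
  assume "vanishes_on \<phi> S"
  thus "\<forall>x \<in> S. \<rho> x = 0" by (simp add: vanishes_on_def \<rho>_def basis_in)
next
  assume z: "\<forall>x \<in> S. \<rho> x = 0"
  have "\<phi> f = 0" if "f \<in> lin_span S" for f
  proof -
    have "f \<in> lin_span (carrier G)" using that assms by (auto simp: lin_span_def)
    hence "\<phi> f = (\<Sum>x | f x \<noteq> 0. mscale (f x) (\<rho> x))" by (rule phi_expand')
    also have "\<dots> = 0" using that z by (intro sum.neutral) (auto simp: lin_span_def)
    finally show ?thesis .
  qed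
  thus "vanishes_on \<phi> S" by (simp add: vanishes_on_def)
qed

text \<open>
  This is the passage to the quotient by \<open>K[I]\<close>, when all basis elements in \<open>I\<close> are killed.
\<close>

lemma phi_eq_off:
  assumes "f \<in> lin_span (carrier G)" "g \<in> lin_span (carrier G)"
    and z: "\<And>x. x \<in> I \<Longrightarrow> \<rho> x = 0" and eq: "\<And>x. x \<notin> I \<Longrightarrow> f x = g x"
  shows "\<phi> f = \<phi> g"
proof -
  define S where "S = {x. f x \<noteq> 0} \<union> {x. g x \<noteq> 0}"
  have S: "finite S" "S \<subseteq> carrier G" using assms(1,2) by (auto simp: S_def lin_span_def)
  have "\<phi> f = (\<Sum>x\<in>S. mscale (f x) (\<rho> x))" by (rule phi_expand[OF S]) (simp add: S_def)
  also have "\<dots> = (\<Sum>x\<in>S. mscale (g x) (\<rho> x))"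
  proof (rule sum.cong[OF HOL.refl])
    fix x assume "x \<in> S"
    show "mscale (f x) (\<rho> x) = mscale (g x) (\<rho> x)" using z[of x] eq[of x] by (cases "x \<in> I") auto
  qed
  also have "\<dots> = \<phi> g" by (rule phi_expand[OF S, symmetric]) (simp add: S_def)
  finally show ?thesis .
qed

end

locale irreducible_monoid_rep = monoid_rep G \<phi>
  for G :: "('m, 'b) monoid_scheme" (structure) and \<phi> :: "('m \<Rightarrow> 'k::field) \<Rightarrow> 'k^'j^'j" +
  assumes irreducible: "irreducible_rep (semigroup_algebra G) \<phi>"
begin

lemma rho_irreducible:
  assumes U: "vec.subspace U" and inv: "\<And>x u. x \<in> carrier G \<Longrightarrow> u \<in> U \<Longrightarrow> \<rho> x *v u \<in> U"
  shows "U = {0} \<or> U = UNIV"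
proof -
  have "\<phi> f *v u \<in> U" if "f \<in> lin_span (carrier G)" "u \<in> U" for f u
    unfolding phi_expand'[OF that(1)] sum_mult_vec mscale_mult_vec using that
    by (intro vec.subspace_sum[OF U] vec.subspace_scale[OF U] inv) (auto simp: lin_span_def)
  thus ?thesis using irreducible U by (simp add: irreducible_rep_def semigroup_algebra_def)
qed

lemma rho_nonzero: "\<exists>x \<in> carrier G. \<rho> x \<noteq> 0"
proof (rule ccontr)
  assume "\<not> ?thesis"
  hence "vanishes_on \<phi> (carrier G)" by (subst vanishes_on_iff) auto
  thus False using irreducible by (auto simp: irreducible_rep_def semigroup_algebra_def vanishes_on_def)
qed

text \<open>
  The element \<open>e\<close> is a lowest one on which the representation does not vanish. If \<open>v\<close> is a vector
  with \<open>\<rho> e v \<noteq> 0\<close>, the line through \<open>\<rho> e v\<close> is invariant under every \<open>\<rho> a\<close>, because \<open>\<rho> a\<close> sends \<open>\<rho> e v\<close>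
  to itself or to zero.
\<close>

lemma one_dimensional:
  assumes e: "e \<in> carrier G" "\<rho> e \<noteq> 0"
    and least: "\<forall>a \<in> carrier G. a \<otimes> e = e \<or> \<rho> (a \<otimes> e) = 0"
  shows "CARD('j) = 1" "e \<otimes> e = e" "\<rho> e = mat 1"
    "\<And>a. a \<in> carrier G \<Longrightarrow> \<rho> a = (if e \<in> two_sided G a then mat 1 else 0)"
proof -
  have bottom: "a \<otimes> e = e \<or> \<rho> (a \<otimes> e) = 0" if "a \<in> carrier G" for a
    using least that by blast
  obtain v where v: "\<rho> e *v v \<noteq> 0" using e(2) matrix_eq[of "\<rho> e" 0] by auto
  define u where "u = \<rho> e *v v"
  have act: "\<rho> a *v u = \<rho> (a \<otimes> e) *v v" if "a \<in> carrier G" for a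
    using rho_mult[OF that e(1)] by (simp add: u_def matrix_vector_mul_assoc)
  have "vec.span {u} = {0} \<or> vec.span {u} = UNIV"
  proof (rule rho_irreducible)
    fix a x assume a: "a \<in> carrier G" and "x \<in> vec.span {u}"
    then obtain c where "x = c *s u" using vec.span_singleton[of u] by auto
    hence "\<rho> a *v x = c *s u \<or> \<rho> a *v x = 0"
      using bottom[OF a] act[OF a] by (auto simp: mult_vec_scale u_def)
    moreover have "c *s u \<in> vec.span {u}" by (intro vec.span_scale vec.span_base) simp
    ultimately show "\<rho> a *v x \<in> vec.span {u}" using vec.span_zero[of "{u}"] by auto
  qed (simp add: vec.subspace_span)
  moreover have "u \<in> vec.span {u}" by (simp add: vec.span_base)
  ultimately have span: "vec.span {u} = UNIV" using v by (auto simp: u_def)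
  have "vec.dim (UNIV :: ('k^'j) set) \<le> card {u}" by (rule vec.dim_le_card) (simp_all add: span)
  hence "CARD('j) \<le> 1" unfolding vec_dim_card by simp
  moreover have "0 < CARD('j)" by simp
  ultimately show "CARD('j) = 1" by linarith
  have scalar: "\<exists>c. x = c *s u" for x
    using vec.span_singleton[of u] span by auto
  have id: "\<rho> a = mat 1" if "a \<in> carrier G" "a \<otimes> e = e" for a
  proof -
    have "\<rho> a *v u = u" using act[OF that(1)] that(2) by (simp add: u_def)
    hence "\<rho> a *v x = mat 1 *v x" for x using scalar[of x] by (auto simp: mult_vec_scale)
    thus ?thesis by (simp add: matrix_eq)
  qed
  have zero: "\<rho> a = 0" if "a \<in> carrier G" "\<rho> (a \<otimes> e) = 0" for a
  proof -
    have "\<rho> a *v u = 0" using act[OF that(1)] that(2) by simp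
    hence "\<rho> a *v x = 0 *v x" for x using scalar[of x] by (auto simp: mult_vec_scale)
    thus ?thesis by (simp add: matrix_eq)
  qed
  show ee: "e \<otimes> e = e" using bottom[OF e(1)] zero[OF e(1)] e(2) by blast
  show "\<rho> e = mat 1" by (rule id[OF e(1) ee])
  fix a assume a: "a \<in> carrier G"
  show "\<rho> a = (if e \<in> two_sided G a then mat 1 else 0)"
  proof (cases "a \<otimes> e = e")
    case True
    hence "e = \<one> \<otimes> a \<otimes> e" using a by simp
    hence "e \<in> two_sided G a" using e(1) unfolding two_sided_def by blast
    thus ?thesis using id[OF a True] by simp
  next
    case False
    hence z: "\<rho> a = 0" using zero[OF a] bottom[OF a] by blast
    have "e \<notin> two_sided G a"
    proof
      assume "e \<in> two_sided G a"
      then obtain x y where "x \<in> carrier G" "y \<in> carrier G" "e = x \<otimes> a \<otimes> y"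
        by (auto simp: two_sided_def)
      hence "\<rho> e = \<rho> x ** \<rho> a ** \<rho> y" using a by (simp add: rho_mult)
      hence "\<rho> e = 0" using z by (simp add: matrix_matrix_mult_def vec_eq_iff)
      thus False using e(2) by simp
    qed
    thus ?thesis using z by simp
  qed
qed

end

section \<open>The representation of a principal factor\<close>

text \<open>
  For \<open>G = C\<^sub>n\<close>, \<open>I = I\<^sub>i\<close> and \<open>s = s\<^sub>i\<close> this is \<open>M\<^sub>i\<close>.
\<close>

abbreviation rees_principal :: "('m, 'b) monoid_scheme \<Rightarrow> 'm set \<Rightarrow> 'm \<Rightarrow> 'm option monoid" where
  "rees_principal G I s \<equiv> (rees_quotient G I)
     \<lparr>carrier := insert None (two_sided (rees_quotient G I) (rees_proj I s))\<rparr>"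

lemma rees_mult:
  "None \<otimes>\<^bsub>rees_quotient G I\<^esub> v = None" "u \<otimes>\<^bsub>rees_quotient G I\<^esub> None = None"
  "Some x \<otimes>\<^bsub>rees_quotient G I\<^esub> Some y = (if x \<otimes>\<^bsub>G\<^esub> y \<in> I then None else Some (x \<otimes>\<^bsub>G\<^esub> y))"
  by (auto simp: rees_quotient_def rees_proj_def split: option.splits)

lemma rees_mult_eq_Some:
  "u \<otimes>\<^bsub>rees_quotient G I\<^esub> v = Some z \<longleftrightarrow>
     (\<exists>x y. u = Some x \<and> v = Some y \<and> z = x \<otimes>\<^bsub>G\<^esub> y \<and> z \<notin> I)"
  by (cases u; cases v) (auto simp: rees_mult)

lemma (in monoid) rees_principal_carrier:
  assumes ideal: "\<And>a x b. a \<in> carrier G \<Longrightarrow> x \<in> I \<Longrightarrow> b \<in> carrier G \<Longrightarrow> a \<otimes> x \<otimes> b \<in> I"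
    and I: "I \<subseteq> carrier G" and s: "s \<in> carrier G"
  shows "carrier (rees_principal G I s) = insert None (Some ` (two_sided G s - I))"
proof -
  have left: "a \<otimes> x \<in> I" if "a \<in> carrier G" "x \<in> I" for a x using ideal[OF that one_closed] that I by auto
  have right: "x \<otimes> b \<in> I" if "b \<in> carrier G" "x \<in> I" for b x using ideal[OF one_closed that(2,1)] that I by auto
  have car: "carrier (rees_quotient G I) = insert None (Some ` (carrier G - I))"
    by (simp add: rees_quotient_def)
  have "Some z \<in> two_sided (rees_quotient G I) (rees_proj I s) \<longleftrightarrow> z \<in> two_sided G s - I" for z
  proof
    assume "Some z \<in> two_sided (rees_quotient G I) (rees_proj I s)"
    then obtain u v where uv: "u \<in> carrier (rees_quotient G I)" "v \<in> carrier (rees_quotient G I)"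
      "u \<otimes>\<^bsub>rees_quotient G I\<^esub> rees_proj I s \<otimes>\<^bsub>rees_quotient G I\<^esub> v = Some z"
      by (auto simp: two_sided_def)
    then obtain w b where "u \<otimes>\<^bsub>rees_quotient G I\<^esub> rees_proj I s = Some w" and b: "v = Some b" "z = w \<otimes> b" "z \<notin> I"
      unfolding rees_mult_eq_Some by blast
    then obtain a where a: "u = Some a" "w = a \<otimes> s"
      unfolding rees_mult_eq_Some by (auto simp: rees_proj_def split: if_splits)
    have "a \<in> carrier G" "b \<in> carrier G" using uv(1,2) a b unfolding car by auto
    thus "z \<in> two_sided G s - I" using a b by (auto simp: two_sided_def)
  next
    assume z: "z \<in> two_sided G s - I"
    then obtain a b where ab: "a \<in> carrier G" "b \<in> carrier G" "z = a \<otimes> s \<otimes> b" by (auto simp: two_sided_def)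
    have as: "a \<otimes> s \<notin> I" using right[OF ab(2)] ab z by auto
    have "a \<notin> I" "s \<notin> I" using as right[OF s] left[OF ab(1)] by auto
    moreover have "b \<notin> I" using left[of "a \<otimes> s" b] ab s z by auto
    ultimately have "Some a \<otimes>\<^bsub>rees_quotient G I\<^esub> rees_proj I s \<otimes>\<^bsub>rees_quotient G I\<^esub> Some b = Some z"
      and "Some a \<in> carrier (rees_quotient G I)" "Some b \<in> carrier (rees_quotient G I)"
      using ab as z by (auto simp: rees_proj_def rees_mult car)
    thus "Some z \<in> two_sided (rees_quotient G I) (rees_proj I s)"
      unfolding two_sided_def by (intro CollectI exI[of _ "Some a"] exI[of _ "Some b"]) simp
  qed
  hence "u \<in> insert None (two_sided (rees_quotient G I) (rees_proj I s)) \<longleftrightarrow>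
      u \<in> insert None (Some ` (two_sided G s - I))" for u
    by (cases u) auto
  thus ?thesis by (simp add: set_eq_iff)
qed

text \<open>
  The representation of the factor is obtained by pulling functions back along \<^const>\<open>Some\<close>. It is
  multiplicative because the products in the monoid algebra and in the contracted algebra differ
  by an element supported on \<open>I\<close>, where \<open>\<phi>\<close> vanishes.
\<close>

lemma induced_on_principal_factor:
  fixes G :: "('m, 'b) monoid_scheme" (structure)
    and \<phi> :: "('m \<Rightarrow> 'k::alg_closed_field) \<Rightarrow> 'k^'j^'j"
  assumes "irreducible_monoid_rep G \<phi>"
    and ideal: "\<And>a x b. a \<in> carrier G \<Longrightarrow> x \<in> I \<Longrightarrow> b \<in> carrier G \<Longrightarrow> a \<otimes> x \<otimes> b \<in> I"
    and I: "I \<subseteq> carrier G" and s: "s \<in> carrier G"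
    and van: "vanishes_on \<phi> I" and nonvan: "\<not> vanishes_on \<phi> (two_sided G s - I)"
  defines "\<psi> \<equiv> \<lambda>g. \<phi> (\<lambda>x. g (Some x))"
    and "A \<equiv> contracted_algebra (rees_principal G I s) None"
  shows "irreducible_rep A \<psi>" "\<psi> ` carrier A = UNIV"
    "\<And>f. f \<in> carrier (semigroup_algebra G) \<Longrightarrow> alg_proj I f \<in> carrier A \<Longrightarrow> \<psi> (alg_proj I f) = \<phi> f"
proof -
  interpret irreducible_monoid_rep G \<phi> by fact
  define T where "T = two_sided G s - I"
  have T: "T \<subseteq> carrier G" using s by (auto simp: T_def two_sided_def)
  have \<rho>I: "\<rho> x = 0" if "x \<in> I" for x using van that by (simp add: vanishes_on_iff[OF I])
  have carA: "carrier A = lin_span (Some ` T)"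
  proof -
    have "insert None (Some ` T) - {None} = Some ` T" by auto
    thus ?thesis using rees_principal_carrier[OF ideal I s]
      by (simp add: A_def contracted_algebra_def T_def)
  qed
  have multA: "(f \<otimes>\<^bsub>A\<^esub> g) = (\<lambda>z. \<Sum>(x, y) \<in> {(x, y). f x \<noteq> 0 \<and> g y \<noteq> 0 \<and>
      x \<otimes>\<^bsub>rees_quotient G I\<^esub> y = z}. f x * g y)(None := 0)" for f g
    by (simp add: A_def contracted_algebra_def semigroup_algebra_def)
  have multG: "(f \<otimes>\<^bsub>semigroup_algebra G\<^esub> g) = (\<lambda>z. \<Sum>(x, y) \<in> {(x, y). f x \<noteq> 0 \<and> g y \<noteq> 0 \<and>
      x \<otimes> y = z}. f x * g y)" for f g :: "'m \<Rightarrow> 'k"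
    by (simp add: semigroup_algebra_def)
  have pull: "(\<lambda>x. g (Some x)) \<in> lin_span T" if "g \<in> carrier A" for g :: "'m option \<Rightarrow> 'k"
  proof -
    have "finite (Some -` {u. g u \<noteq> 0})" using that carA
      by (intro finite_vimageI) (auto simp: lin_span_def)
    thus ?thesis using that carA by (auto simp: lin_span_def vimage_def)
  qed
  hence pullG: "(\<lambda>x. g (Some x)) \<in> lin_span (carrier G)" if "g \<in> carrier A" for g :: "'m option \<Rightarrow> 'k"
    using that T by (fastforce simp: lin_span_def)
  have gNone: "g None = 0" if "g \<in> carrier A" for g :: "'m option \<Rightarrow> 'k"
    using that carA by (auto simp: lin_span_def)
  have mult_Some: "(f \<otimes>\<^bsub>A\<^esub> g) (Some z) =
      (if z \<in> I then 0 else ((\<lambda>x. f (Some x)) \<otimes>\<^bsub>semigroup_algebra G\<^esub> (\<lambda>x. g (Some x))) z)"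
    if "f \<in> carrier A" "g \<in> carrier A" for f g :: "'m option \<Rightarrow> 'k" and z
  proof -
    define P where "P = {(x, y). f x \<noteq> 0 \<and> g y \<noteq> 0 \<and> x \<otimes>\<^bsub>rees_quotient G I\<^esub> y = Some z}"
    define P' where "P' = {(x, y). f (Some x) \<noteq> 0 \<and> g (Some y) \<noteq> 0 \<and> x \<otimes> y = z}"
    have l: "(f \<otimes>\<^bsub>A\<^esub> g) (Some z) = (\<Sum>(x, y)\<in>P. f x * g y)" by (simp add: multA P_def)
    have r: "((\<lambda>x. f (Some x)) \<otimes>\<^bsub>semigroup_algebra G\<^esub> (\<lambda>x. g (Some x))) z =
        (\<Sum>(x, y)\<in>P'. f (Some x) * g (Some y))" by (simp add: multG P'_def)
    show ?thesis
    proof (cases "z \<in> I")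
      case True
      hence "P = {}" by (auto simp: P_def rees_mult_eq_Some)
      thus ?thesis using True l by simp
    next
      case False
      hence "P = map_prod Some Some ` P'"
        by (auto simp: P_def P'_def rees_mult_eq_Some image_iff)
      moreover have "inj_on (map_prod Some Some) P'" by (auto simp: inj_on_def)
      ultimately show ?thesis using False unfolding l r
        by (simp add: sum.reindex case_prod_unfold)
    qed
  qed
  have multG_in: "f \<otimes>\<^bsub>semigroup_algebra G\<^esub> g \<in> lin_span (carrier G)"
    if "f \<in> lin_span (carrier G)" "g \<in> lin_span (carrier G)" for f g :: "'m \<Rightarrow> 'k"
  proof -
    let ?P = "(\<lambda>(x, y). x \<otimes> y) ` ({x. f x \<noteq> 0} \<times> {y. g y \<noteq> 0})"
    have "z \<in> ?P" if "(f \<otimes>\<^bsub>semigroup_algebra G\<^esub> g) z \<noteq> 0" for z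
    proof (rule ccontr)
      assume "z \<notin> ?P"
      hence "{(x, y). f x \<noteq> 0 \<and> g y \<noteq> 0 \<and> x \<otimes> y = z} = {}" by (auto simp: image_iff)
      hence "(f \<otimes>\<^bsub>semigroup_algebra G\<^esub> g) z = 0" unfolding multG by (simp only: sum.empty)
      thus False using that by simp
    qed
    hence sub: "{z. (f \<otimes>\<^bsub>semigroup_algebra G\<^esub> g) z \<noteq> 0} \<subseteq> ?P" by blast
    have "finite ?P" using that by (auto simp: lin_span_def)
    moreover have "?P \<subseteq> carrier G" using that by (auto simp: lin_span_def)
    ultimately show ?thesis using sub finite_subset[OF sub] unfolding lin_span_def by blast
  qed
  have psi_mult: "\<psi> (f \<otimes>\<^bsub>A\<^esub> g) = \<psi> f ** \<psi> g" if fg: "f \<in> carrier A" "g \<in> carrier A" for f g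
  proof -
    let ?p = "(\<lambda>x. f (Some x)) \<otimes>\<^bsub>semigroup_algebra G\<^esub> (\<lambda>x. g (Some x))"
    have p: "?p \<in> lin_span (carrier G)" by (rule multG_in[OF pullG[OF fg(1)] pullG[OF fg(2)]])
    have "(\<lambda>z. if z \<in> I then 0 else ?p z) \<in> lin_span (carrier G)"
      using p by (auto simp: lin_span_def elim!: rev_finite_subset)
    hence "\<phi> (\<lambda>z. if z \<in> I then 0 else ?p z) = \<phi> ?p"
      by (rule phi_eq_off[where I = I, OF _ p]) (auto simp: \<rho>I)
    also have "\<dots> = \<psi> f ** \<psi> g"
      unfolding \<psi>_def by (rule phi_mult[OF pullG[OF fg(1)] pullG[OF fg(2)]])
    finally show ?thesis unfolding \<psi>_def mult_Some[OF fg] .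
  qed
  have add_in: "(f \<oplus>\<^bsub>A\<^esub> g) \<in> carrier A" and psi_add: "\<psi> (f \<oplus>\<^bsub>A\<^esub> g) = \<psi> f + \<psi> g"
    if fg: "f \<in> carrier A" "g \<in> carrier A" for f g
  proof -
    have e: "(f \<oplus>\<^bsub>A\<^esub> g) = (\<lambda>x. f x + g x)"
      by (simp add: A_def contracted_algebra_def semigroup_algebra_def)
    have "{x. f x + g x \<noteq> 0} \<subseteq> {x. f x \<noteq> 0} \<union> {x. g x \<noteq> 0}" by auto
    from finite_subset[OF this] this show "(f \<oplus>\<^bsub>A\<^esub> g) \<in> carrier A"
      using fg unfolding e carA lin_span_def by blast
    show "\<psi> (f \<oplus>\<^bsub>A\<^esub> g) = \<psi> f + \<psi> g" unfolding e \<psi>_def by (rule phi_add[OF pullG[OF fg(1)] pullG[OF fg(2)]])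
  qed
  have scale_in: "(c \<odot>\<^bsub>A\<^esub> f) \<in> carrier A" and psi_scale: "\<psi> (c \<odot>\<^bsub>A\<^esub> f) = mscale c (\<psi> f)"
    if f: "f \<in> carrier A" for f c
  proof -
    have e: "(c \<odot>\<^bsub>A\<^esub> f) = (\<lambda>x. c * f x)"
      by (simp add: A_def contracted_algebra_def semigroup_algebra_def)
    have "{x. c * f x \<noteq> 0} \<subseteq> {x. f x \<noteq> 0}" by auto
    from finite_subset[OF this] this show "(c \<odot>\<^bsub>A\<^esub> f) \<in> carrier A"
      using f unfolding e carA lin_span_def by blast
    show "\<psi> (c \<odot>\<^bsub>A\<^esub> f) = mscale c (\<psi> f)" unfolding e \<psi>_def by (rule phi_scale[OF pullG[OF f]])
  qed
  have left: "c \<otimes> t \<in> T \<or> c \<otimes> t \<in> I" and right: "t \<otimes> c \<in> T \<or> t \<otimes> c \<in> I"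
    if c: "c \<in> carrier G" and t: "t \<in> T" for c t
  proof -
    from t obtain a b where ab: "a \<in> carrier G" "b \<in> carrier G" "t = a \<otimes> s \<otimes> b"
      by (auto simp: T_def two_sided_def)
    have "c \<otimes> t = (c \<otimes> a) \<otimes> s \<otimes> b" "t \<otimes> c = a \<otimes> s \<otimes> (b \<otimes> c)" using ab c s by (simp_all add: m_assoc)
    moreover have "c \<otimes> a \<in> carrier G" "b \<otimes> c \<in> carrier G" using ab c by simp_all
    ultimately have "c \<otimes> t \<in> two_sided G s" "t \<otimes> c \<in> two_sided G s"
      using ab unfolding two_sided_def by blast+
    thus "c \<otimes> t \<in> T \<or> c \<otimes> t \<in> I" "t \<otimes> c \<in> T \<or> t \<otimes> c \<in> I" by (auto simp: T_def)
  qed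
  have mult_in: "(f \<otimes>\<^bsub>A\<^esub> g) \<in> carrier A" if fg: "f \<in> carrier A" "g \<in> carrier A" for f g
  proof -
    let ?h = "f \<otimes>\<^bsub>A\<^esub> g"
    let ?p = "(\<lambda>x. f (Some x)) \<otimes>\<^bsub>semigroup_algebra G\<^esub> (\<lambda>x. g (Some x))"
    have p: "?p \<in> lin_span (carrier G)" by (rule multG_in[OF pullG[OF fg(1)] pullG[OF fg(2)]])
    have "u \<in> Some ` (T \<inter> {z. ?p z \<noteq> 0})" if u: "?h u \<noteq> 0" for u
    proof -
      have "?h None = 0" unfolding multA by simp
      then obtain z where z: "u = Some z" using u by (cases u) auto
      have zI: "z \<notin> I" and pz: "?p z \<noteq> 0" using u unfolding z mult_Some[OF fg] by (auto split: if_splits)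
      have "\<exists>x y. f (Some x) \<noteq> 0 \<and> g (Some y) \<noteq> 0 \<and> x \<otimes> y = z"
      proof (rule ccontr)
        assume "\<not> ?thesis"
        hence "{(x, y). f (Some x) \<noteq> 0 \<and> g (Some y) \<noteq> 0 \<and> x \<otimes> y = z} = {}" by auto
        hence "?p z = 0" unfolding multG by (simp only: sum.empty)
        thus False using pz by simp
      qed
      then obtain x y where "f (Some x) \<noteq> 0" "g (Some y) \<noteq> 0" "x \<otimes> y = z" by blast
      moreover have "x \<in> T" "y \<in> T" using calculation pull[OF fg(1)] pull[OF fg(2)]
        by (auto simp: lin_span_def)
      ultimately have "z \<in> T" using left[of x y] T zI by auto
      thus ?thesis using pz z by simp
    qed
    hence sub: "{u. ?h u \<noteq> 0} \<subseteq> Some ` (T \<inter> {z. ?p z \<noteq> 0})" by blast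
    have "finite (Some ` (T \<inter> {z. ?p z \<noteq> 0}))" using p by (auto simp: lin_span_def)
    from finite_subset[OF sub this] sub show ?thesis unfolding carA lin_span_def by blast
  qed
  have repA: "representation A \<psi>"
    unfolding representation_def using psi_add psi_mult psi_scale by (simp add: mscale_def)
  obtain t where t: "t \<in> T" "\<rho> t \<noteq> 0" using nonvan vanishes_on_iff[OF T] by (auto simp: T_def)
  have basis: "(basis_elem (Some t) :: 'm option \<Rightarrow> 'k) \<in> carrier A" "\<psi> (basis_elem (Some t)) = \<rho> t" if "t \<in> T" for t
  proof -
    show "(basis_elem (Some t) :: 'm option \<Rightarrow> 'k) \<in> carrier A"
      using that by (auto simp: carA lin_span_def basis_elem_def)
    show "\<psi> (basis_elem (Some t)) = \<rho> t" by (simp add: \<psi>_def \<rho>_def basis_elem_def)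
  qed
  have [simp]: "a ** (0 :: 'k^'j^'j) = 0" "0 ** a = 0" for a :: "'k^'j^'j"
    by (simp_all add: matrix_matrix_mult_def vec_eq_iff)
  have absorb: "\<rho> c ** \<rho> x \<in> insert 0 (\<rho> ` T)" "\<rho> x ** \<rho> c \<in> insert 0 (\<rho> ` T)"
    if c: "c \<in> carrier G" and x: "x \<in> T" for c x
  proof -
    have "x \<in> carrier G" using x T by blast
    note rho_mult[OF c this, symmetric] rho_mult[OF this c, symmetric]
    thus "\<rho> c ** \<rho> x \<in> insert 0 (\<rho> ` T)" "\<rho> x ** \<rho> c \<in> insert 0 (\<rho> ` T)"
      using left[OF c x] right[OF c x] \<rho>I by auto
  qed
  have irr: "U = {0} \<or> U = UNIV"
    if U: "vec.subspace U" and inv: "\<And>g u. g \<in> carrier A \<Longrightarrow> u \<in> U \<Longrightarrow> \<psi> g *v u \<in> U" for U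
  proof (rule irreducible_on_ideal[where R = "\<rho> ` carrier G" and Q = "insert 0 (\<rho> ` T)" and ?q0.0 = "\<rho> t"])
    show "W = {0} \<or> W = UNIV" if "vec.subspace W" "\<And>r u. r \<in> \<rho> ` carrier G \<Longrightarrow> u \<in> W \<Longrightarrow> r *v u \<in> W" for W
      using that by (intro rho_irreducible) auto
    show "r ** q \<in> insert 0 (\<rho> ` T)"
      if r: "r \<in> \<rho> ` carrier G" and q: "q \<in> insert 0 (\<rho> ` T)" for r q
    proof -
      from r obtain c where c: "c \<in> carrier G" "r = \<rho> c" by (rule imageE)
      from q show ?thesis using absorb(1)[OF c(1)] unfolding c(2) by (rule_tac insertE) auto
    qed
    show "q ** r \<in> insert 0 (\<rho> ` T)"
      if r: "r \<in> \<rho> ` carrier G" and q: "q \<in> insert 0 (\<rho> ` T)" for r q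
    proof -
      from r obtain c where c: "c \<in> carrier G" "r = \<rho> c" by (rule imageE)
      from q show ?thesis using absorb(2)[OF c(1)] unfolding c(2) by (rule_tac insertE) auto
    qed
    show "\<rho> t \<in> insert 0 (\<rho> ` T)" "\<rho> t \<noteq> 0" using t by auto
    show "vec.subspace U" by fact
    show "q *v u \<in> U" if "q \<in> insert 0 (\<rho> ` T)" "u \<in> U" for q u
      using that inv[OF basis(1)] vec.subspace_0[OF U] by (auto simp: basis(2))
  qed
  show irrA: "irreducible_rep A \<psi>"
    unfolding irreducible_rep_def using repA irr basis[OF t(1)] t(2) by metis
  have "irreducible_matrix_algebra (\<psi> ` carrier A)"
  proof
    fix a b c assume "a \<in> \<psi> ` carrier A"
    then obtain f where f: "f \<in> carrier A" "a = \<psi> f" by (elim imageE) blast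
    show "mscale c a \<in> \<psi> ` carrier A"
      unfolding f(2) psi_scale[OF f(1), symmetric] by (rule imageI) (rule scale_in[OF f(1)])
    assume "b \<in> \<psi> ` carrier A"
    then obtain g where g: "g \<in> carrier A" "b = \<psi> g" by (elim imageE) blast
    show "a + b \<in> \<psi> ` carrier A"
      unfolding f(2) g(2) psi_add[OF f(1) g(1), symmetric] by (rule imageI) (rule add_in[OF f(1) g(1)])
    show "a ** b \<in> \<psi> ` carrier A"
      unfolding f(2) g(2) psi_mult[OF f(1) g(1), symmetric] by (rule imageI) (rule mult_in[OF f(1) g(1)])
  next
    have "\<psi> (basis_elem (Some t)) \<in> \<psi> ` carrier A" by (rule imageI) (rule basis(1)[OF t(1)])
    thus "\<exists>a\<in>\<psi> ` carrier A. a \<noteq> 0" using basis(2)[OF t(1)] t(2) by (intro bexI) simp_all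
    show "U = {0} \<or> U = UNIV"
      if "vec.subspace U" "\<And>a u. a \<in> \<psi> ` carrier A \<Longrightarrow> u \<in> U \<Longrightarrow> a *v u \<in> U" for U
      using that by (intro irr) auto
  qed
  thus "\<psi> ` carrier A = UNIV" by (rule burnside)
  show "\<psi> (alg_proj I f) = \<phi> f" if f: "f \<in> carrier (semigroup_algebra G)" and pf: "alg_proj I f \<in> carrier A" for f
    unfolding \<psi>_def
  proof (rule phi_eq_off[where I = I])
    show "f \<in> lin_span (carrier G)" using f by (simp add: semigroup_algebra_def)
  qed (use pullG[OF pf] \<rho>I in \<open>auto simp: alg_proj_def\<close>)
qed

section \<open>The Hecke--Kiselman monoid and its ideals\<close>

context oriented_cycle begin

definition word_class :: "nat list \<Rightarrow> nat list set" where
  "word_class w = pres_class X (hk_relations n) w"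

lemma mem_word_class_iff: "v \<in> word_class w \<longleftrightarrow> w \<approx> v"
  by (simp add: word_class_def pres_class_def)

lemma word_class_eq_iff: "u \<in> W \<Longrightarrow> v \<in> W \<Longrightarrow> word_class u = word_class v \<longleftrightarrow> u \<approx> v"
proof
  assume "u \<in> W" "v \<in> W" "word_class u = word_class v"
  moreover have "v \<in> word_class v" unfolding mem_word_class_iff by (rule pres_cong.refl[OF \<open>v \<in> W\<close>])
  ultimately have "v \<in> word_class u" by blast
  thus "u \<approx> v" by (simp only: mem_word_class_iff)
next
  assume "u \<approx> v"
  thus "word_class u = word_class v"
    unfolding set_eq_iff mem_word_class_iff by (blast intro: pres_cong.sym pres_cong.trans)
qed

lemma hk_carrier: "carrier (hk n) = word_class ` W"
  by (simp add: hk_def presented_monoid_def word_class_def)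

lemma word_class_in [simp]: "w \<in> W \<Longrightarrow> word_class w \<in> carrier (hk n)"
  by (simp add: hk_carrier)

lemma hk_one: "\<one>\<^bsub>hk n\<^esub> = word_class []"
  by (simp add: hk_def presented_monoid_def word_class_def)

lemma hk_gen_eq: "hk_gen n i = word_class [i]"
  by (simp add: hk_gen_def word_class_def)

lemma hk_mult:
  assumes "u \<in> W" "v \<in> W" shows "word_class u \<otimes>\<^bsub>hk n\<^esub> word_class v = word_class (u @ v)"
proof -
  have e: "word_class (u' @ v') = word_class (u @ v)" if "u' \<in> word_class u" "v' \<in> word_class v" for u' v'
  proof -
    have c: "u \<approx> u'" "v \<approx> v'" using that by (simp_all only: mem_word_class_iff)
    from cong_append[OF this] have "u @ v \<approx> u' @ v'" .
    moreover have "u' @ v' \<in> W" using cong_lists[OF \<open>u @ v \<approx> u' @ v'\<close>] by blast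
    ultimately show ?thesis using assms word_class_eq_iff[of "u @ v" "u' @ v'"] by simp
  qed
  have "u \<in> word_class u" "v \<in> word_class v" unfolding mem_word_class_iff using assms by (auto intro: pres_cong.refl)
  hence "(\<Union>u'\<in>word_class u. \<Union>v'\<in>word_class v. word_class (u' @ v')) = word_class (u @ v)" using e by blast
  thus ?thesis by (simp add: hk_def presented_monoid_def word_class_def)
qed

lemma hk_monoid: "monoid (hk n)"
proof
  fix x y z assume "x \<in> carrier (hk n)" "y \<in> carrier (hk n)" "z \<in> carrier (hk n)"
  then obtain u v w where "u \<in> W" "v \<in> W" "w \<in> W" "x = word_class u" "y = word_class v" "z = word_class w"
    unfolding hk_carrier by (elim imageE) blast
  thus "x \<otimes>\<^bsub>hk n\<^esub> y \<otimes>\<^bsub>hk n\<^esub> z = x \<otimes>\<^bsub>hk n\<^esub> (y \<otimes>\<^bsub>hk n\<^esub> z)"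
    by (simp add: hk_mult)
next
  fix x y assume "x \<in> carrier (hk n)" "y \<in> carrier (hk n)"
  then obtain u v where "u \<in> W" "v \<in> W" "x = word_class u" "y = word_class v"
    unfolding hk_carrier by (elim imageE) blast
  thus "x \<otimes>\<^bsub>hk n\<^esub> y \<in> carrier (hk n)" by (simp add: hk_mult)
next
  fix x assume "x \<in> carrier (hk n)"
  then obtain u where "u \<in> W" "x = word_class u" unfolding hk_carrier by (elim imageE) blast
  thus "\<one>\<^bsub>hk n\<^esub> \<otimes>\<^bsub>hk n\<^esub> x = x" "x \<otimes>\<^bsub>hk n\<^esub> \<one>\<^bsub>hk n\<^esub> = x"
    by (simp_all add: hk_one hk_mult)
qed (simp add: hk_one)

lemma mon_prod_gens: "w \<in> W \<Longrightarrow> mon_prod (hk n) (map (hk_gen n) w) = word_class w"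
proof (induction w)
  case Nil thus ?case by (simp add: mon_prod_def hk_one)
next
  case (Cons i w)
  have "mon_prod (hk n) (map (hk_gen n) (i # w)) = word_class [i] \<otimes>\<^bsub>hk n\<^esub> mon_prod (hk n) (map (hk_gen n) w)"
    by (simp add: mon_prod_def hk_gen_eq)
  also have "\<dots> = word_class (i # w)" using Cons by (simp add: hk_mult)
  finally show ?case .
qed

lemma hk_s_eq: "i + 2 \<le> n \<Longrightarrow> hk_s n i = word_class (s_word i)"
proof -
  assume i: "i + 2 \<le> n"
  have W: "[n] \<in> W" "[1..<i+1] \<in> W" "rev [i+1..<n] \<in> W" using i by (auto simp del: upt_Suc)
  hence "hk_s n i = word_class [n] \<otimes>\<^bsub>hk n\<^esub> word_class [1..<i+1] \<otimes>\<^bsub>hk n\<^esub> word_class (rev [i+1..<n])"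
    unfolding hk_s_def by (simp only: mon_prod_gens hk_gen_eq)
  thus ?thesis using W by (simp add: hk_mult s_word_def del: upt_Suc)
qed

lemma hk_pow: "w \<in> W \<Longrightarrow> word_class w [^]\<^bsub>hk n\<^esub> (m :: nat) = word_class (concat (replicate m w))"
proof (induction m)
  case 0 thus ?case by (simp add: nat_pow_def hk_one)
next
  case (Suc m)
  have "word_class w [^]\<^bsub>hk n\<^esub> Suc m = word_class w [^]\<^bsub>hk n\<^esub> m \<otimes>\<^bsub>hk n\<^esub> word_class w" by (simp add: nat_pow_def)
  also have "\<dots> = word_class (concat (replicate m w) @ w)"
    using Suc concat_replicate_in[of w m] by (simp add: hk_mult)
  also have "concat (replicate m w) @ w = concat (replicate (Suc m) w)"
    using concat_append[of "replicate m w" "[w]"] by (simp add: replicate_append_same)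
  finally show ?case .
qed

lemma two_sided_hk:
  assumes "w \<in> W"
  shows "two_sided (hk n) (word_class w) = {word_class (a @ w @ b) | a b. a \<in> W \<and> b \<in> W}"
proof (intro equalityI subsetI)
  fix x assume "x \<in> two_sided (hk n) (word_class w)"
  then obtain a b where "a \<in> W" "b \<in> W" "x = word_class a \<otimes>\<^bsub>hk n\<^esub> word_class w \<otimes>\<^bsub>hk n\<^esub> word_class b"
    unfolding two_sided_def hk_carrier by blast
  thus "x \<in> {word_class (a @ w @ b) | a b. a \<in> W \<and> b \<in> W}" using assms by (auto simp: hk_mult)
next
  fix x assume "x \<in> {word_class (a @ w @ b) | a b. a \<in> W \<and> b \<in> W}"
  then obtain a b where ab: "a \<in> W" "b \<in> W" "x = word_class (a @ w @ b)" by blast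
  hence "x = word_class a \<otimes>\<^bsub>hk n\<^esub> word_class w \<otimes>\<^bsub>hk n\<^esub> word_class b" using assms by (simp add: hk_mult)
  thus "x \<in> two_sided (hk n) (word_class w)" using word_class_in[OF ab(1)] word_class_in[OF ab(2)]
    unfolding two_sided_def by blast
qed

text \<open>
  An element with more ascents would divide a power of \<open>s\<^sub>i\<close>. For \<open>I\<^sub>i\<^sub>-\<^sub>1\<close> this is the bound on the rank
  that makes \<open>few_ascents_divisible\<close> applicable with \<open>s\<^sub>i\<close>.
\<close>

lemma in_ideal_few_ascents:
  assumes "w \<in> W" "i + 2 \<le> n" "word_class w \<in> hk_ideal_nat n i"
  shows "ascents (word_act w) < n - 1 - i"
proof (rule ccontr)
  assume "\<not> ?thesis"
  hence "n - 1 - i \<le> ascents (word_act w)" by simp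
  from many_ascents_divides_power[OF assms(1,2) this]
  obtain a b m where ab: "a \<in> W" "b \<in> W" "a @ w @ b \<approx> concat (replicate m (s_word i))" by blast
  have s: "s_word i \<in> W" by (rule s_word_in[OF assms(2)])
  have "word_class (a @ w @ b) = hk_s n i [^]\<^bsub>hk n\<^esub> m"
    unfolding hk_s_eq[OF assms(2)] hk_pow[OF s] using ab assms(1) concat_replicate_in[OF s]
    by (subst word_class_eq_iff) auto
  hence "word_class (a @ w @ b) \<in> cyclic_submonoid (hk n) (hk_s n i)" by (auto simp: cyclic_submonoid_def)
  moreover have "word_class (a @ w @ b) \<in> two_sided (hk n) (word_class w)" using ab two_sided_hk[OF assms(1)] by blast
  ultimately show False using assms(3) by (auto simp: hk_ideal_nat_def)
qed

text \<open>
  For \<open>i = n - 2\<close> the rank of \<open>s\<^sub>i\<close> is one, and every map has at least one ascent.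
\<close>

lemma last_ideal_empty: "hk_ideal_nat n (n - 2) = {}"
proof (rule equals0I)
  fix x assume x: "x \<in> hk_ideal_nat n (n - 2)"
  hence "x \<in> carrier (hk n)" by (simp add: hk_ideal_nat_def)
  then obtain w where w: "w \<in> W" "x = word_class w" unfolding hk_carrier by (elim imageE) blast
  have "ascents (word_act w) < n - 1 - (n - 2)"
    using n3 x w by (intro in_ideal_few_ascents) auto
  thus False using ascents_pos[of w] n3 by simp
qed

lemma hk_ideal_nat_ideal:
  assumes "a \<in> carrier (hk n)" "x \<in> hk_ideal_nat n i" "b \<in> carrier (hk n)"
  shows "a \<otimes>\<^bsub>hk n\<^esub> x \<otimes>\<^bsub>hk n\<^esub> b \<in> hk_ideal_nat n i"
proof -
  interpret monoid "hk n" by (rule hk_monoid)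
  have x: "x \<in> carrier (hk n)" using assms(2) by (simp add: hk_ideal_nat_def)
  have "two_sided (hk n) (a \<otimes>\<^bsub>hk n\<^esub> x \<otimes>\<^bsub>hk n\<^esub> b) \<subseteq> two_sided (hk n) x"
  proof
    fix y assume "y \<in> two_sided (hk n) (a \<otimes>\<^bsub>hk n\<^esub> x \<otimes>\<^bsub>hk n\<^esub> b)"
    then obtain c d where cd: "c \<in> carrier (hk n)" "d \<in> carrier (hk n)"
      "y = c \<otimes>\<^bsub>hk n\<^esub> (a \<otimes>\<^bsub>hk n\<^esub> x \<otimes>\<^bsub>hk n\<^esub> b) \<otimes>\<^bsub>hk n\<^esub> d" by (auto simp: two_sided_def)
    hence "y = (c \<otimes>\<^bsub>hk n\<^esub> a) \<otimes>\<^bsub>hk n\<^esub> x \<otimes>\<^bsub>hk n\<^esub> (b \<otimes>\<^bsub>hk n\<^esub> d)" using assms x by (simp add: m_assoc)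
    moreover have "c \<otimes>\<^bsub>hk n\<^esub> a \<in> carrier (hk n)" "b \<otimes>\<^bsub>hk n\<^esub> d \<in> carrier (hk n)"
      using cd assms by simp_all
    ultimately show "y \<in> two_sided (hk n) x" unfolding two_sided_def by blast
  qed
  thus ?thesis using assms x by (auto simp: hk_ideal_nat_def)
qed

lemma two_sided_left:
  assumes "s \<in> carrier (hk n)" "a \<in> carrier (hk n)" "x \<in> two_sided (hk n) s"
  shows "a \<otimes>\<^bsub>hk n\<^esub> x \<in> two_sided (hk n) s"
proof -
  interpret monoid "hk n" by (rule hk_monoid)
  obtain c d where cd: "c \<in> carrier (hk n)" "d \<in> carrier (hk n)" "x = c \<otimes>\<^bsub>hk n\<^esub> s \<otimes>\<^bsub>hk n\<^esub> d"
    using assms(3) by (auto simp: two_sided_def)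
  hence "a \<otimes>\<^bsub>hk n\<^esub> x = (a \<otimes>\<^bsub>hk n\<^esub> c) \<otimes>\<^bsub>hk n\<^esub> s \<otimes>\<^bsub>hk n\<^esub> d" using assms by (simp add: m_assoc)
  moreover have "a \<otimes>\<^bsub>hk n\<^esub> c \<in> carrier (hk n)" using cd assms by simp
  ultimately show ?thesis using cd unfolding two_sided_def by blast
qed

lemma hk_s_in: "i + 2 \<le> n \<Longrightarrow> hk_s n i \<in> carrier (hk n)"
  by (simp only: hk_s_eq word_class_in s_word_in)

lemma hk_ideal_subset: "hk_ideal n k \<subseteq> carrier (hk n)"
proof -
  interpret monoid "hk n" by (rule hk_monoid)
  have "hk_s n 0 \<in> carrier (hk n)" using n3 by (intro hk_s_in) simp
  thus ?thesis by (auto simp: hk_ideal_def hk_ideal_nat_def two_sided_def)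
qed

lemma hk_ideal_left:
  assumes "a \<in> carrier (hk n)" "x \<in> hk_ideal n k"
  shows "a \<otimes>\<^bsub>hk n\<^esub> x \<in> hk_ideal n k"
proof -
  interpret monoid "hk n" by (rule hk_monoid)
  have x: "x \<in> carrier (hk n)" using assms hk_ideal_subset by blast
  have nat: "a \<otimes>\<^bsub>hk n\<^esub> x \<in> hk_ideal_nat n i" if "x \<in> hk_ideal_nat n i" for i
    using hk_ideal_nat_ideal[OF assms(1) that one_closed] assms(1) x by simp
  have "hk_s n 0 \<in> carrier (hk n)" using n3 by (intro hk_s_in) simp
  thus ?thesis using assms nat two_sided_left by (auto simp: hk_ideal_def split: if_splits)
qed

lemma hk_M_carrier:
  assumes "i + 2 \<le> n"
  shows "hk_M n i = rees_principal (hk n) (hk_ideal n (int i)) (hk_s n i)"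
    "hk_M_nonzero n i = two_sided (hk n) (hk_s n i) - hk_ideal n (int i)"
proof -
  interpret monoid "hk n" by (rule hk_monoid)
  show M: "hk_M n i = rees_principal (hk n) (hk_ideal n (int i)) (hk_s n i)"
    by (simp add: hk_M_def Let_def)
  have I: "hk_ideal n (int i) = hk_ideal_nat n i" by (simp add: hk_ideal_def)
  have "carrier (hk_M n i) = insert None (Some ` (two_sided (hk n) (hk_s n i) - hk_ideal n (int i)))"
    unfolding M
    by (rule rees_principal_carrier[OF _ hk_ideal_subset hk_s_in[OF assms]])
       (auto simp: I intro: hk_ideal_nat_ideal)
  thus "hk_M_nonzero n i = two_sided (hk n) (hk_s n i) - hk_ideal n (int i)"
    by (auto simp: hk_M_nonzero_def)
qed

section \<open>Elements of largest displacement\<close>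

text \<open>
  A point that moves down little holds up all points above it, and by periodicity these are all
  points.
\<close>

lemma displacement_bounded:
  assumes "z - 5 * int n < word_act w z"
  shows "displacement (word_act w) \<le> n * (6 * n)"
proof -
  have "nat (y - word_act w y) \<le> 6 * n" for y
  proof -
    define t where "t = (y - z) div int n"
    have r: "0 \<le> (y - z) mod int n" "(y - z) mod int n < int n" using n3 by simp_all
    have "int n * t + (y - z) mod int n = y - z" by (simp add: t_def)
    hence le: "z + int n * t \<le> y" "y < z + int n * t + int n" using r by linarith+
    have "word_act w (z + int n * t) = word_act w z + int n * t"
      by (rule quasi_periodic_mult) (rule word_act_period)
    hence "z + int n * t - 5 * int n < word_act w y" using assms word_act_mono[OF le(1), of w] by linarith
    thus ?thesis using le(2) by simp
  qed
  hence "displacement (word_act w) \<le> (\<Sum>y = 1..int n. 6 * n)" unfolding displacement_def by (intro sum_mono)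
  thus ?thesis by simp
qed

text \<open>
  The elements of \<open>J\<close> with property \<open>P\<close> are not multiples of \<open>s\<^sub>i\<close>, so their displacement is bounded by
  \<open>few_ascents_divisible\<close>. One of maximal displacement is as required: multiplying it by \<open>a\<close> can
  only lower the map, so either the map, and hence the element, stays the same, or the
  displacement grows.
\<close>

lemma ex_bottom_element:
  assumes i: "i + 2 \<le> n" and J: "J \<subseteq> carrier (hk n)"
    and left: "\<And>a x. a \<in> carrier (hk n) \<Longrightarrow> x \<in> J \<Longrightarrow> a \<otimes>\<^bsub>hk n\<^esub> x \<in> J"
    and prev: "0 < i \<Longrightarrow> J \<subseteq> hk_ideal_nat n (i - 1)"
    and ex: "x0 \<in> J" "P x0"
    and away: "\<And>x. x \<in> J \<Longrightarrow> P x \<Longrightarrow> x \<notin> two_sided (hk n) (hk_s n i)"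
  shows "\<exists>e \<in> J. P e \<and> (\<forall>a \<in> carrier (hk n). a \<otimes>\<^bsub>hk n\<^esub> e = e \<or> \<not> P (a \<otimes>\<^bsub>hk n\<^esub> e))"
proof -
  define good where "good w \<longleftrightarrow> w \<in> W \<and> word_class w \<in> J \<and> P (word_class w)" for w
  have bound: "displacement (word_act w) < Suc (n * (6 * n))" if "good w" for w
  proof -
    have w: "w \<in> W" "word_class w \<in> J" "P (word_class w)" using that by (simp_all add: good_def)
    have "\<exists>z. z - 5 * int n < word_act w z"
    proof (rule ccontr)
      assume "\<not> ?thesis"
      hence far: "word_act w z \<le> z - 5 * int n" for z by (simp add: not_less)
      have "ascents (word_act w) \<le> n - 1 - i"
      \<comment> \<open>For \<open>i = 0\<close> nothing is known about \<open>J\<close>, but the rank is \<open>n\<close> only for the identity.\<close>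
      proof (cases "i = 0")
        case True
        have "w \<noteq> []" using far[of 0] n3 by auto
        thus ?thesis using ascents_le[OF w(1)] True by simp
      next
        case False
        have "word_class w \<in> hk_ideal_nat n (i - 1)" using prev w(2) False by auto
        from in_ideal_few_ascents[OF w(1) _ this] show ?thesis using i False by simp
      qed
      from few_ascents_divisible[OF w(1) i this far]
      obtain a b where ab: "a \<in> W" "b \<in> W" "a @ s_word i @ b \<approx> w" by blast
      have s: "s_word i \<in> W" by (rule s_word_in[OF i])
      hence "word_class (a @ s_word i @ b) = word_class w" using ab w(1) by (subst word_class_eq_iff) auto
      hence "word_class w \<in> two_sided (hk n) (hk_s n i)"
        unfolding hk_s_eq[OF i] two_sided_hk[OF s] using ab by blast
      thus False using away[OF w(2,3)] by simp
    qed
    then obtain z where "z - 5 * int n < word_act w z" by blast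
    from displacement_bounded[OF this] show ?thesis by simp
  qed
  obtain w0 where "w0 \<in> W" "x0 = word_class w0" using ex(1) J unfolding hk_carrier by blast
  hence "good w0" using ex by (simp add: good_def)
  hence "\<exists>w. good w \<and> (\<forall>v. good v \<longrightarrow> displacement (word_act v) \<le> displacement (word_act w))"
    by (rule ex_has_greatest_nat[where f = "\<lambda>w. displacement (word_act w)" and b = "Suc (n * (6 * n))"]) (use bound in blast)
  then obtain w where w: "good w" "\<And>v. good v \<Longrightarrow> displacement (word_act v) \<le> displacement (word_act w)" by blast
  have wW: "w \<in> W" "word_class w \<in> J" using w(1) by (simp_all add: good_def)
  have "a \<otimes>\<^bsub>hk n\<^esub> word_class w = word_class w \<or> \<not> P (a \<otimes>\<^bsub>hk n\<^esub> word_class w)" if a: "a \<in> carrier (hk n)" for a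
  proof (rule disjCI)
    assume "\<not> \<not> P (a \<otimes>\<^bsub>hk n\<^esub> word_class w)"
    obtain v where v: "v \<in> W" "a = word_class v" using a unfolding hk_carrier by (elim imageE) blast
    have m: "a \<otimes>\<^bsub>hk n\<^esub> word_class w = word_class (v @ w)" using v wW by (simp add: hk_mult)
    hence "good (v @ w)" using \<open>\<not> \<not> P _\<close> left[OF a wW(2)] v wW by (simp add: good_def)
    hence "\<not> displacement (word_act w) < displacement (word_act (v @ w))" using w(2) by (simp add: not_less)
    moreover have "word_act (v @ w) z \<le> word_act w z" for z by (simp add: word_act_le)
    ultimately have "word_act (v @ w) = word_act w"
      using displacement_less[OF lowering_map_word_act lowering_map_word_act, of "v @ w" w] by blast
    hence "v @ w \<approx> w" using v wW by (subst cong_iff_word_act) auto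
    thus "a \<otimes>\<^bsub>hk n\<^esub> word_class w = word_class w" unfolding m using v wW by (subst word_class_eq_iff) auto
  qed
  thus ?thesis using w(1) by (intro bexI[of _ "word_class w"]) (auto simp: good_def)
qed

end

theorem theorem4p2:
  fixes n :: nat
    and \<phi> :: "(nat list set \<Rightarrow> 'k::alg_closed_field) \<Rightarrow> 'k^'j^'j"
    and i :: int
  assumes "n \<ge> 3"
    and "unital_irreducible_rep (semigroup_algebra (hk n)) \<phi>"
    and "i = (if \<not> vanishes_on \<phi> (hk_ideal n (int n - 3)) then int n - 2
              else Min {k \<in> {-1..int n - 3}. vanishes_on \<phi> (hk_ideal n k)})"
  shows "(i \<ge> 0 \<longrightarrow>
            (\<not> vanishes_on \<phi> (hk_M_nonzero n (nat i)) \<and> (\<exists>\<psi>. induced_by_rep n (nat i) \<phi> \<psi>))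
          \<or> (vanishes_on \<phi> (hk_M_nonzero n (nat i))
             \<and> (\<exists>e \<in> hk_ideal n (i - 1) - hk_ideal n i.
                   one_dim_induced_by n e \<phi> \<and> \<phi> (basis_elem e) = mat 1)))
       \<and> (i = -1 \<longrightarrow>
            (\<exists>e \<in> carrier (hk n) - hk_ideal n (-1).
                one_dim_induced_by n e \<phi> \<and> \<phi> (basis_elem e) = mat 1))"
proof -
  interpret oriented_cycle n by unfold_locales (rule assms(1))
  interpret monoid "hk n" by (rule hk_monoid)
  have irr: "irreducible_rep (semigroup_algebra (hk n)) \<phi>"
    using assms(2) by (simp add: unital_irreducible_rep_def)
  interpret irreducible_monoid_rep "hk n" \<phi>
    by unfold_locales (use irr in \<open>simp_all add: irreducible_rep_def\<close>)
  have van_iff: "vanishes_on \<phi> (hk_ideal n k) \<longleftrightarrow> (\<forall>x \<in> hk_ideal n k. \<rho> x = 0)" for k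
    by (rule vanishes_on_iff[OF hk_ideal_subset])
  have van: "vanishes_on \<phi> (hk_ideal n i)" and i_range: "-1 \<le> i" "i \<le> int n - 2"
    and nonvan: "0 \<le> i \<Longrightarrow> \<not> vanishes_on \<phi> (hk_ideal n (i - 1))"
  proof -
    have "vanishes_on \<phi> (hk_ideal n i) \<and> -1 \<le> i \<and> i \<le> int n - 2 \<and>
      (0 \<le> i \<longrightarrow> \<not> vanishes_on \<phi> (hk_ideal n (i - 1)))"
    proof (cases "vanishes_on \<phi> (hk_ideal n (int n - 3))")
      case False
      hence i: "i = int n - 2" using assms(3) by simp
      have "nat i = n - 2" "i \<noteq> -1" using i n3 by auto
      \<comment> \<open>Here \<open>\<phi>\<close> vanishes on the span of \<open>I\<^sub>n\<^sub>-\<^sub>2\<close> because this ideal is empty.\<close>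
      hence "hk_ideal n i = {}" using last_ideal_empty by (simp add: hk_ideal_def)
      moreover have "i - 1 = int n - 3" using i by simp
      ultimately show ?thesis using False i n3 van_iff[of i] by simp
    next
      case True
      define S where "S = {k \<in> {-1..int n - 3}. vanishes_on \<phi> (hk_ideal n k)}"
      have fin: "finite S" unfolding S_def by (rule finite_subset[of _ "{-1..int n - 3}"]) auto
      have i: "i = Min S" using assms(3) True by (simp add: S_def)
      have "int n - 3 \<in> S" using True n3 by (simp add: S_def)
      hence "i \<in> S" unfolding i using fin by (intro Min_in) auto
      moreover have "i - 1 \<notin> S"
      proof
        assume "i - 1 \<in> S"
        from Min_le[OF fin this] show False by (simp add: i)
      qed
      ultimately show ?thesis by (auto simp: S_def)
    qed
    thus "vanishes_on \<phi> (hk_ideal n i)" "-1 \<le> i" "i \<le> int n - 2"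
      "0 \<le> i \<Longrightarrow> \<not> vanishes_on \<phi> (hk_ideal n (i - 1))" by blast+
  qed
  have zero: "\<rho> x = 0" if "x \<in> hk_ideal n i" for x using van that by (simp add: van_iff)
  have idem: "one_dim_induced_by n e \<phi>" "\<phi> (basis_elem e) = mat 1"
    if e: "e \<in> carrier (hk n)" "\<rho> e \<noteq> 0"
      and bottom: "\<forall>a \<in> carrier (hk n). a \<otimes>\<^bsub>hk n\<^esub> e = e \<or> \<not> \<rho> (a \<otimes>\<^bsub>hk n\<^esub> e) \<noteq> 0" for e
  proof -
    have b: "\<forall>a \<in> carrier (hk n). a \<otimes>\<^bsub>hk n\<^esub> e = e \<or> \<rho> (a \<otimes>\<^bsub>hk n\<^esub> e) = 0"
      using bottom by simp
    note od = one_dimensional[OF e b]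
    show "\<phi> (basis_elem e) = mat 1" using od(3) by (simp add: \<rho>_def)
    have "\<phi> f = mat (idempotent_rep n e f)" if "f \<in> carrier (semigroup_algebra (hk n))" for f
    proof -
      have f: "f \<in> lin_span (carrier (hk n))" using that by (simp add: semigroup_algebra_def)
      hence "\<phi> f = (\<Sum>m | f m \<noteq> 0. mscale (f m) (\<rho> m))" by (rule phi_expand')
      also have "\<dots> = (\<Sum>m | f m \<noteq> 0. mat (f m * (if e \<in> two_sided (hk n) m then 1 else 0)))"
      proof (rule sum.cong[OF HOL.refl])
        fix m assume "m \<in> {m. f m \<noteq> 0}"
        hence "m \<in> carrier (hk n)" using f by (auto simp: lin_span_def)
        from od(4)[OF this] show "mscale (f m) (\<rho> m) = mat (f m * (if e \<in> two_sided (hk n) m then 1 else 0))"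
          by (simp add: mscale_def mat_def vec_eq_iff)
      qed
      also have "\<dots> = mat (idempotent_rep n e f)"
        by (simp add: idempotent_rep_def mat_def vec_eq_iff sum_component)
      finally show ?thesis .
    qed
    thus "one_dim_induced_by n e \<phi>" using od(1,2) e(1) by (simp add: one_dim_induced_by_def)
  qed
  show ?thesis
  proof (intro conjI impI)
    assume "i = -1"
    obtain x0 where x0: "x0 \<in> carrier (hk n)" "\<rho> x0 \<noteq> 0" using rho_nonzero by blast
    have "\<exists>e \<in> carrier (hk n). \<rho> e \<noteq> 0 \<and> (\<forall>a \<in> carrier (hk n). a \<otimes>\<^bsub>hk n\<^esub> e = e \<or> \<not> \<rho> (a \<otimes>\<^bsub>hk n\<^esub> e) \<noteq> 0)"
    proof (rule ex_bottom_element[where i = 0 and P = "\<lambda>x. \<rho> x \<noteq> 0", OF _ _ _ _ x0])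
      show "x \<notin> two_sided (hk n) (hk_s n 0)" if "\<rho> x \<noteq> 0" for x
        using zero[of x] that by (auto simp: \<open>i = -1\<close> hk_ideal_def)
    qed (use n3 in auto)
    then obtain e where e: "e \<in> carrier (hk n)" "\<rho> e \<noteq> 0"
      "\<forall>a \<in> carrier (hk n). a \<otimes>\<^bsub>hk n\<^esub> e = e \<or> \<not> \<rho> (a \<otimes>\<^bsub>hk n\<^esub> e) \<noteq> 0" by blast
    have "e \<notin> hk_ideal n (-1)" using zero[of e] e(2) by (auto simp: \<open>i = -1\<close>)
    thus "\<exists>e \<in> carrier (hk n) - hk_ideal n (-1). one_dim_induced_by n e \<phi> \<and> \<phi> (basis_elem e) = mat 1"
      using idem[OF e] e(1) by blast
  next
    assume "0 \<le> i"
    define k where "k = nat i"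
    have k: "i = int k" "k + 2 \<le> n" using \<open>0 \<le> i\<close> i_range by (auto simp: k_def)
    have Ik: "hk_ideal n (int k) = hk_ideal_nat n k" by (simp add: hk_ideal_def)
    note M = hk_M_carrier[OF k(2)]
    have MG: "hk_M_nonzero n k \<subseteq> carrier (hk n)"
      unfolding M(2) using hk_s_in[OF k(2)] by (auto simp: two_sided_def)
    show "(\<not> vanishes_on \<phi> (hk_M_nonzero n (nat i)) \<and> (\<exists>\<psi>. induced_by_rep n (nat i) \<phi> \<psi>))
          \<or> (vanishes_on \<phi> (hk_M_nonzero n (nat i))
             \<and> (\<exists>e \<in> hk_ideal n (i - 1) - hk_ideal n i.
                   one_dim_induced_by n e \<phi> \<and> \<phi> (basis_elem e) = mat 1))"
    proof (cases "vanishes_on \<phi> (hk_M_nonzero n k)")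
      case False
      have "induced_by_rep n k \<phi> (\<lambda>g. \<phi> (\<lambda>x. g (Some x)))"
      proof -
        have ideal: "a \<otimes>\<^bsub>hk n\<^esub> x \<otimes>\<^bsub>hk n\<^esub> b \<in> hk_ideal n (int k)"
          if "a \<in> carrier (hk n)" "x \<in> hk_ideal n (int k)" "b \<in> carrier (hk n)" for a x b
          using that hk_ideal_nat_ideal unfolding Ik by blast
        have v: "vanishes_on \<phi> (hk_ideal n (int k))" using van k(1) by simp
        have nv: "\<not> vanishes_on \<phi> (two_sided (hk n) (hk_s n k) - hk_ideal n (int k))"
          using False unfolding M(2) .
        have ir: "irreducible_monoid_rep (hk n) \<phi>" by unfold_locales
        note ind = induced_on_principal_factor[OF ir ideal hk_ideal_subset hk_s_in[OF k(2)] v nv]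
        show ?thesis unfolding induced_by_rep_def M(1) using v ind by blast
      qed
      thus ?thesis using False by (auto simp: k_def)
    next
      case True
      have "\<exists>x0 \<in> hk_ideal n (i - 1). \<rho> x0 \<noteq> 0"
        using nonvan[OF \<open>0 \<le> i\<close>] by (simp add: van_iff)
      then obtain x0 where x0: "x0 \<in> hk_ideal n (i - 1)" "\<rho> x0 \<noteq> 0" by blast
      have "\<exists>e \<in> hk_ideal n (i - 1). \<rho> e \<noteq> 0 \<and>
          (\<forall>a \<in> carrier (hk n). a \<otimes>\<^bsub>hk n\<^esub> e = e \<or> \<not> \<rho> (a \<otimes>\<^bsub>hk n\<^esub> e) \<noteq> 0)"
      proof (rule ex_bottom_element[where i = k and P = "\<lambda>x. \<rho> x \<noteq> 0", OF k(2) hk_ideal_subset _ _ x0])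
        show "a \<otimes>\<^bsub>hk n\<^esub> x \<in> hk_ideal n (i - 1)" if "a \<in> carrier (hk n)" "x \<in> hk_ideal n (i - 1)" for a x
          using that by (rule hk_ideal_left)
        show "hk_ideal n (i - 1) \<subseteq> hk_ideal_nat n (k - 1)" if "0 < k"
        proof -
          have "i - 1 \<noteq> -1" "nat (i - 1) = k - 1" using that k(1) by auto
          thus ?thesis by (simp add: hk_ideal_def)
        qed
        show "x \<notin> two_sided (hk n) (hk_s n k)" if "\<rho> x \<noteq> 0" for x
        proof
          assume "x \<in> two_sided (hk n) (hk_s n k)"
          moreover have "x \<notin> hk_ideal n (int k)" using zero[of x] that k(1) by auto
          ultimately have "x \<in> hk_M_nonzero n k" unfolding M(2) by blast
          thus False using True that vanishes_on_iff[OF MG] by blast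
        qed
      qed
      then obtain e where e: "e \<in> hk_ideal n (i - 1)" "\<rho> e \<noteq> 0"
        "\<forall>a \<in> carrier (hk n). a \<otimes>\<^bsub>hk n\<^esub> e = e \<or> \<not> \<rho> (a \<otimes>\<^bsub>hk n\<^esub> e) \<noteq> 0" by blast
      have "e \<in> carrier (hk n)" using e(1) hk_ideal_subset by blast
      from idem[OF this e(2,3)] have "one_dim_induced_by n e \<phi> \<and> \<phi> (basis_elem e) = mat 1" by blast
      moreover have "e \<notin> hk_ideal n i" using zero[of e] e(2) by auto
      ultimately show ?thesis using e(1) True unfolding k_def by blast
    qed
  qed
qed

end
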